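(* Let $\Pi$ be a self-contained $k$-witness problem, suppose that $0 < \epsilon < 1$, $0 < \delta \leq \frac{1}{2}$ and $M \in \mathbb{N}$, and that we have access to a randomised oracle for the decision problem whose error probability is at most some constant $c < \frac{1}{2}$. Then there exists a randomised algorithm which, on an instance of $\Pi$ with universe of size $n$, makes at most $2^{O(k)} \log^3 n \cdot M \log(\delta^{-1})$ calls to this oracle and, with probability at least $1-\delta$, if the total number of witnesses in the instance is exactly $N$, does the following: (1) if $N \leq M$, outputs a number $N'$ such that $(1-\epsilon)N \leq N' \leq N$; (2) if $N \geq M$, outputs either a number $N'$ such that $(1-\epsilon)N \leq N' \leq M$ or ``More than $M$''. Moreover, if there is a randomised algorithm solving the decision version of $\Pi$ (with error probability at most $c < \frac{1}{2}$) in time $g(k)\cdot n^{O(1)}$ for some computable function $g$, then the expected running time of the randomised counting algorithm is bounded by $2^{O(k)}\cdot g(k)\cdot n^{O(1)} \cdot M \cdot \log(\delta^{-1})$.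
   Context: A self-contained $k$-witness problem is one in which an instance consists of a universe $U$ of $n$ elements and a parameter $k$, together with a collection of $k$-element subsets of $U$ called witnesses, such that a decision procedure may be called on any subset $X \subseteq U$ to determine whether some witness of the original instance is contained in $X$. A randomised decision oracle takes $X \subseteq U$ and is intended to return $1$ if some witness $W \subseteq X$ exists and $0$ otherwise; on each call it returns an incorrect answer with probability at most $c$, independently of other calls. *)

theory Defs
  imports "HOL-Probability.Probability" "HOL-Library.Landau_Symbols"
begin

section \<open>Witness problems\<close>

text \<open>
  The universe of an instance is named \<open>{..<usize I}\<close>.  The bit string \<open>descr I\<close> is whatever
  else the instance consists of (a graph, a formula, ...); it determines the witnesses through
  \<open>witnesses \<P>\<close> and is the input of an algorithm for the decision version, but counting algorithms
  see the witnesses only through a decision oracle.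
\<close>

record inst =
  usize :: nat
  param :: nat
  descr :: "bool list"

record problem =
  instances :: "inst set"
  witnesses :: "inst \<Rightarrow> nat set set"

definition witness_problem :: "problem \<Rightarrow> bool" where
  "witness_problem \<P> \<longleftrightarrow>
     (\<forall>I \<in> instances \<P>. \<forall>W \<in> witnesses \<P> I. W \<subseteq> {..<usize I} \<and> card W = param I)"

text \<open>Self-containedness: the decision question makes sense for every subset \<open>X\<close> of the universe.\<close>

definition contains_witness :: "problem \<Rightarrow> inst \<Rightarrow> nat set \<Rightarrow> bool" where
  "contains_witness \<P> I X \<longleftrightarrow> (\<exists>W \<in> witnesses \<P> I. W \<subseteq> X)"

text \<open>
  The answer to the \<open>i\<close>-th call, on \<open>X\<close>, is a fresh sample of \<open>Or i X\<close>; the error probability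
  may vary with \<open>i\<close> and \<open>X\<close>.
\<close>

definition randomised_oracle ::
    "problem \<Rightarrow> inst \<Rightarrow> real \<Rightarrow> (nat \<Rightarrow> nat set \<Rightarrow> bool pmf) \<Rightarrow> bool" where
  "randomised_oracle \<P> I c Or \<longleftrightarrow>
     (\<forall>i. \<forall>X \<subseteq> {..<usize I}. pmf (Or i X) (\<not> contains_witness \<P> I X) \<le> c)"


section \<open>Randomised oracle algorithms with running times\<close>

text \<open>
  A random access machine with addition and truncated subtraction, fair coins and oracle calls,
  presented as a while language.  Memory consists of named arrays of natural numbers; a scalar
  variable is cell 0 of an array.  There is no multiplication, so unit cost is a
  polynomially faithful measure.
\<close>

type_synonym vname = string
type_synonym store = "vname \<Rightarrow> nat \<Rightarrow> nat"

datatype exp = Const nat | Read vname exp | Plus exp exp | Minus exp exp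

primrec val :: "exp \<Rightarrow> store \<Rightarrow> nat" where
  "val (Const m) s = m"
| "val (Read x e) s = s x (val e s)"
| "val (Plus e1 e2) s = val e1 s + val e2 s"
| "val (Minus e1 e2) s = val e1 s - val e2 s"

primrec cost :: "exp \<Rightarrow> nat" where
  "cost (Const m) = 1"
| "cost (Read x e) = 1 + cost e"
| "cost (Plus e1 e2) = 1 + cost e1 + cost e2"
| "cost (Minus e1 e2) = 1 + cost e1 + cost e2"

datatype com =
    Skip
  | Assign vname exp exp
  | Flip vname
  | Query vname vname exp
  | Seq com com
  | Cond exp com com
  | While exp com

record state =
  mem :: store
  elapsed :: nat
  calls :: nat

definition put :: "vname \<Rightarrow> nat \<Rightarrow> nat \<Rightarrow> state \<Rightarrow> state" where
  "put x i v s = s\<lparr>mem := (mem s)(x := (mem s x)(i := v))\<rparr>"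

definition tick :: "nat \<Rightarrow> state \<Rightarrow> state" where
  "tick t s = s\<lparr>elapsed := elapsed s + t\<rparr>"

text \<open>
  The first argument of \<open>exec\<close> is the procedure answering oracle calls: given the number of
  earlier calls and the query set, it returns an answer and the time spent on it.
  \<open>Query r x e\<close> asks about the set with characteristic vector \<open>x[0], ..., x[e - 1]\<close>, writes
  the answer to \<open>r\<close>, and additionally pays for passing that vector.
  Non-termination is the missing probability mass of the subprobability distribution.
\<close>

partial_function (spmf) exec ::
    "(nat \<Rightarrow> nat set \<Rightarrow> (bool \<times> nat) spmf) \<Rightarrow> com \<Rightarrow> state \<Rightarrow> state spmf" where
  "exec Or p s = (case p of
     Skip \<Rightarrow> return_spmf (tick 1 s)
   | Assign x a e \<Rightarrow>
       return_spmf (tick (1 + cost a + cost e) (put x (val a (mem s)) (val e (mem s)) s))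
   | Flip x \<Rightarrow> bind_spmf coin_spmf (\<lambda>b. return_spmf (tick 1 (put x 0 (of_bool b) s)))
   | Query r x e \<Rightarrow>
       bind_spmf (Or (calls s) {i. i < val e (mem s) \<and> mem s x i \<noteq> 0}) (\<lambda>(b, t).
         return_spmf (tick (1 + cost e + val e (mem s) + t)
           ((put r 0 (of_bool b) s)\<lparr>calls := calls s + 1\<rparr>)))
   | Seq p1 p2 \<Rightarrow> bind_spmf (exec Or p1 s) (\<lambda>s'. exec Or p2 s')
   | Cond e p1 p2 \<Rightarrow>
       (if val e (mem s) \<noteq> 0 then exec Or p1 (tick (1 + cost e) s)
        else exec Or p2 (tick (1 + cost e) s))
   | While e p1 \<Rightarrow>
       (if val e (mem s) \<noteq> 0
        then bind_spmf (exec Or p1 (tick (1 + cost e) s)) (\<lambda>s'. exec Or (While e p1) s')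
        else return_spmf (tick (1 + cost e) s)))"

definition start :: "store \<Rightarrow> state" where
  "start m = \<lparr>mem = m, elapsed = 0, calls = 0\<rparr>"

definition array :: "nat list \<Rightarrow> nat \<Rightarrow> nat" where
  "array xs i = (if i < length xs then xs ! i else 0)"

primrec oracle_free :: "com \<Rightarrow> bool" where
  "oracle_free Skip = True"
| "oracle_free (Assign x a e) = True"
| "oracle_free (Flip x) = True"
| "oracle_free (Query r x e) = False"
| "oracle_free (Seq p1 p2) = (oracle_free p1 \<and> oracle_free p2)"
| "oracle_free (Cond e p1 p2) = (oracle_free p1 \<and> oracle_free p2)"
| "oracle_free (While e p) = oracle_free p"

primrec coin_free :: "com \<Rightarrow> bool" where
  "coin_free Skip = True"
| "coin_free (Assign x a e) = True"
| "coin_free (Flip x) = False"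
| "coin_free (Query r x e) = True"
| "coin_free (Seq p1 p2) = (coin_free p1 \<and> coin_free p2)"
| "coin_free (Cond e p1 p2) = (coin_free p1 \<and> coin_free p2)"
| "coin_free (While e p) = coin_free p"

text \<open>For running oracle-free programs; the choice of procedure is irrelevant.\<close>

definition no_oracle :: "nat \<Rightarrow> nat set \<Rightarrow> (bool \<times> nat) spmf" where
  "no_oracle i X = return_pmf None"

definition computable :: "(nat \<Rightarrow> nat) \<Rightarrow> bool" where
  "computable g \<longleftrightarrow> (\<exists>p. oracle_free p \<and> coin_free p \<and>
     (\<forall>k. \<exists>s. exec no_oracle p (start ((\<lambda>_ _. 0)(''k'' := array [k]))) = return_spmf s
              \<and> mem s ''out'' 0 = g k))"

definition expected_time :: "state spmf \<Rightarrow> ennreal" where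
  "expected_time r =
     (\<integral>\<^sup>+ x. (case x of None \<Rightarrow> \<infinity> | Some s \<Rightarrow> of_nat (elapsed s)) \<partial>measure_pmf r)"


section \<open>Decision algorithms\<close>

definition decision_run :: "com \<Rightarrow> inst \<Rightarrow> nat set \<Rightarrow> state spmf" where
  "decision_run p I X = exec no_oracle p (start ((\<lambda>_ _. 0)(
     ''n'' := array [usize I],
     ''k'' := array [param I],
     ''len'' := array [length (descr I)],
     ''inst'' := array (map of_bool (descr I)),
     ''X'' := (\<lambda>i. of_bool (i \<in> X)))))"

definition accepts :: "state \<Rightarrow> bool" where
  "accepts s \<longleftrightarrow> mem s ''out'' 0 \<noteq> 0"

definition solves_decision :: "problem \<Rightarrow> real \<Rightarrow> com \<Rightarrow> bool" where
  "solves_decision \<P> c p \<longleftrightarrow> oracle_free p \<and>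
     (\<forall>I \<in> instances \<P>. \<forall>X \<subseteq> {..<usize I}.
        lossless_spmf (decision_run p I X) \<and>
        spmf (map_spmf accepts (decision_run p I X)) (\<not> contains_witness \<P> I X) \<le> c)"

text \<open>
  Worst-case time \<open>g(k) \<cdot> n\<^sup>a\<close> over all coin flips.  Instances with fewer than two elements are left
  out, as for them \<open>n\<^sup>a\<close> cannot absorb a constant factor.
\<close>

definition decision_time :: "problem \<Rightarrow> com \<Rightarrow> (nat \<Rightarrow> nat) \<Rightarrow> nat \<Rightarrow> bool" where
  "decision_time \<P> p g a \<longleftrightarrow>
     (\<forall>I \<in> instances \<P>. 2 \<le> usize I \<longrightarrow>
        (\<forall>X \<subseteq> {..<usize I}. \<forall>s \<in> set_spmf (decision_run p I X).
           elapsed s \<le> g (param I) * usize I ^ a))"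


section \<open>Counting algorithms\<close>

definition counting_run ::
    "(nat \<Rightarrow> nat set \<Rightarrow> (bool \<times> nat) spmf) \<Rightarrow> com \<Rightarrow> inst \<Rightarrow> state spmf" where
  "counting_run Or p I = exec Or p (start ((\<lambda>_ _. 0)(
     ''n'' := array [usize I],
     ''k'' := array [param I])))"

definition with_oracle :: "(nat \<Rightarrow> nat set \<Rightarrow> bool pmf) \<Rightarrow> com \<Rightarrow> inst \<Rightarrow> state spmf" where
  "with_oracle Or = counting_run (\<lambda>i X. spmf_of_pmf (map_pmf (\<lambda>b. (b, 0)) (Or i X)))"

text \<open>Every oracle call is replaced by a run of the decision algorithm \<open>d\<close>, and charged for it.\<close>

definition with_decision :: "com \<Rightarrow> com \<Rightarrow> inst \<Rightarrow> state spmf" where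
  "with_decision d p I =
     counting_run (\<lambda>i X. map_spmf (\<lambda>s. (accepts s, elapsed s)) (decision_run d I X)) p I"

datatype result = Number nat | More_than_M

definition result :: "state \<Rightarrow> result" where
  "result s = (if mem s ''more'' 0 \<noteq> 0 then More_than_M else Number (mem s ''out'' 0))"

definition good_result :: "real \<Rightarrow> nat \<Rightarrow> nat \<Rightarrow> result \<Rightarrow> bool" where
  "good_result \<epsilon> M N r \<longleftrightarrow>
     (N \<le> M \<longrightarrow> (\<exists>N'. r = Number N' \<and> (1 - \<epsilon>) * real N \<le> real N' \<and> N' \<le> N)) \<and>
     (N \<ge> M \<longrightarrow> (\<exists>N'. r = Number N' \<and> (1 - \<epsilon>) * real N \<le> real N' \<and> N' \<le> M) \<or>
                r = More_than_M)"

end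

theory Submission
  imports Defs "HOL-Library.Nat_Bijection"
begin

text \<open>
  One run performs \<open>2 ^ O(k) \<cdot> log n\<close> rounds.  A round colours the universe at random with \<open>k\<close> colours and
  gives each element a string of \<open>O(log n)\<close> random bits; it then searches a binary tree that refines, one bit and one
  colour at a time, one cell per colour.  A subtree is entered only if the union of its cells
  contains a witness.  A fixed set of \<open>k\<close> elements lies in at most \<open>2 ^ k\<close> nodes per level in expectation, whatever its colours,
  because a set that meets few colours survives in many nodes only with correspondingly small probability.  So
  the search visits \<open>2 ^ O(k) \<cdot> log n\<close> nodes per witness, while every witness is multicoloured and alone in its leaf with probability
  \<open>2 ^ (- O(k))\<close>.  Each question is put to the decision procedure \<open>O(k log n)\<close> times and decided by majority.

  A run is a single loop with a fixed number of iterations, one node each, which bounds the number of calls.  A potential that is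
  linear in the number of nodes yet to be visited shows that a run returns the exact number of witnesses,
  truncated at \<open>M + 1\<close>, with probability at least \<open>3 / 4\<close>; the answer is the value returned by more than half of
  \<open>O(log (1 / \<delta>))\<close> runs.
\<close>

text \<open>Failure is instead bounded by a potential that does not grow in expectation along the
  loop and is capped at 1, the price of every state reached after a wrong vote. Of the three factors
  log n, one comes from the rounds, as each of up to n ^ k witnesses must be hit; one from the depth
  \<open>k * L\<close> of the tree; and one from the votes, as all of 2 ^ O(k) * n ^ O(k) expected
  questions must be decided correctly. The factor \<open>M\<close> is the iteration budget: the
  expected number of nodes is proportional to the number of witnesses, and a run that exhausts a
  budget meant for \<open>M\<close> witnesses reports \<open>M + 1\<close>, which is right if there
  are more. A leaf counts only if it is alive and has at most \<open>k\<close> elements, which makes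
  it a witness itself. With correct votes a run can therefore only miss witnesses, and correct runs
  agree on one value, so a majority of equal results is a meaningful answer.\<close>

type_synonym answerer = "nat \<Rightarrow> nat set \<Rightarrow> (bool \<times> nat) spmf"

lemma exec_simps [simp]:
  "exec Or Skip s = return_spmf (tick 1 s)"
  "exec Or (Assign x a e) s =
     return_spmf (tick (1 + cost a + cost e) (put x (val a (mem s)) (val e (mem s)) s))"
  "exec Or (Flip x) s = bind_spmf coin_spmf (\<lambda>b. return_spmf (tick 1 (put x 0 (of_bool b) s)))"
  "exec Or (Query r x e) s =
     bind_spmf (Or (calls s) {i. i < val e (mem s) \<and> mem s x i \<noteq> 0}) (\<lambda>(b, t).
       return_spmf (tick (1 + cost e + val e (mem s) + t)
         ((put r 0 (of_bool b) s)\<lparr>calls := calls s + 1\<rparr>)))"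
  "exec Or (Seq p1 p2) s = bind_spmf (exec Or p1 s) (exec Or p2)"
  "exec Or (Cond e p1 p2) s =
     (if val e (mem s) \<noteq> 0 then exec Or p1 (tick (1 + cost e) s)
      else exec Or p2 (tick (1 + cost e) s))"
  by (subst exec.simps, simp)+

text \<open>Kept apart from the simp rules: the loop reappears on the right-hand side, so rewriting
  with it would not terminate.\<close>

lemma exec_While:
  "exec Or (While e p) s =
     (if val e (mem s) \<noteq> 0
      then bind_spmf (exec Or p (tick (1 + cost e) s)) (exec Or (While e p))
      else return_spmf (tick (1 + cost e) s))"
  by (subst exec.simps) simp

lemma state_simps [simp]:
  "mem (tick t s) = mem s" "calls (tick t s) = calls s" "elapsed (tick t s) = elapsed s + t"
  "mem (put x i v s) = (mem s)(x := (mem s x)(i := v))"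
  "calls (put x i v s) = calls s" "elapsed (put x i v s) = elapsed s"
  by (simp_all add: tick_def put_def)


section \<open>Programs with counting loops\<close>

abbreviation var :: "vname \<Rightarrow> exp" where
  "var x \<equiv> Read x (Const 0)"

text \<open>
  \<open>PFor i x p\<close> runs \<open>p\<close> with the counter \<open>i\<close> going down from \<open>x - 1\<close> to \<open>0\<close>; queries always
  concern subsets of \<open>{..<n}\<close>.
\<close>

datatype prog =
    PSkip
  | PAssign vname exp exp
  | PFlip vname
  | PQuery vname vname
  | PSeq prog prog (infixr \<open>;;\<close> 60)
  | PIf exp prog prog
  | PFor vname vname prog

primrec com_of :: "prog \<Rightarrow> com" where
  "com_of PSkip = Skip"
| "com_of (PAssign x a e) = Assign x a e"
| "com_of (PFlip x) = Flip x"
| "com_of (PQuery r x) = Query r x (var ''n'')"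
| "com_of (p ;; p') = Seq (com_of p) (com_of p')"
| "com_of (PIf e p p') = Cond e (com_of p) (com_of p')"
| "com_of (PFor i x p) = Seq (Assign i (Const 0) (var x))
     (While (var i) (Seq (Assign i (Const 0) (Minus (var i) (Const 1))) (com_of p)))"

primrec mods :: "prog \<Rightarrow> vname set" where
  "mods PSkip = {}"
| "mods (PAssign x a e) = {x}"
| "mods (PFlip x) = {x}"
| "mods (PQuery r x) = {r}"
| "mods (p ;; p') = mods p \<union> mods p'"
| "mods (PIf e p p') = mods p \<union> mods p'"
| "mods (PFor i x p) = insert i (mods p)"

text \<open>The variables whose values govern the running time: loop bounds, and \<open>n\<close> as
  the length of the vector passed with a query. If a program does not modify them, its worst-case
  cost is a function of the initial store.\<close>

primrec bounds :: "prog \<Rightarrow> vname set" where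
  "bounds PSkip = {}"
| "bounds (PAssign x a e) = {}"
| "bounds (PFlip x) = {}"
| "bounds (PQuery r x) = {''n''}"
| "bounds (p ;; p') = bounds p \<union> bounds p'"
| "bounds (PIf e p p') = bounds p \<union> bounds p'"
| "bounds (PFor i x p) = insert x (bounds p)"

text \<open>A loop body leaves the counter alone, so the number of iterations is fixed on entry,
  whatever the coins and answers are.\<close>

primrec wf_prog :: "prog \<Rightarrow> bool" where
  "wf_prog PSkip = True"
| "wf_prog (PAssign x a e) = True"
| "wf_prog (PFlip x) = True"
| "wf_prog (PQuery r x) = True"
| "wf_prog (p ;; p') = (wf_prog p \<and> wf_prog p')"
| "wf_prog (PIf e p p') = (wf_prog p \<and> wf_prog p')"
| "wf_prog (PFor i x p) = (wf_prog p \<and> i \<notin> mods p)"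

primrec determ :: "prog \<Rightarrow> bool" where
  "determ PSkip = True"
| "determ (PAssign x a e) = True"
| "determ (PFlip x) = False"
| "determ (PQuery r x) = False"
| "determ (p ;; p') = (determ p \<and> determ p')"
| "determ (PIf e p p') = (determ p \<and> determ p')"
| "determ (PFor i x p) = determ p"

primrec downto0 :: "(nat \<Rightarrow> 'a \<Rightarrow> 'a) \<Rightarrow> nat \<Rightarrow> 'a \<Rightarrow> 'a" where
  "downto0 f 0 a = a"
| "downto0 f (Suc j) a = downto0 f j (f j a)"

lemma downto0_inv:
  assumes "P j a" and "\<And>i a. i < j \<Longrightarrow> P (Suc i) a \<Longrightarrow> P i (f i a)"
  shows "P 0 (downto0 f j a)"
  using assms by (induction j arbitrary: a) auto

text \<open>The value on coins and queries is irrelevant.\<close>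

primrec dsem :: "prog \<Rightarrow> store \<Rightarrow> store" where
  "dsem PSkip m = m"
| "dsem (PAssign x a e) m = m(x := (m x)(val a m := val e m))"
| "dsem (PFlip x) m = m"
| "dsem (PQuery r x) m = m"
| "dsem (p ;; p') m = dsem p' (dsem p m)"
| "dsem (PIf e p p') m = (if val e m \<noteq> 0 then dsem p m else dsem p' m)"
| "dsem (PFor i x p) m =
     downto0 (\<lambda>j m. dsem p (m(i := (m i)(0 := j)))) (m x 0) (m(i := (m i)(0 := m x 0)))"

lemma dsem_frame: "x \<notin> mods p \<Longrightarrow> dsem p m x = m x"
proof (induction p arbitrary: m)
  case (PFor i y p)
  show ?case
    unfolding dsem.simps
    by (rule downto0_inv[where P = "\<lambda>j m'. m' x = m x"]) (use PFor in auto)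
qed auto

text \<open>The loop of \<open>PFor\<close> without the initialisation, so that inductions can run
  over the current value of the counter.\<close>

definition loop_of :: "vname \<Rightarrow> prog \<Rightarrow> com" where
  "loop_of i p = While (var i) (Seq (Assign i (Const 0) (Minus (var i) (Const 1))) (com_of p))"

text \<open>Effect of entering the loop body once: the 9 time units are 3 for the guard and 6 for
  the decrement.\<close>

definition dec :: "vname \<Rightarrow> state \<Rightarrow> state" where
  "dec i s = tick 9 (put i 0 (mem s i 0 - 1) s)"

lemma dec_simps [simp]:
  "mem (dec i s) = (mem s)(i := (mem s i)(0 := mem s i 0 - 1))"
  "calls (dec i s) = calls s" "elapsed (dec i s) = elapsed s + 9"
  by (simp_all add: dec_def)

lemma exec_loop_of:
  "exec Or (loop_of i p) s =
     (if mem s i 0 \<noteq> 0 then bind_spmf (exec Or (com_of p) (dec i s)) (exec Or (loop_of i p))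
      else return_spmf (tick 3 s))"
  unfolding loop_of_def
  by (subst exec_While)
    (simp add: dec_def put_def tick_def numeral_eq_Suc)

lemma exec_PFor:
  "exec Or (com_of (PFor i x p)) s =
     exec Or (loop_of i p) (tick 4 (put i 0 (mem s x 0) s))"
  by (simp add: loop_of_def numeral_eq_Suc)

lemma set_exec_Seq:
  "set_spmf (exec Or (Seq p p') s) = (\<Union>s' \<in> set_spmf (exec Or p s). set_spmf (exec Or p' s'))"
  by (simp add: set_bind_spmf o_def bind_UNION)

lemma exec_frame:
  assumes "wf_prog p" "s' \<in> set_spmf (exec Or (com_of p) s)" "x \<notin> mods p"
  shows "mem s' x = mem s x"
  using assms
proof (induction p arbitrary: s s' x)
  case (PSeq p p')
  then obtain s1 where "s1 \<in> set_spmf (exec Or (com_of p) s)" "s' \<in> set_spmf (exec Or (com_of p') s1)"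
    by (auto simp: set_bind_spmf o_def bind_UNION)
  then show ?case
    using PSeq.IH(1)[of s1 s x] PSeq.IH(2)[of s' s1 x] PSeq.prems by simp
next
  case (PFor i y p)
  have "mem s' x = mem s x" if "s' \<in> set_spmf (exec Or (loop_of i p) s)" for s
    using that
  proof (induction "mem s i 0" arbitrary: s)
    case 0
    then show ?case by (subst (asm) exec_loop_of) simp
  next
    case (Suc j)
    then obtain s1 where s1: "s1 \<in> set_spmf (exec Or (com_of p) (dec i s))"
      and s': "s' \<in> set_spmf (exec Or (loop_of i p) s1)"
      by (subst (asm) (3) exec_loop_of) (auto simp: set_bind_spmf o_def bind_UNION)
    have "mem s1 i 0 = mem (dec i s) i 0"
      using PFor.IH[OF _ s1, of i] PFor.prems(1) by simp
    moreover have "mem s1 x = mem s x"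
      using PFor.IH[OF _ s1, of x] PFor.prems by simp
    ultimately show ?case
      using Suc(1)[OF _ s'] Suc(2) by simp
  qed
  from this[of "tick 4 (put i 0 (mem s y 0) s)"] show ?case
    using PFor.prems unfolding exec_PFor by auto
next
  case (PIf e p p')
  then show ?case
    using PIf.IH(1)[of s' "tick (1 + cost e) s" x] PIf.IH(2)[of s' "tick (1 + cost e) s" x]
    by (simp split: if_splits)
qed (auto simp: set_bind_spmf o_def bind_UNION)

lemma exec_det:
  assumes "wf_prog p" "determ p" "s' \<in> set_spmf (exec Or (com_of p) s)"
  shows "mem s' = dsem p (mem s)"
  using assms
proof (induction p arbitrary: s s')
  case (PSeq p p')
  then obtain s1 where "s1 \<in> set_spmf (exec Or (com_of p) s)" "s' \<in> set_spmf (exec Or (com_of p') s1)"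
    by (auto simp: set_bind_spmf o_def bind_UNION)
  then show ?case
    using PSeq.IH(1)[of s1 s] PSeq.IH(2)[of s' s1] PSeq.prems by simp
next
  case (PIf e p p')
  then show ?case
    using PIf.IH(1)[of s' "tick (1 + cost e) s"] PIf.IH(2)[of s' "tick (1 + cost e) s"]
    by (simp split: if_splits)
next
  case (PFor i y p)
  have "mem s' = downto0 (\<lambda>j m. dsem p (m(i := (m i)(0 := j)))) (mem s i 0) (mem s)"
    if "s' \<in> set_spmf (exec Or (loop_of i p) s)" for s
    using that
  proof (induction "mem s i 0" arbitrary: s)
    case 0
    then show ?case by (subst (asm) exec_loop_of) simp
  next
    case (Suc j)
    then obtain s1 where s1: "s1 \<in> set_spmf (exec Or (com_of p) (dec i s))"
      and s': "s' \<in> set_spmf (exec Or (loop_of i p) s1)"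
      by (subst (asm) (3) exec_loop_of) (auto simp: set_bind_spmf o_def bind_UNION)
    have j: "mem s1 i 0 = j"
      using exec_frame[OF _ s1, of i] PFor.prems(1) Suc(2) by simp
    have "mem s1 = dsem p ((mem s)(i := (mem s i)(0 := j)))"
      using PFor.IH[OF _ _ s1] PFor.prems Suc(2) by (metis dec_simps(1) determ.simps(7) diff_Suc_1 wf_prog.simps(7))
    then show ?case
      unfolding Suc(1)[OF j[symmetric] s'] Suc(2)[symmetric] j by simp
  qed
  from this[of "tick 4 (put i 0 (mem s y 0) s)"] show ?case
    using PFor.prems unfolding exec_PFor by auto
qed (auto simp: set_bind_spmf o_def bind_UNION)


section \<open>Worst-case resources\<close>

text \<open>Here \<tau> is the time charged for an answer. Both branches of a conditional are added
  instead of taking the maximum, so that the bound is built from sums and products only.\<close>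

primrec time_bound :: "nat \<Rightarrow> (vname \<Rightarrow> nat) \<Rightarrow> prog \<Rightarrow> nat" where
  "time_bound \<tau> v PSkip = 1"
| "time_bound \<tau> v (PAssign x a e) = 1 + cost a + cost e"
| "time_bound \<tau> v (PFlip x) = 1"
| "time_bound \<tau> v (PQuery r x) = 3 + v ''n'' + \<tau>"
| "time_bound \<tau> v (p ;; p') = time_bound \<tau> v p + time_bound \<tau> v p'"
| "time_bound \<tau> v (PIf e p p') = 1 + cost e + (time_bound \<tau> v p + time_bound \<tau> v p')"
| "time_bound \<tau> v (PFor i x p) = 7 + v x * (9 + time_bound \<tau> v p)"

primrec call_bound :: "(vname \<Rightarrow> nat) \<Rightarrow> prog \<Rightarrow> nat" where
  "call_bound v PSkip = 0"
| "call_bound v (PAssign x a e) = 0"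
| "call_bound v (PFlip x) = 0"
| "call_bound v (PQuery r x) = 1"
| "call_bound v (p ;; p') = call_bound v p + call_bound v p'"
| "call_bound v (PIf e p p') = call_bound v p + call_bound v p'"
| "call_bound v (PFor i x p) = v x * call_bound v p"

definition runs_within :: "answerer \<Rightarrow> prog \<Rightarrow> state \<Rightarrow> nat \<Rightarrow> nat \<Rightarrow> bool" where
  "runs_within Or p s t q \<longleftrightarrow> lossless_spmf (exec Or (com_of p) s) \<and>
     (\<forall>s' \<in> set_spmf (exec Or (com_of p) s).
        elapsed s' \<le> elapsed s + t \<and> calls s' \<le> calls s + q)"

lemma runs_within_Seq:
  assumes "runs_within Or p s t q"
    and "\<And>s'. s' \<in> set_spmf (exec Or (com_of p) s) \<Longrightarrow> runs_within Or p' s' t' q'"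
  shows "runs_within Or (p ;; p') s (t + t') (q + q')"
  using assms unfolding runs_within_def
  by (fastforce simp: set_bind_spmf o_def bind_UNION)

lemma runs_within_mono:
  "runs_within Or p s t q \<Longrightarrow> t \<le> t' \<Longrightarrow> q \<le> q' \<Longrightarrow> runs_within Or p s t' q'"
  unfolding runs_within_def by fastforce

lemma runs_within_bounds:
  assumes "wf_prog p" "bounds p \<inter> mods p = {}" "\<And>x. x \<in> bounds p \<Longrightarrow> mem s x 0 = v x"
    and or: "\<And>i X. X \<subseteq> {..<v ''n''} \<Longrightarrow>
       lossless_spmf (Or i X) \<and> (\<forall>(b, t) \<in> set_spmf (Or i X). t \<le> \<tau>)"
  shows "runs_within Or p s (time_bound \<tau> v p) (call_bound v p)"
  using assms(1-3)
proof (induction p arbitrary: s)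
  case (PQuery r x)
  have "{i. i < mem s ''n'' 0 \<and> mem s x i \<noteq> 0} \<subseteq> {..<v ''n''}"
    using PQuery by auto
  from or[OF this, of "calls s"] show ?case
    using PQuery unfolding runs_within_def
    by (fastforce simp: set_bind_spmf o_def bind_UNION lossless_bind_spmf)
next
  case (PSeq p p')
  have "runs_within Or p s (time_bound \<tau> v p) (call_bound v p)"
    by (rule PSeq.IH) (use PSeq.prems in auto)
  moreover have "runs_within Or p' s' (time_bound \<tau> v p') (call_bound v p')"
    if "s' \<in> set_spmf (exec Or (com_of p) s)" for s'
  proof (rule PSeq.IH)
    show "mem s' x 0 = v x" if "x \<in> bounds p'" for x
    proof -
      have "x \<notin> mods p" using PSeq.prems(2) that by auto
      then show ?thesis
        using exec_frame[OF _ \<open>s' \<in> _\<close>, of x] PSeq.prems that by simp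
    qed
  qed (use PSeq.prems in auto)
  ultimately show ?case
    using runs_within_Seq by simp
next
  case (PIf e p p')
  have "runs_within Or p (tick (1 + cost e) s) (time_bound \<tau> v p) (call_bound v p)"
    by (rule PIf.IH) (use PIf.prems in auto)
  moreover
  have "runs_within Or p' (tick (1 + cost e) s) (time_bound \<tau> v p') (call_bound v p')"
    by (rule PIf.IH) (use PIf.prems in auto)
  ultimately show ?case
    by (cases "val e (mem s) = 0") (simp_all add: runs_within_def Ball_def trans_le_add1 trans_le_add2 add.assoc le_SucI, (force intro: le_trans)+)
next
  case (PFor i x p)
  \<comment> \<open>Generalised to a loop in progress: the counter tells the iterations left, and
    the 3 is the final failing guard.\<close>
  have *: "lossless_spmf (exec Or (loop_of i p) s) \<and>
     (\<forall>s' \<in> set_spmf (exec Or (loop_of i p) s).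
        elapsed s' \<le> elapsed s + 3 + mem s i 0 * (9 + time_bound \<tau> v p) \<and>
        calls s' \<le> calls s + mem s i 0 * call_bound v p)"
    if "\<And>x. x \<in> bounds p \<Longrightarrow> mem s x 0 = v x" for s
    using that
  proof (induction "mem s i 0" arbitrary: s)
    case 0
    then show ?case by (subst (1 2) exec_loop_of) simp
  next
    case (Suc j)
    have ni: "i \<notin> bounds p" using PFor.prems by auto
    have body: "runs_within Or p (dec i s) (time_bound \<tau> v p) (call_bound v p)"
      by (rule PFor.IH) (use PFor.prems Suc.prems ni in auto)
    have frame: "mem s1 y 0 = mem (dec i s) y 0"
      if "s1 \<in> set_spmf (exec Or (com_of p) (dec i s))" "y \<notin> mods p" for s1 y
      using exec_frame[OF _ that] PFor.prems by simp
    have rest: "lossless_spmf (exec Or (loop_of i p) s1) \<and>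
       (\<forall>s' \<in> set_spmf (exec Or (loop_of i p) s1).
        elapsed s' \<le> elapsed s1 + 3 + j * (9 + time_bound \<tau> v p) \<and>
        calls s' \<le> calls s1 + j * call_bound v p)"
      if s1: "s1 \<in> set_spmf (exec Or (com_of p) (dec i s))" for s1
    proof -
      have "mem s1 i 0 = j"
        using frame[OF s1, of i] PFor.prems Suc(2) by simp
      moreover have "mem s1 y 0 = v y" if y: "y \<in> bounds p" for y
      proof -
        have "y \<notin> mods p" "y \<noteq> i" using PFor.prems(2) y ni by auto
        then show ?thesis
          using frame[OF s1, of y] Suc(3)[OF y] by simp
      qed
      ultimately show ?thesis
        using Suc(1)[of s1] by simp
    qed
    have "lossless_spmf (exec Or (loop_of i p) s)"
      by (subst exec_loop_of)
        (use Suc(2) body rest in \<open>simp add: runs_within_def lossless_bind_spmf\<close>)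
    moreover have "elapsed s' \<le> elapsed s + 3 + mem s i 0 * (9 + time_bound \<tau> v p) \<and>
        calls s' \<le> calls s + mem s i 0 * call_bound v p"
      if s': "s' \<in> set_spmf (exec Or (loop_of i p) s)" for s'
    proof -
      obtain s1 where s1: "s1 \<in> set_spmf (exec Or (com_of p) (dec i s))"
        and "s' \<in> set_spmf (exec Or (loop_of i p) s1)"
        using s' Suc(2) by (subst (asm) exec_loop_of)
          (auto simp: set_bind_spmf o_def bind_UNION)
      then show ?thesis
        using rest[OF s1] body s1 unfolding runs_within_def Suc(2)[symmetric]
        by fastforce
    qed
    ultimately show ?case by blast
  qed
  have ni: "i \<notin> bounds p" using PFor.prems by auto
  have x: "mem s x 0 = v x" using PFor.prems by auto
  have "mem (tick 4 (put i 0 (v x) s)) y 0 = v y" if "y \<in> bounds p" for y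
    using PFor.prems(3)[of y] ni that by auto
  from *[OF this] show ?case
    unfolding runs_within_def exec_PFor x by (simp add: algebra_simps)
qed (auto simp: runs_within_def lossless_bind_spmf set_bind_spmf o_def bind_UNION)


section \<open>Expectations\<close>

text \<open>Runs that do not terminate contribute 0, so only upper bounds on failure are drawn from
  \<open>ev\<close>; termination is established separately through
  \<open>runs_within\<close>.\<close>

definition ev :: "answerer \<Rightarrow> prog \<Rightarrow> (store \<Rightarrow> ennreal) \<Rightarrow> state \<Rightarrow> ennreal" where
  "ev Or p \<phi> s = (\<integral>\<^sup>+ s'. \<phi> (mem s') \<partial>measure_spmf (exec Or (com_of p) s))"

lemma nn_integral_bind_spmf:
  "(\<integral>\<^sup>+ y. f y \<partial>measure_spmf (bind_spmf p g)) =
     (\<integral>\<^sup>+ x. (\<integral>\<^sup>+ y. f y \<partial>measure_spmf (g x)) \<partial>measure_spmf p)"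
  by (simp add: measure_spmf_bind nn_integral_bind[where B = "count_space UNIV"] space_subprob_algebra)

lemma nn_integral_spmf_mono:
  assumes "\<And>x. x \<in> set_spmf p \<Longrightarrow> f x \<le> g x"
  shows "(\<integral>\<^sup>+ x. f x \<partial>measure_spmf p) \<le> (\<integral>\<^sup>+ x. g x \<partial>measure_spmf p)"
  by (rule nn_integral_mono_AE) (use assms in \<open>simp add: AE_measure_spmf_iff\<close>)

lemma nn_integral_spmf_le_const:
  assumes "\<And>x. x \<in> set_spmf p \<Longrightarrow> f x \<le> c"
  shows "(\<integral>\<^sup>+ x. f x \<partial>measure_spmf p) \<le> c"
proof -
  have "(\<integral>\<^sup>+ x. f x \<partial>measure_spmf p) \<le> (\<integral>\<^sup>+ x. c \<partial>measure_spmf p)"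
    by (rule nn_integral_spmf_mono[OF assms])
  also have "\<dots> = c * emeasure (measure_spmf p) UNIV"
    by (simp add: space_measure_spmf)
  also have "\<dots> \<le> c * 1"
    by (rule mult_left_mono) (auto simp: measure_spmf.subprob_emeasure_le_1)
  finally show ?thesis by simp
qed

lemma ev_PSeq:
  "ev Or (p ;; p') \<phi> s = (\<integral>\<^sup>+ s'. ev Or p' \<phi> s' \<partial>measure_spmf (exec Or (com_of p) s))"
  by (simp add: ev_def nn_integral_bind_spmf)

lemma ev_mono:
  assumes "wf_prog p"
    and "\<And>m. (\<And>x. x \<notin> mods p \<Longrightarrow> m x = mem s x) \<Longrightarrow> \<phi> m \<le> \<psi> m"
  shows "ev Or p \<phi> s \<le> ev Or p \<psi> s"
  unfolding ev_def
  by (rule nn_integral_spmf_mono, rule assms(2)) (use exec_frame assms(1) in blast)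

lemma ev_le_const:
  assumes "wf_prog p" and "\<And>m. (\<And>x. x \<notin> mods p \<Longrightarrow> m x = mem s x) \<Longrightarrow> \<phi> m \<le> c"
  shows "ev Or p \<phi> s \<le> c"
  unfolding ev_def
  by (rule nn_integral_spmf_le_const, rule assms(2)) (use exec_frame assms(1) in blast)

text \<open>Only an inequality, because the total mass may be below 1.\<close>

lemma ev_add_mult_le:
  "ev Or p (\<lambda>m. a + b * \<phi> m) s \<le> a + b * ev Or p \<phi> s"
proof -
  have "ev Or p (\<lambda>m. a + b * \<phi> m) s =
      (\<integral>\<^sup>+ s'. a \<partial>measure_spmf (exec Or (com_of p) s)) + b * ev Or p \<phi> s"
    by (simp add: ev_def nn_integral_add nn_integral_cmult)
  also have "\<dots> \<le> a + b * ev Or p \<phi> s"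
    by (intro add_right_mono nn_integral_spmf_le_const order_refl)
  finally show ?thesis .
qed

lemma ev_PSeq_le:
  assumes "wf_prog p"
    and "\<And>s'. (\<And>x. x \<notin> mods p \<Longrightarrow> mem s' x = mem s x) \<Longrightarrow> ev Or p' \<phi> s' \<le> \<psi> (mem s')"
  shows "ev Or (p ;; p') \<phi> s \<le> ev Or p \<psi> s"
  unfolding ev_PSeq ev_def[of Or p]
  by (rule nn_integral_spmf_mono, rule assms(2)) (use exec_frame assms(1) in blast)

lemma ev_det_le: 
  assumes "wf_prog p" "determ p" "\<phi> (dsem p (mem s)) \<le> c"
  shows "ev Or p \<phi> s \<le> c"
  unfolding ev_def
  by (rule nn_integral_spmf_le_const) (use exec_det[OF assms(1,2)] assms(3) in force)

lemma ev_det_PSeq_le: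
  assumes "wf_prog p" "determ p"
    and "\<And>s'. mem s' = dsem p (mem s) \<Longrightarrow> ev Or p' \<phi> s' \<le> c"
  shows "ev Or (p ;; p') \<phi> s \<le> c"
  unfolding ev_PSeq
  by (rule nn_integral_spmf_le_const, rule assms(3)) (use exec_det[OF assms(1,2)] in force)

lemma ev_PSeq_det_le:
  assumes "wf_prog p'" "determ p'"
  shows "ev Or (p ;; p') \<phi> s \<le> ev Or p (\<lambda>m. \<phi> (dsem p' m)) s"
  unfolding ev_PSeq ev_def[of Or p]
  by (rule nn_integral_spmf_mono, rule ev_det_le) (use assms in auto)

lemma ev_PIf:
  "ev Or (PIf e p p') \<phi> s =
     (if val e (mem s) \<noteq> 0 then ev Or p \<phi> (tick (1 + cost e) s)
      else ev Or p' \<phi> (tick (1 + cost e) s))"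
  by (simp add: ev_def)

text \<open>The potential \<open>J j\<close> refers to the moment when \<open>j\<close> iterations remain.\<close>

lemma ev_PFor_le:
  assumes wf: "wf_prog (PFor i x p)"
    and J_cnt: "\<And>j m v. J j (m(i := (m i)(0 := v))) = J j m"
    and body: "\<And>j s. j < mem s0 x 0 \<Longrightarrow> mem s i 0 = j \<Longrightarrow> 
        (\<And>y. y \<notin> insert i (mods p) \<Longrightarrow> mem s y = mem s0 y) \<Longrightarrow>
        ev Or p (J j) s \<le> J (Suc j) (mem s)"
  shows "ev Or (PFor i x p) (J 0) s0 \<le> J (mem s0 x 0) (mem s0)"
proof -
  have *: "(\<integral>\<^sup>+ s'. J 0 (mem s') \<partial>measure_spmf (exec Or (loop_of i p) s)) \<le> J (mem s i 0) (mem s)"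
    if "mem s i 0 \<le> mem s0 x 0" "\<And>y. y \<notin> insert i (mods p) \<Longrightarrow> mem s y = mem s0 y" for s
    using that
  proof (induction "mem s i 0" arbitrary: s)
    case 0
    then show ?case by (subst exec_loop_of) (simp add: measure_spmf_return_spmf nn_integral_return)
  next
    case (Suc j)
    have "(\<integral>\<^sup>+ s'. J 0 (mem s') \<partial>measure_spmf (exec Or (loop_of i p) s)) =
      (\<integral>\<^sup>+ s1. (\<integral>\<^sup>+ s'. J 0 (mem s') \<partial>measure_spmf (exec Or (loop_of i p) s1))
         \<partial>measure_spmf (exec Or (com_of p) (dec i s)))"
      by (subst exec_loop_of) (simp add: Suc(2)[symmetric] nn_integral_bind_spmf)
    also have "\<dots> \<le> (\<integral>\<^sup>+ s1. J j (mem s1) \<partial>measure_spmf (exec Or (com_of p) (dec i s)))"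
    proof (rule nn_integral_spmf_mono)
      fix s1 assume s1: "s1 \<in> set_spmf (exec Or (com_of p) (dec i s))"
      have fr: "mem s1 y = mem (dec i s) y" if "y \<notin> mods p" for y
        using exec_frame[OF _ s1 that] wf by simp
      have "mem s1 i 0 = j"
        using fr[of i] wf Suc(2) by simp
      with Suc(1)[of s1] show "(\<integral>\<^sup>+ s'. J 0 (mem s') \<partial>measure_spmf (exec Or (loop_of i p) s1))
           \<le> J j (mem s1)"
        using fr Suc(2-4) by simp
    qed
    also have "\<dots> = ev Or p (J j) (dec i s)" by (simp add: ev_def)
    also have "\<dots> \<le> J (Suc j) (mem (dec i s))"
      by (rule body) (use Suc(2-4) in auto)
    also have "\<dots> = J (mem s i 0) (mem s)" using J_cnt Suc(2) by simp
    finally show ?case .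
  qed
  show ?thesis
    unfolding ev_def exec_PFor
    using *[of "tick 4 (put i 0 (mem s0 x 0) s0)"] J_cnt by simp
qed

lemma ev_PFlip: "ev Or (PFlip x) \<phi> s =
   (\<phi> ((mem s)(x := (mem s x)(0 := 0))) + \<phi> ((mem s)(x := (mem s x)(0 := 1)))) / 2"
  by (simp add: ev_def nn_integral_bind_spmf measure_spmf_return_spmf nn_integral_return
      nn_integral_spmf_of_set UNIV_bool add.commute)

section \<open>Depth-first search in a binary tree\<close>

text \<open>
  A node of the complete binary tree is a depth \<open>d\<close> together with a path, a sequence of which only the
  first \<open>d\<close> entries matter.  \<open>trav\<close> lists, with their labels \<open>A d p\<close>, the nodes visited by a depth-first search that
  enters the children of a node only if its label satisfies \<open>al\<close>.
\<close>

primrec trav :: "('a \<Rightarrow> bool) \<Rightarrow> (nat \<Rightarrow> (nat \<Rightarrow> nat) \<Rightarrow> 'a) \<Rightarrow> nat \<Rightarrow> nat \<Rightarrow> (nat \<Rightarrow> nat) \<Rightarrow> (nat \<times> 'a) list"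
  where
  "trav al A 0 d p = [(d, A d p)]"
| "trav al A (Suc r) d p = (d, A d p) #
     (if al (A d p) then trav al A r (Suc d) (p(d := 0)) @ trav al A r (Suc d) (p(d := 1)) else [])"

text \<open>The depth that backtracking from depth \<open>d\<close> arrives at.\<close>

primrec shed :: "(nat \<Rightarrow> nat) \<Rightarrow> nat \<Rightarrow> nat" where
  "shed p 0 = 0"
| "shed p (Suc d) = (if p d = 0 then Suc d else shed p d)"

lemma shed_le: "shed p d \<le> d"
  by (induction d) (auto intro: le_SucI)

lemma shed_eq_Suc: "shed p d = Suc i \<Longrightarrow> p i = 0"
  by (induction d) (auto split: if_splits)

locale tree_search =
  fixes al :: "'a \<Rightarrow> bool" and A :: "nat \<Rightarrow> (nat \<Rightarrow> nat) \<Rightarrow> 'a" and D :: nat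
  assumes A_cong: "\<And>d p p'. (\<And>e. e < d \<Longrightarrow> p e = p' e) \<Longrightarrow> A d p = A d p'"
begin

lemma trav_cong: "(\<And>e. e < d \<Longrightarrow> p e = p' e) \<Longrightarrow> trav al A r d p = trav al A r d p'"
proof (induction r arbitrary: d p p')
  case 0
  then show ?case using A_cong[of d p p'] by simp
next
  case (Suc r)
  have "A d p = A d p'" using A_cong[of d p p'] Suc.prems by simp
  moreover have "trav al A r (Suc d) (p(d := b)) = trav al A r (Suc d) (p'(d := b))" for b
    by (rule Suc.IH) (use Suc.prems in \<open>auto simp: less_Suc_eq\<close>)
  ultimately show ?case by simp
qed

text \<open>The part of the search that is still to come when the subtree below \<open>(d, p)\<close> is finished.\<close>

primrec siblings :: "nat \<Rightarrow> (nat \<Rightarrow> nat) \<Rightarrow> (nat \<times> 'a) list" where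
  "siblings 0 p = []"
| "siblings (Suc d) p =
     (if p d = 0 then trav al A (D - Suc d) (Suc d) (p(d := 1)) else []) @ siblings d p"

text \<open>Depth and path determine the entire remaining search, beginning with the node about to
  be visited; this is why the program needs no stack.\<close>

definition pending :: "nat \<Rightarrow> (nat \<Rightarrow> nat) \<Rightarrow> (nat \<times> 'a) list" where
  "pending d p = trav al A (D - d) d p @ siblings d p"

lemma siblings_cong: "(\<And>e. e < d \<Longrightarrow> p e = p' e) \<Longrightarrow> siblings d p = siblings d p'"
proof (induction d)
  case (Suc d)
  have "trav al A r (Suc d) (p(d := 1)) = trav al A r (Suc d) (p'(d := 1))" for r
    by (rule trav_cong) (use Suc.prems in auto)
  with Suc show ?case by simp
qed simp

text \<open>A nonzero entry on the path says that the second child is being explored, so nothing is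
  pending at that level and backtracking may skip it.\<close>

lemma siblings_shed: "siblings d p = siblings (shed p d) p"
  by (induction d) auto

text \<open>Together with \<open>pending_finish\<close>, \<open>siblings_0\<close> and
  \<open>siblings_Suc\<close> this shows that each move of the search removes exactly the head of
  the pending list.\<close>

lemma pending_descend:
  assumes "d < D" "al (A d p)"
  shows "pending d p = (d, A d p) # pending (Suc d) (p(d := 0))"
proof -
  have "D - d = Suc (D - Suc d)" using assms by simp
  moreover have "siblings d (p(d := 0)) = siblings d p"
    by (rule siblings_cong) simp
  ultimately show ?thesis
    using assms by (simp add: pending_def)
qed

lemma pending_finish:
  assumes "d = D \<or> \<not> al (A d p)" "d \<le> D"
  shows "pending d p = (d, A d p) # siblings d p"
proof (cases "D - d")
  case 0
  then show ?thesis by (simp add: pending_def)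
next
  case (Suc r)
  with assms have "\<not> al (A d p)" by auto
  with Suc show ?thesis by (simp add: pending_def)
qed

lemma siblings_0: "shed p d = 0 \<Longrightarrow> siblings d p = []"
  using siblings_shed[of d p] by simp

lemma siblings_Suc:
  assumes "shed p d = Suc i"
  shows "siblings d p = pending (Suc i) (p(i := 1))"
proof -
  have "siblings i (p(i := 1)) = siblings i p"
    by (rule siblings_cong) simp
  then show ?thesis
    using siblings_shed[of d p] shed_eq_Suc[OF assms] assms by (simp add: pending_def)
qed

lemma trav_reach:
  assumes "\<And>e. b e \<in> {0, 1}" "\<And>d. d < D \<Longrightarrow> al (A d b)" "\<And>e. e < d \<Longrightarrow> p e = b e" "d \<le> D"
  shows "(D, A D b) \<in> set (trav al A (D - d) d p)"
  using assms(3,4)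
proof (induction "D - d" arbitrary: d p)
  case 0
  then show ?case using A_cong[of d p b] by simp
next
  case (Suc r)
  have "al (A d p)" using A_cong[of d p b] assms(2)[of d] Suc by simp
  moreover have "(D, A D b) \<in> set (trav al A (D - Suc d) (Suc d) (p(d := b d)))"
    by (rule Suc(1)) (use Suc(2-) in \<open>auto simp: less_Suc_eq\<close>)
  moreover have "D - Suc d = r" using Suc(2) by simp
  ultimately show ?case
    using assms(1)[of d] unfolding Suc(2)[symmetric] by auto
qed

end

text \<open>The last level is left out, because only a node whose children may be entered has to be
  charged.\<close>

primrec visits :: "(nat \<Rightarrow> (nat \<Rightarrow> nat) \<Rightarrow> bool) \<Rightarrow> nat \<Rightarrow> nat \<Rightarrow> (nat \<Rightarrow> nat) \<Rightarrow> nat" where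
  "visits P 0 d p = 0"
| "visits P (Suc r) d p =
     of_bool (P d p) + visits P r (Suc d) (p(d := 0)) + visits P r (Suc d) (p(d := 1))"

text \<open>Apart from the root, every visited node is one of the two children of an inner node
  satisfying \<open>al\<close>, and such a node is charged to some \<open>W\<close> that justifies
  \<open>al\<close>.\<close>

lemma length_trav_le:
  assumes "finite \<W>" "\<And>a. al a \<longleftrightarrow> (\<exists>W \<in> \<W>. Q W a)"
  shows "length (trav al A r d p) \<le> 1 + 2 * (\<Sum>W\<in>\<W>. visits (\<lambda>d p. Q W (A d p)) r d p)"
proof (induction r arbitrary: d p)
  case (Suc r)
  show ?case
  proof (cases "al (A d p)")
    case True
    then obtain W where W: "W \<in> \<W>" "Q W (A d p)" using assms(2) by blast
    then have "1 \<le> (\<Sum>W\<in>\<W>. of_bool (Q W (A d p)) :: nat)"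
      using sum_mono2[of \<W> "{W}" "\<lambda>W. of_bool (Q W (A d p)) :: nat"] assms(1) by simp
    with Suc.IH[of "Suc d" "p(d := 0)"] Suc.IH[of "Suc d" "p(d := 1)"] True show ?thesis
      by (simp add: sum.distrib del: fun_upd_apply)
  qed simp
qed simp

text \<open>Double counting: there are 2 ^ e nodes \<open>e\<close> levels further down, and each of
  them is counted for at most \<open>F (d0 + e)\<close> of the \<open>Y\<close>.\<close>

lemma sum_visits_le:
  fixes F :: "nat \<Rightarrow> real"
  assumes "finite \<Y>" "\<And>d p. d < d0 + r \<Longrightarrow> real (card {Y \<in> \<Y>. P Y d p}) \<le> F d"
  shows "(\<Sum>Y\<in>\<Y>. real (visits (P Y) r d0 p)) \<le> (\<Sum>e<r. 2 ^ e * F (d0 + e))"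
  using assms(2)
proof (induction r arbitrary: d0 p)
  case (Suc r)
  have "(\<Sum>Y\<in>\<Y>. of_bool (P Y d0 p) :: real) = real (card {Y \<in> \<Y>. P Y d0 p})"
    using assms(1) by (simp add: of_bool_def sum.If_cases Int_def)
  also have "\<dots> \<le> F d0" using Suc.prems by simp
  moreover have "(\<Sum>Y\<in>\<Y>. real (visits (P Y) r (Suc d0) p')) \<le> (\<Sum>e<r. 2 ^ e * F (Suc d0 + e))" for p'
    by (rule Suc.IH) (use Suc.prems in auto)
  from this[of "p(d0 := 0)"] this[of "p(d0 := 1)"]
  have "(\<Sum>Y\<in>\<Y>. real (visits (P Y) r (Suc d0) (p(d0 := 0)))) +
      (\<Sum>Y\<in>\<Y>. real (visits (P Y) r (Suc d0) (p(d0 := 1)))) \<le>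
      (\<Sum>e<r. 2 ^ Suc e * F (Suc d0 + e))"
    by (simp add: sum_distrib_left[symmetric] mult.assoc del: fun_upd_apply)
  ultimately show ?case
    by (simp add: sum.distrib sum.lessThan_Suc_shift del: sum.lessThan_Suc fun_upd_apply)
qed simp


section \<open>Counting bit strings\<close>

text \<open>The bits outside \<open>Z\<close> determine those inside. With bit strings as sets this
  is the form in which all upper bounds on probabilities are obtained.\<close>

lemma card_determined_le:
  assumes "finite U" "Z \<subseteq> U"
    and "\<And>Y Y'. P Y \<Longrightarrow> P Y' \<Longrightarrow> Y \<subseteq> U \<Longrightarrow> Y' \<subseteq> U \<Longrightarrow> Y - Z = Y' - Z \<Longrightarrow> Y = Y'"
  shows "card {Y \<in> Pow U. P Y} \<le> 2 ^ (card U - card Z)"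
proof -
  have "inj_on (\<lambda>Y. Y - Z) {Y \<in> Pow U. P Y}"
    using assms(3) by (auto intro!: inj_onI)
  moreover have "(\<lambda>Y. Y - Z) ` {Y \<in> Pow U. P Y} \<subseteq> Pow (U - Z)" by auto
  ultimately have "card {Y \<in> Pow U. P Y} \<le> card (Pow (U - Z))"
    using assms(1) by (intro card_inj_on_le) auto
  also have "\<dots> = 2 ^ (card U - card Z)"
    using assms(1,2) by (simp add: card_Pow card_Diff_subset finite_subset)
  finally show ?thesis .
qed

lemma card_cylinder:
  assumes "finite U" "Z \<subseteq> U" "Q \<subseteq> Z"
  shows "card {Y \<in> Pow U. Y \<inter> Z = Q} = 2 ^ (card U - card Z)"
proof -
  have "{Y \<in> Pow U. Y \<inter> Z = Q} = (\<lambda>X. X \<union> Q) ` Pow (U - Z)"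
  proof (intro set_eqI iffI)
    fix Y assume "Y \<in> {Y \<in> Pow U. Y \<inter> Z = Q}"
    then have "Y = (Y - Z) \<union> Q" "Y - Z \<in> Pow (U - Z)" by auto
    then show "Y \<in> (\<lambda>X. X \<union> Q) ` Pow (U - Z)" by blast
  qed (use assms in auto)
  moreover have "inj_on (\<lambda>X. X \<union> Q) (Pow (U - Z))"
    using assms by (auto intro!: inj_onI)
  ultimately show ?thesis
    using assms by (simp add: card_image card_Pow card_Diff_subset finite_subset)
qed

lemma set_decode_less:
  assumes "a < 2 ^ m" shows "set_decode a \<subseteq> {..<m}"
proof
  fix i assume "i \<in> set_decode a"
  then have "2 ^ i \<le> a"
    by (auto simp: set_decode_def intro: ccontr)
  then have "(2::nat) ^ i < 2 ^ m" using assms by linarith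
  then show "i \<in> {..<m}" by simp
qed

text \<open>By (1 + 1 / k) ^ k \<le> e \<le> 4. It turns the probability k! / (2 k) ^ k of a rainbow
  colouring into 8 ^ (- k).\<close>

lemma power_self_le: "k ^ k \<le> 4 ^ k * (fact k :: nat)"
proof (induction k)
  case (Suc k)
  have "(Suc k) ^ k \<le> 4 * k ^ k"
  proof (cases "k = 0")
    case False
    have "(1 + 1 / real k) ^ k \<le> exp (1 / real k) ^ k"
      by (intro power_mono) (auto simp: exp_ge_add_one_self)
    also have "\<dots> = exp 1" using False by (simp flip: exp_of_nat_mult)
    also have "\<dots> \<le> 4" using exp_le by linarith
    finally have "(1 + 1 / real k) ^ k * real k ^ k \<le> 4 * real k ^ k"
      by (intro mult_right_mono) auto
    moreover have "(1 + 1 / real k) * real k = real (Suc k)"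
      using False by (simp add: field_simps)
    ultimately have "real (Suc k) ^ k \<le> 4 * real k ^ k"
      by (metis power_mult_distrib)
    then have "real (Suc k ^ k) \<le> real (4 * k ^ k)" by simp
    then show ?thesis unfolding of_nat_le_iff .
  qed simp
  then have "Suc k ^ Suc k \<le> Suc k * (4 * k ^ k)"
    unfolding power_Suc by (rule mult_left_mono) simp
  also have "\<dots> \<le> Suc k * (4 * (4 ^ k * fact k))"
    using Suc by (intro mult_left_mono) auto
  finally show ?case by (simp add: algebra_simps)
qed simp


section \<open>Random colourings with random cells\<close>

text \<open>
  A bit string, given by the set \<open>Y\<close> of its positions carrying a one, assigns to each element \<open>v\<close> of the
  universe a row of \<open>m + k L\<close> bits: an \<open>m\<close>-bit colour and one bit for every depth.  The bit for depth
  \<open>e\<close> is used only if \<open>e mod k\<close> is the colour of \<open>v\<close>.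
\<close>

locale colouring =
  fixes n k m L :: nat
begin

definition S :: nat where "S = n * (m + k * L)"

text \<open>The rows are stored in reverse order of the elements, because the counter of
  \<open>compute_X\<close> runs downwards while the tape is read forwards.\<close>

definition pos :: "nat \<Rightarrow> nat \<Rightarrow> nat" where
  "pos v j = (n - Suc v) * (m + k * L) + j"

text \<open>A number of \<open>m\<close> bits. Since 2 ^ m may exceed \<open>k\<close>, some values
  are not valid colours; \<open>matching\<close> drops the elements that receive them.\<close>

definition colour :: "nat set \<Rightarrow> nat \<Rightarrow> nat" where
  "colour Y v = set_encode {i. i < m \<and> pos v i \<in> Y}"

definition matching :: "nat set \<Rightarrow> nat \<Rightarrow> (nat \<Rightarrow> nat) \<Rightarrow> nat set" where
  "matching Y d p = {v. v < n \<and> colour Y v < k \<and>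
     (\<forall>e < d. e mod k = colour Y v \<longrightarrow> of_bool (pos v (m + e) \<in> Y) = p e)}"

lemma matching_cong: "(\<And>e. e < d \<Longrightarrow> p e = p' e) \<Longrightarrow> matching Y d p = matching Y d p'"
  by (auto simp: matching_def)

lemma pos_less:
  assumes "v < n" "j < m + k * L" shows "pos v j < S"
proof -
  have "pos v j < Suc (n - Suc v) * (m + k * L)"
    using assms by (simp add: pos_def)
  also have "\<dots> \<le> S"
    unfolding S_def using assms by (intro mult_right_mono) auto
  finally show ?thesis .
qed

lemma pos_eq_iff:
  assumes "v < n" "j < m + k * L" "v' < n" "j' < m + k * L"
  shows "pos v j = pos v' j' \<longleftrightarrow> v = v' \<and> j = j'"
proof
  assume eq: "pos v j = pos v' j'"
  have dm: "(a * h + b) div h = a" "(a * h + b) mod h = b" if "b < h" for a b h :: nat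
    using that by auto
  have "pos v j div (m + k * L) = n - Suc v" "pos v j mod (m + k * L) = j"
       "pos v' j' div (m + k * L) = n - Suc v'" "pos v' j' mod (m + k * L) = j'"
    unfolding pos_def by (rule dm[OF assms(2)] dm[OF assms(4)])+
  with eq have "n - Suc v = n - Suc v'" "j = j'" by auto
  with assms show "v = v' \<and> j = j'" by auto
qed simp

lemma colour_eqD:
  assumes "colour Y v = colour Y' v" "i < m"
  shows "pos v i \<in> Y \<longleftrightarrow> pos v i \<in> Y'"
proof -
  have "{i. i < m \<and> pos v i \<in> Y} = {i. i < m \<and> pos v i \<in> Y'}"
    using assms(1) unfolding colour_def by (subst (asm) set_encode_eq) auto
  with assms(2) show ?thesis by blast
qed

lemma card_rows:
  assumes "W \<subseteq> {..<n}" "\<And>v. v \<in> W \<Longrightarrow> J v \<subseteq> {..<m + k * L}" "\<And>v. v \<in> W \<Longrightarrow> card (J v) = c"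
  shows "card ((\<lambda>(v, j). pos v j) ` Sigma W J) = card W * c"
    and "(\<lambda>(v, j). pos v j) ` Sigma W J \<subseteq> {..<S}"
proof -
  have fin: "finite W" "finite (J v)" if "v \<in> W" for v
    using assms(1) finite_subset[OF assms(2)[OF that]] by (auto intro: finite_subset)
  have "inj_on (\<lambda>(v, j). pos v j) (Sigma W J)"
    using assms(1,2) by (intro inj_onI) (auto, (metis lessThan_iff pos_eq_iff subsetD)+)
  then have "card ((\<lambda>(v, j). pos v j) ` Sigma W J) = card (Sigma W J)"
    by (rule card_image)
  also have "\<dots> = card W * c"
    using assms(1,3) fin by (subst card_SigmaI) (auto intro: finite_subset)
  finally show "card ((\<lambda>(v, j). pos v j) ` Sigma W J) = card W * c" .
  show "(\<lambda>(v, j). pos v j) ` Sigma W J \<subseteq> {..<S}"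
  proof clarify
    fix v j assume "v \<in> W" "j \<in> J v"
    with assms(1) assms(2)[of v] have "v < n" "j < m + k * L" by blast+
    then show "pos v j < S" by (rule pos_less)
  qed
qed

text \<open>
  In expectation, each set of \<open>k\<close> elements survives in at most \<open>2 ^ k\<close> nodes of every depth: a node of depth
  \<open>d\<close> fixes at least \<open>d div k\<close> bits of each element.
\<close>

lemma card_subset_matching_le:
  assumes W: "W \<subseteq> {..<n}" "card W = k" and d: "d \<le> k * L" and km: "k \<le> 2 ^ m"
  shows "card {Y \<in> Pow {..<S}. W \<subseteq> matching Y d p} * 2 ^ (k * (d div k)) \<le> 2 ^ S"
proof -
  \<comment> \<open>All colourings of \<open>W\<close>, not only the injective ones: a witness that
    is not multicoloured still keeps nodes alive and has to be paid for.\<close>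
  define Col where "Col = (W \<rightarrow>\<^sub>E {..<k})"
  define P where "P \<gamma> Y \<longleftrightarrow> (\<forall>v\<in>W. colour Y v = \<gamma> v \<and>
      (\<forall>e<d. e mod k = \<gamma> v \<longrightarrow> of_bool (pos v (m + e) \<in> Y) = p e))" for \<gamma> Y
  \<comment> \<open>Once the colouring \<gamma> is given, survival fixes these bits in the row of
    \<open>v\<close>: the whole colour, and one bit for each complete block of \<open>k\<close>
    depths.\<close>
  define J where "J \<gamma> v = {..<m} \<union> (\<lambda>i. m + (i * k + \<gamma> v)) ` {..<d div k}" for \<gamma> :: "nat \<Rightarrow> nat" and v
  define c where "c = m + d div k"
  have finW: "finite W" using W(1) finite_subset by blast
  have dk: "i * k + a < d" if "i < d div k" "a < k" for i a
  proof -
    have "i * k + a < Suc i * k" using that by simp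
    also have "\<dots> \<le> (d div k) * k" using that by (intro mult_right_mono) auto
    also have "\<dots> \<le> d" by simp
    finally show ?thesis .
  qed
  have card_P: "card {Y \<in> Pow {..<S}. P \<gamma> Y} \<le> 2 ^ (S - k * c) \<and> k * c \<le> S"
    if \<gamma>: "\<gamma> \<in> Col" for \<gamma>
  proof -
    define Z where "Z = (\<lambda>(v, j). pos v j) ` Sigma W (J \<gamma>)"
    have \<gamma>v: "\<gamma> v < k" if "v \<in> W" for v
      using \<gamma> that by (auto simp: Col_def)
    have "card (J \<gamma> v) = c" if "v \<in> W" for v
    proof -
      have "inj_on (\<lambda>i. m + (i * k + \<gamma> v)) {..<d div k}"
        using \<gamma>v[OF that] by (intro inj_onI) auto
      then show ?thesis
        unfolding J_def c_def by (subst card_Un_disjoint) (auto simp: card_image)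
    qed
    moreover have "J \<gamma> v \<subseteq> {..<m + k * L}" if "v \<in> W" for v
      using dk[OF _ \<gamma>v[OF that]] d by (fastforce simp: J_def)
    ultimately have Z: "card Z = k * c" "Z \<subseteq> {..<S}"
      unfolding Z_def using card_rows[OF W(1), of "J \<gamma>" c] W(2) by auto
    have "card {Y \<in> Pow {..<S}. P \<gamma> Y} \<le> 2 ^ (card {..<S} - card Z)"
    proof (rule card_determined_le)
      fix Y Y' assume P: "P \<gamma> Y" "P \<gamma> Y'" and eq: "Y - Z = Y' - Z"
      have "z \<in> Y \<longleftrightarrow> z \<in> Y'" if "z \<in> Z" for z
      proof -
        from that obtain v j where v: "v \<in> W" "j \<in> J \<gamma> v" "z = pos v j"
          unfolding Z_def by auto
        show ?thesis
        proof (cases "j < m")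
          case True
          with P v show ?thesis
            using colour_eqD[of Y v Y' j] by (simp add: P_def)
        next
          case False
          then obtain i where i: "i < d div k" "j = m + (i * k + \<gamma> v)"
            using v by (auto simp: J_def)
          have "(of_bool (z \<in> Y) :: nat) = p (i * k + \<gamma> v)" "(of_bool (z \<in> Y') :: nat) = p (i * k + \<gamma> v)"
            using P v i dk[OF i(1) \<gamma>v[OF v(1)]] \<gamma>v[OF v(1)] by (auto simp: P_def)
          then have "(of_bool (z \<in> Y) :: nat) = of_bool (z \<in> Y')" by simp
          then show ?thesis by (simp only: of_bool_eq_iff)
        qed
      qed
      with eq show "Y = Y'" by blast
    qed (use Z in auto)
    moreover have "card Z \<le> card {..<S}"
      by (intro card_mono) (use Z in auto)
    ultimately show ?thesis using Z by simp
  qed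
  have kcS: "k * c \<le> S"
  proof (cases "k = 0")
    case False
    then have "Col \<noteq> {}" unfolding Col_def by (simp add: PiE_eq_empty_iff lessThan_empty_iff)
    with card_P show ?thesis by blast
  qed simp
  have "{Y \<in> Pow {..<S}. W \<subseteq> matching Y d p} \<subseteq> (\<Union>\<gamma>\<in>Col. {Y \<in> Pow {..<S}. P \<gamma> Y})"
  proof safe
    fix Y assume Y: "Y \<subseteq> {..<S}" "W \<subseteq> matching Y d p"
    have "restrict (colour Y) W \<in> Col" "P (restrict (colour Y) W) Y"
      using Y(2) by (auto simp: Col_def P_def matching_def subset_iff)
    with Y(1) show "Y \<in> (\<Union>\<gamma>\<in>Col. {Y \<in> Pow {..<S}. P \<gamma> Y})" by blast
  qed
  then have "card {Y \<in> Pow {..<S}. W \<subseteq> matching Y d p} \<le>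
      card (\<Union>\<gamma>\<in>Col. {Y \<in> Pow {..<S}. P \<gamma> Y})"
    by (intro card_mono) (auto simp: Col_def finW intro!: finite_PiE)
  also have "\<dots> \<le> (\<Sum>\<gamma>\<in>Col. card {Y \<in> Pow {..<S}. P \<gamma> Y})"
    by (rule card_UN_le) (simp add: Col_def finW finite_PiE)
  also have "\<dots> \<le> card Col * 2 ^ (S - k * c)"
    using sum_bounded_above[of Col] card_P by (metis (no_types, lifting) of_nat_id)
  also have "card Col = k ^ k"
    unfolding Col_def using finW W(2) by (simp add: card_funcsetE)
  \<comment> \<open>The union bound over the k ^ k colourings is paid for by the
    \<open>m * k\<close> colour bits that each of them fixes.\<close>
  also have "k ^ k \<le> 2 ^ (m * k)"
    using km by (metis power_mono power_mult zero_le)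
  finally have "card {Y \<in> Pow {..<S}. W \<subseteq> matching Y d p} * 2 ^ (k * (d div k)) \<le>
      2 ^ (m * k) * 2 ^ (S - k * c) * 2 ^ (k * (d div k))"
    by simp
  also have "\<dots> = 2 ^ (m * k + (S - k * c) + k * (d div k))"
    by (simp add: power_add)
  also have "m * k + (S - k * c) + k * (d div k) = S"
    using kcS by (simp add: c_def algebra_simps)
  finally show ?thesis .
qed

end

section \<open>Witnesses that are multicoloured and alone in their leaf\<close>

context colouring
begin

definition rainbow :: "nat set \<Rightarrow> nat set \<Rightarrow> bool" where
  "rainbow Y W \<longleftrightarrow> inj_on (colour Y) W \<and> colour Y ` W \<subseteq> {..<k}"

text \<open>Elements of the same colour that no path of length \<open>k * L\<close> can
  separate.\<close>

definition collide :: "nat set \<Rightarrow> nat \<Rightarrow> nat \<Rightarrow> bool" where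
  "collide Y u v \<longleftrightarrow> colour Y u = colour Y v \<and>
     (\<forall>e < k * L. e mod k = colour Y v \<longrightarrow> (pos u (m + e) \<in> Y \<longleftrightarrow> pos v (m + e) \<in> Y))"

definition isolated :: "nat set \<Rightarrow> nat set \<Rightarrow> bool" where
  "isolated Y W \<longleftrightarrow> rainbow Y W \<and> (\<forall>u \<in> {..<n} - W. \<forall>v \<in> W. \<not> collide Y u v)"

text \<open>\<open>W\<close> is rainbow with probability k! / 2 ^ (m k), which is at least 8 ^ (-
  k). Given a rainbow colouring of \<open>W\<close>, an outsider shares colour and all
  \<open>L\<close> relevant bits with some element of \<open>W\<close> with probability at most k /
  2 ^ (m + L) \<le> 1 / (2 n); with at most \<open>n\<close> outsiders, no collision occurs with
  probability at least 1 / 2.\<close>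

lemma card_isolated_ge:
  assumes W: "W \<subseteq> {..<n}" "card W = k"
    and km: "k \<le> 2 ^ m" and mk: "2 ^ (m * k) \<le> (2 * k) ^ k" and nL: "2 * n \<le> 2 ^ L"
  shows "2 ^ S \<le> 2 * 8 ^ k * card {Y \<in> Pow {..<S}. isolated Y W}"
proof -
  define Col where "Col = {\<gamma> \<in> W \<rightarrow>\<^sub>E {..<k}. inj_on \<gamma> W}"
  define G where "G \<gamma> = {Y \<in> Pow {..<S}. \<forall>v\<in>W. colour Y v = \<gamma> v}" for \<gamma>
  define B where "B \<gamma> u = {Y \<in> G \<gamma>. \<exists>v\<in>W. collide Y u v}" for \<gamma> u
  have finW: "finite W" using W(1) finite_subset by blast
  have finCol: "finite Col" unfolding Col_def using finW by (simp add: finite_PiE)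
  have cardCol: "card Col = fact k"
    unfolding Col_def using card_inj_on_subset_funcset[OF finW, of "{..<k}" W] W(2)
    by (simp add: fact_prod_rev)
  have kmS: "k * m \<le> S"
  proof -
    have "k \<le> n" using card_mono[OF _ W(1)] W(2) by simp
    then show ?thesis unfolding S_def by (intro mult_mono) auto
  qed
  have cardG: "card (G \<gamma>) = 2 ^ (S - k * m)" if \<gamma>: "\<gamma> \<in> Col" for \<gamma>
  proof -
    define Z where "Z = (\<lambda>(v, j). pos v j) ` Sigma W (\<lambda>_. {..<m})"
    define Q where "Q = (\<lambda>(v, j). pos v j) ` Sigma W (\<lambda>v. set_decode (\<gamma> v))"
    have sub: "set_decode (\<gamma> v) \<subseteq> {..<m}" if "v \<in> W" for v
      by (rule set_decode_less) (use that \<gamma> km in \<open>auto simp: Col_def intro: less_le_trans\<close>)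
    have Z: "card Z = k * m" "Z \<subseteq> {..<S}"
      unfolding Z_def using card_rows[OF W(1), of "\<lambda>_. {..<m}" m] W(2) by auto
    have QZ: "Q \<subseteq> Z" unfolding Q_def Z_def using sub by fastforce
    have Q_iff: "pos v i \<in> Q \<longleftrightarrow> i \<in> set_decode (\<gamma> v)" if "v \<in> W" "i < m" for v i
    proof
      assume "pos v i \<in> Q"
      then obtain v' j where "v' \<in> W" "j \<in> set_decode (\<gamma> v')" "pos v i = pos v' j"
        unfolding Q_def by auto
      moreover from this have "j < m" using sub by auto
      ultimately show "i \<in> set_decode (\<gamma> v)"
        using pos_eq_iff[of v i v' j] that W(1) by auto
    qed (use that in \<open>auto simp: Q_def\<close>)
    have "colour Y v = \<gamma> v \<longleftrightarrow> (\<forall>i<m. pos v i \<in> Y \<longleftrightarrow> pos v i \<in> Q)" if "v \<in> W" for v Y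
    proof -
      have "set_decode (colour Y v) = {i. i < m \<and> pos v i \<in> Y}"
        by (simp add: colour_def)
      then have "colour Y v = \<gamma> v \<longleftrightarrow> {i. i < m \<and> pos v i \<in> Y} = set_decode (\<gamma> v)"
        by (metis set_decode_inverse)
      also have "\<dots> \<longleftrightarrow> (\<forall>i<m. pos v i \<in> Y \<longleftrightarrow> pos v i \<in> Q)"
        using Q_iff[OF that] sub[OF that] by auto
      finally show ?thesis .
    qed
    then have "G \<gamma> = {Y \<in> Pow {..<S}. \<forall>v\<in>W. \<forall>i<m. pos v i \<in> Y \<longleftrightarrow> pos v i \<in> Q}"
      unfolding G_def by auto
    also have "\<dots> = {Y \<in> Pow {..<S}. Y \<inter> Z = Q}"
    proof -
      have "(\<forall>v\<in>W. \<forall>i<m. pos v i \<in> Y \<longleftrightarrow> pos v i \<in> Q) \<longleftrightarrow> (\<forall>z\<in>Z. z \<in> Y \<longleftrightarrow> z \<in> Q)" for Y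
        unfolding Z_def by auto
      moreover have "(\<forall>z\<in>Z. z \<in> Y \<longleftrightarrow> z \<in> Q) \<longleftrightarrow> Y \<inter> Z = Q" for Y
        using QZ by blast
      ultimately show ?thesis by simp
    qed
    finally show ?thesis
      using card_cylinder[OF _ Z(2) QZ] Z(1) by simp
  qed
  have cardB: "card (B \<gamma> u) * (2 * n) \<le> 2 ^ (S - k * m)" if \<gamma>: "\<gamma> \<in> Col" and u: "u \<in> {..<n} - W" for \<gamma> u
  proof -
    define c where "c v = {Y \<in> Pow {..<S}. (\<forall>w\<in>W. colour Y w = \<gamma> w) \<and> collide Y u v}" for v
    have c: "card (c v) \<le> 2 ^ (S - (k * m + m + L)) \<and> k * m + m + L \<le> S" if v: "v \<in> W" for v
    proof -
      have \<gamma>v: "\<gamma> v < k" using \<gamma> v by (auto simp: Col_def)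
      define Z1 where "Z1 = (\<lambda>(v, j). pos v j) ` Sigma W (\<lambda>_. {..<m})"
      define J where "J = {..<m} \<union> (\<lambda>i. m + (i * k + \<gamma> v)) ` {..<L}"
      define Z2 where "Z2 = (\<lambda>(v, j). pos v j) ` Sigma {u} (\<lambda>_. J)"
      have Z1: "card Z1 = k * m" "Z1 \<subseteq> {..<S}"
        unfolding Z1_def using card_rows[OF W(1), of "\<lambda>_. {..<m}" m] W(2) by auto
      have lt: "i * k + \<gamma> v < k * L" if "i < L" for i
      proof -
        have "i * k + \<gamma> v < Suc i * k" using \<gamma>v by simp
        also have "\<dots> \<le> L * k" using that by (intro mult_right_mono) auto
        finally show ?thesis by (simp add: mult.commute)
      qed
      have J: "J \<subseteq> {..<m + k * L}" unfolding J_def using lt by auto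
      have "inj_on (\<lambda>i. m + (i * k + \<gamma> v)) {..<L}"
        using \<gamma>v by (intro inj_onI) auto
      then have cJ: "card J = m + L"
        unfolding J_def by (subst card_Un_disjoint) (auto simp: card_image)
      have Z2: "card Z2 = m + L" "Z2 \<subseteq> {..<S}"
        unfolding Z2_def using card_rows[of "{u}" "\<lambda>_. J" "m + L"] u J cJ by auto
      have disj: "Z1 \<inter> Z2 = {}"
      proof (rule ccontr)
        assume "Z1 \<inter> Z2 \<noteq> {}"
        then obtain w i j where "w \<in> W" "i < m" "j \<in> J" "pos w i = pos u j"
          unfolding Z1_def Z2_def by auto
        then show False
          using pos_eq_iff[of w i u j] u W(1) J by auto
      qed
      have "card (Z1 \<union> Z2) = k * m + m + L"
        using Z1 Z2 disj by (subst card_Un_disjoint) (auto intro: finite_subset)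
      moreover have "card (c v) \<le> 2 ^ (card {..<S} - card (Z1 \<union> Z2))"
        unfolding c_def
      proof (rule card_determined_le)
        fix Y Y'
        assume Y: "(\<forall>w\<in>W. colour Y w = \<gamma> w) \<and> collide Y u v"
          and Y': "(\<forall>w\<in>W. colour Y' w = \<gamma> w) \<and> collide Y' u v"
          and eq: "Y - (Z1 \<union> Z2) = Y' - (Z1 \<union> Z2)"
        have z1: "z \<in> Y \<longleftrightarrow> z \<in> Y'" if "z \<in> Z1" for z
          using that Y Y' colour_eqD[of Y _ Y'] by (auto simp: Z1_def)
        have z2: "z \<in> Y \<longleftrightarrow> z \<in> Y'" if "z \<in> Z2" for z
        proof -
          from that obtain j where j: "j \<in> J" "z = pos u j" by (auto simp: Z2_def)
          show ?thesis
          proof (cases "j < m")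
            case True
            then show ?thesis
              using colour_eqD[of Y u Y' j] Y Y' v j by (auto simp: collide_def)
          next
            case False
            then obtain i where i: "i < L" "j = m + (i * k + \<gamma> v)" using j by (auto simp: J_def)
            \<comment> \<open>The bit of \<open>v\<close> lies outside both \<open>Z1\<close> and
              \<open>Z2\<close>, so it is among the untouched bits, and the collision copies it to
              \<open>u\<close>.\<close>
            have "pos v j \<notin> Z1"
            proof
              assume "pos v j \<in> Z1"
              then obtain w i where "w \<in> W" "i < m" "pos v j = pos w i" by (auto simp: Z1_def)
              with False pos_eq_iff[of v j w i] J j(1) v W(1) show False by auto
            qed
            moreover have "pos v j \<notin> Z2"
            proof
              assume "pos v j \<in> Z2"
              then obtain i where "i \<in> J" "pos v j = pos u i" by (auto simp: Z2_def)
              with pos_eq_iff[of v j u i] J j(1) v u W(1) show False by auto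
            qed
            ultimately have "pos v j \<in> Y \<longleftrightarrow> pos v j \<in> Y'" using eq by blast
            moreover have "pos u j \<in> Y \<longleftrightarrow> pos v j \<in> Y" "pos u j \<in> Y' \<longleftrightarrow> pos v j \<in> Y'"
              using Y Y' v i lt[OF i(1)] \<gamma>v by (auto simp: collide_def)
            ultimately show ?thesis using j by simp
          qed
        qed
        from eq z1 z2 show "Y = Y'" by blast
      qed (use Z1 Z2 in auto)
      moreover have "card (Z1 \<union> Z2) \<le> card {..<S}"
        by (intro card_mono) (use Z1 Z2 in auto)
      ultimately show ?thesis by simp
    qed
    have "B \<gamma> u = (\<Union>v\<in>W. c v)" unfolding B_def G_def c_def by auto
    then have "card (B \<gamma> u) \<le> (\<Sum>v\<in>W. card (c v))"
      using card_UN_le[OF finW] by simp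
    also have "\<dots> \<le> (\<Sum>v\<in>W. 2 ^ (S - (k * m + m + L)))"
      by (intro sum_mono) (use c in auto)
    also have "\<dots> = k * 2 ^ (S - (k * m + m + L))" using W(2) by simp
    finally have "card (B \<gamma> u) * (2 * n) \<le> k * 2 ^ (S - (k * m + m + L)) * (2 * n)"
      by simp
    also have "\<dots> \<le> 2 ^ (S - k * m)"
    proof (cases "W = {}")
      case False
      then have S: "k * m + m + L \<le> S" using c by blast
      \<comment> \<open>The \<open>k\<close> choices of the partner \<open>v\<close> are absorbed by
        the \<open>m\<close> colour bits of \<open>u\<close>, and the factor \<open>2 * n\<close> by
        its \<open>L\<close> cell bits.\<close>
      have "k * 2 ^ (S - (k * m + m + L)) * (2 * n) \<le> 2 ^ m * 2 ^ (S - (k * m + m + L)) * 2 ^ L"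
        using km nL by (intro mult_mono) auto
      also have "\<dots> = 2 ^ (m + (S - (k * m + m + L)) + L)" by (simp add: power_add)
      also have "m + (S - (k * m + m + L)) + L = S - k * m" using S by simp
      finally show ?thesis .
    qed (use W(2) in simp)
    finally show ?thesis .
  qed
  have ge: "2 ^ (S - k * m) \<le> 2 * card (G \<gamma> \<inter> {Y. isolated Y W})" if \<gamma>: "\<gamma> \<in> Col" for \<gamma>
  proof -
    have "rainbow Y W" if "Y \<in> G \<gamma>" for Y
    proof -
      have "inj_on (colour Y) W \<longleftrightarrow> inj_on \<gamma> W"
        using that by (intro inj_on_cong) (simp add: G_def)
      then show ?thesis
        using that \<gamma> by (auto simp: rainbow_def G_def Col_def)
    qed
    then have sub: "G \<gamma> \<subseteq> (G \<gamma> \<inter> {Y. isolated Y W}) \<union> (\<Union>u\<in>{..<n} - W. B \<gamma> u)"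
      by (auto simp: isolated_def B_def)
    have fin: "finite (G \<gamma>)" unfolding G_def by simp
    have "card (\<Union>u\<in>{..<n} - W. B \<gamma> u) * 2 \<le> 2 ^ (S - k * m)"
    proof (cases "n = 0")
      case False
      have "card (\<Union>u\<in>{..<n} - W. B \<gamma> u) * (2 * n) \<le> (\<Sum>u\<in>{..<n} - W. card (B \<gamma> u)) * (2 * n)"
        by (intro mult_right_mono card_UN_le) auto
      also have "\<dots> = (\<Sum>u\<in>{..<n} - W. card (B \<gamma> u) * (2 * n))" by (simp add: sum_distrib_right)
      also have "\<dots> \<le> (\<Sum>u\<in>{..<n} - W. 2 ^ (S - k * m))"
        by (intro sum_mono cardB \<gamma>) auto
      also have "\<dots> \<le> n * 2 ^ (S - k * m)"
        using card_mono[of "{..<n}" "{..<n} - W"] by simp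
      finally show ?thesis using False by simp
    qed simp
    moreover have "card (G \<gamma>) \<le> card (G \<gamma> \<inter> {Y. isolated Y W}) + card (\<Union>u\<in>{..<n} - W. B \<gamma> u)"
    proof (rule order.trans[OF card_mono[OF _ sub] card_Un_le])
      show "finite ((G \<gamma> \<inter> {Y. isolated Y W}) \<union> (\<Union>u\<in>{..<n} - W. B \<gamma> u))"
        using fin by (auto simp: B_def)
    qed
    ultimately show ?thesis using cardG[OF \<gamma>] by linarith
  qed
  have "fact k * 2 ^ (S - k * m) = (\<Sum>\<gamma>\<in>Col. 2 ^ (S - k * m))" using cardCol by simp
  also have "\<dots> \<le> (\<Sum>\<gamma>\<in>Col. 2 * card (G \<gamma> \<inter> {Y. isolated Y W}))"
    by (intro sum_mono ge)
  also have "\<dots> = 2 * card (\<Union>\<gamma>\<in>Col. G \<gamma> \<inter> {Y. isolated Y W})"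
  proof (subst card_UN_disjoint)
    show "\<forall>i\<in>Col. \<forall>j\<in>Col. i \<noteq> j \<longrightarrow> G i \<inter> {Y. isolated Y W} \<inter> (G j \<inter> {Y. isolated Y W}) = {}"
    proof (intro ballI impI, rule ccontr)
      fix i j assume ij: "i \<in> Col" "j \<in> Col" "i \<noteq> j"
        and "G i \<inter> {Y. isolated Y W} \<inter> (G j \<inter> {Y. isolated Y W}) \<noteq> {}"
      then obtain Y where "Y \<in> G i" "Y \<in> G j" by blast
      then have "i v = j v" if "v \<in> W" for v using that by (auto simp: G_def)
      moreover have "i \<in> W \<rightarrow>\<^sub>E {..<k}" "j \<in> W \<rightarrow>\<^sub>E {..<k}" using ij by (auto simp: Col_def)
      ultimately have "i = j" by (intro PiE_ext)
      with ij show False by simp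
    qed
  qed (use finCol in \<open>auto simp: G_def sum_distrib_left\<close>)
  also have "\<dots> \<le> 2 * card {Y \<in> Pow {..<S}. isolated Y W}"
    by (intro mult_left_mono card_mono) (auto simp: G_def)
  finally have "8 ^ k * (fact k * 2 ^ (S - k * m)) \<le> 8 ^ k * (2 * card {Y \<in> Pow {..<S}. isolated Y W})"
    by (rule mult_left_mono) simp
  moreover have "2 ^ (k * m) \<le> 8 ^ k * (fact k :: nat)"
  proof -
    have "2 ^ (k * m) \<le> (2 * k) ^ k" using mk by (simp add: mult.commute)
    also have "\<dots> = 2 ^ k * k ^ k" by (simp add: power_mult_distrib)
    also have "\<dots> \<le> 2 ^ k * (4 ^ k * fact k)" using power_self_le by simp
    also have "\<dots> = (2 * 4) ^ k * fact k" by (simp only: power_mult_distrib mult.assoc)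
    finally show ?thesis by simp
  qed
  then have "2 ^ (k * m) * 2 ^ (S - k * m) \<le> 8 ^ k * fact k * (2::nat) ^ (S - k * m)"
    by (rule mult_right_mono) simp
  moreover have "2 ^ (k * m) * 2 ^ (S - k * m) = (2::nat) ^ S"
    using kmS by (simp flip: power_add)
  ultimately have "(2::nat) ^ S \<le> 8 ^ k * (fact k * 2 ^ (S - k * m))"
    by (simp only: mult.assoc)
  also have "\<dots> \<le> 8 ^ k * (2 * card {Y \<in> Pow {..<S}. isolated Y W})" by fact
  finally show ?thesis by simp
qed

end

text \<open>\<open>m_le\<close> is the \<open>k\<close>-th power of 2 ^ m \<le> 2 k; in this form it
  also holds for \<open>k = 0\<close>, where the plain inequality fails.\<close>

locale witness_search = colouring +
  fixes \<W> :: "nat set set"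
  assumes \<W>: "W \<in> \<W> \<Longrightarrow> W \<subseteq> {..<n}" "W \<in> \<W> \<Longrightarrow> card W = k"
    and k_le: "k \<le> 2 ^ m" and m_le: "2 ^ (m * k) \<le> (2 * k) ^ k" and L_ge: "2 * n \<le> 2 ^ L"
begin

definition alive :: "nat set \<Rightarrow> bool" where
  "alive X \<longleftrightarrow> (\<exists>W \<in> \<W>. W \<subseteq> X)"

text \<open>A leaf that is alive and has at most \<open>k\<close> elements coincides with the
  witness it contains; larger leaves are ignored, so nothing but witnesses is ever recorded.\<close>

definition found :: "(nat \<times> nat set) list \<Rightarrow> nat set set" where
  "found xs = {X. (k * L, X) \<in> set xs \<and> alive X \<and> card X \<le> k}"

definition search :: "nat set \<Rightarrow> (nat \<times> nat set) list" where
  "search Y = trav alive (matching Y) (k * L) 0 (\<lambda>_. 0)"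

text \<open>Bounds the expected number of nodes of a round: the root, and two children for each of
  at most 2 ^ k surviving nodes per witness and inner depth.\<close>

definition visits_bound :: real where
  "visits_bound = 1 + 2 * real (card \<W>) * real (k * L) * 2 ^ k"

lemma finite_\<W>: "finite \<W>"
  by (rule finite_subset[of _ "Pow {..<n}"]) (use \<W>(1) in auto)

lemma tree_search: "tree_search (matching Y)"
  by unfold_locales (rule matching_cong)

lemma found_subset: "found xs \<subseteq> \<W>" if "\<And>d X. (d, X) \<in> set xs \<Longrightarrow> X \<subseteq> {..<n}"
proof
  fix X assume "X \<in> found xs"
  then obtain W where W: "W \<in> \<W>" "W \<subseteq> X" and X: "card X \<le> k" "(k * L, X) \<in> set xs"
    by (auto simp: found_def alive_def)
  have "finite X" using that[OF X(2)] finite_subset by blast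
  then have "W = X" using W X(1) \<W>(2)[OF W(1)] by (intro card_seteq) auto
  with W show "X \<in> \<W>" by simp
qed

lemma isolated_found:
  assumes "W \<in> \<W>" "isolated Y W"
  shows "W \<in> found (search Y)"
proof -
  \<comment> \<open>The path to the leaf of \<open>W\<close>: at depth \<open>e\<close> it follows
    the bit of the element of colour \<open>e mod k\<close>, which is unique because
    \<open>W\<close> is rainbow.\<close>
  define b where "b e = (of_bool (\<exists>v\<in>W. colour Y v = e mod k \<and> pos v (m + e) \<in> Y) :: nat)" for e
  have inj: "inj_on (colour Y) W" and lt: "colour Y ` W \<subseteq> {..<k}"
    using assms(2) by (auto simp: isolated_def rainbow_def)
  have im: "colour Y ` W = {..<k}"
    using lt card_image[OF inj] \<W>(2)[OF assms(1)] by (intro card_subset_eq) auto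
  have b: "b e = of_bool (pos v (m + e) \<in> Y)" if "v \<in> W" "e mod k = colour Y v" for v e
    using that inj_onD[OF inj, of _ v] by (auto simp: b_def)
  have sub: "W \<subseteq> matching Y d b" for d
    using \<W>(1)[OF assms(1)] lt b by (auto simp: matching_def)
  have "matching Y (k * L) b \<subseteq> W"
  proof
    fix u assume u: "u \<in> matching Y (k * L) b"
    then have "colour Y u \<in> colour Y ` W" using im by (simp add: matching_def)
    then obtain v where v: "v \<in> W" "colour Y v = colour Y u" by auto
    show "u \<in> W"
    proof (rule ccontr)
      assume "u \<notin> W"
      then have "\<not> collide Y u v"
        using assms(2) u v by (auto simp: isolated_def matching_def)
      then obtain e where e: "e < k * L" "e mod k = colour Y v"
        "\<not> (pos u (m + e) \<in> Y \<longleftrightarrow> pos v (m + e) \<in> Y)"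
        using v by (auto simp: collide_def)
      then have "of_bool (pos u (m + e) \<in> Y) = b e"
        using u v by (auto simp: matching_def)
      then show False using b[OF v(1) e(2)] e(3) by auto
    qed
  qed
  with sub have eq: "matching Y (k * L) b = W" by blast
  have "(k * L, matching Y (k * L) b) \<in> set (trav alive (matching Y) (k * L - 0) 0 (\<lambda>_. 0))"
    by (rule tree_search.trav_reach[OF tree_search])
      (use assms(1) sub in \<open>auto simp: b_def alive_def\<close>)
  then show ?thesis
    using assms(1) \<W>(2)[OF assms(1)] by (auto simp: found_def search_def eq alive_def)
qed

lemma card_found_ge:
  assumes "W \<in> \<W>"
  shows "2 ^ S \<le> 2 * 8 ^ k * card {Y \<in> Pow {..<S}. W \<in> found (search Y)}"
proof -
  have "2 ^ S \<le> 2 * 8 ^ k * card {Y \<in> Pow {..<S}. isolated Y W}"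
    by (rule card_isolated_ge) (use \<W> assms k_le m_le L_ge in auto)
  also have "\<dots> \<le> 2 * 8 ^ k * card {Y \<in> Pow {..<S}. W \<in> found (search Y)}"
    using isolated_found[OF assms] by (intro mult_left_mono card_mono) auto
  finally show ?thesis .
qed

text \<open>Linearity of expectation over witnesses and depths. At depth \<open>e\<close> there are
  2 ^ e nodes, each containing \<open>W\<close> with probability at most 2 ^ (- k (e div
  k)).\<close>

lemma sum_length_search_le:
  "(\<Sum>Y\<in>Pow {..<S}. real (length (search Y))) \<le> 2 ^ S * visits_bound"
proof -
  define V where "V Y W = visits (\<lambda>d p. W \<subseteq> matching Y d p) (k * L) 0 (\<lambda>_. 0)" for Y W
  define F where "F d = 2 ^ S / (2 ^ (k * (d div k)) :: real)" for d
  have "(\<Sum>Y\<in>Pow {..<S}. real (V Y W)) \<le> 2 ^ S * (real (k * L) * 2 ^ k)" if W: "W \<in> \<W>" for W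
  proof -
    have F: "real (card {Y \<in> Pow {..<S}. W \<subseteq> matching Y d p}) \<le> F d" if "d < 0 + k * L" for d p
    proof -
      have "card {Y \<in> Pow {..<S}. W \<subseteq> matching Y d p} * 2 ^ (k * (d div k)) \<le> 2 ^ S"
        by (rule card_subset_matching_le) (use \<W> W k_le that in auto)
      then have "real (card {Y \<in> Pow {..<S}. W \<subseteq> matching Y d p} * 2 ^ (k * (d div k))) \<le> real (2 ^ S)"
        unfolding of_nat_le_iff .
      then show ?thesis by (simp add: F_def pos_le_divide_eq)
    qed
    have "(\<Sum>Y\<in>Pow {..<S}. real (V Y W)) \<le> (\<Sum>e<k * L. 2 ^ e * F (0 + e))"
      unfolding V_def using F by (intro sum_visits_le) auto
    also have "\<dots> \<le> (\<Sum>e<k * L. 2 ^ S * 2 ^ k)"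
    proof (rule sum_mono)
      fix e assume "e \<in> {..<k * L}"
      then have "k > 0" by (cases k) auto
      then have "k * (e div k) + e mod k = e" "e mod k < k" by auto
      \<comment> \<open>Only the incomplete block of fewer than \<open>k\<close> depths is not
        compensated; it is the source of the factor 2 ^ k.\<close>
      then have "e \<le> k + k * (e div k)" by linarith
      then have "(2::real) ^ e \<le> 2 ^ k * 2 ^ (k * (e div k))"
        by (simp flip: power_add)
      then show "2 ^ e * F (0 + e) \<le> 2 ^ S * 2 ^ k"
        by (simp add: F_def divide_simps mult.commute)
    qed
    finally show ?thesis by (simp add: mult_ac)
  qed
  then have V: "(\<Sum>W\<in>\<W>. \<Sum>Y\<in>Pow {..<S}. real (V Y W)) \<le> (\<Sum>W\<in>\<W>. 2 ^ S * (real (k * L) * 2 ^ k))"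
    by (rule sum_mono)
  have "(\<Sum>Y\<in>Pow {..<S}. real (length (search Y))) \<le>
      (\<Sum>Y\<in>Pow {..<S}. real (1 + 2 * (\<Sum>W\<in>\<W>. V Y W)))"
    unfolding search_def V_def of_nat_le_iff
    by (intro sum_mono of_nat_mono length_trav_le finite_\<W>) (simp add: alive_def)
  also have "\<dots> = 2 ^ S + 2 * (\<Sum>W\<in>\<W>. \<Sum>Y\<in>Pow {..<S}. real (V Y W))"
    by (subst sum.swap) (simp add: sum.distrib sum_distrib_left card_Pow)
  also have "\<dots> \<le> 2 ^ S * visits_bound"
    using V by (simp add: visits_bound_def algebra_simps)
  finally show ?thesis .
qed

end

section \<open>The counting program\<close>

abbreviation set_var :: "vname \<Rightarrow> exp \<Rightarrow> prog" (infix \<open>::=\<close> 65) where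
  "x ::= e \<equiv> PAssign x (Const 0) e"

text \<open>Conditions are numbers and subtraction is truncated, so a single difference tests for
  greater and the sum of both differences tests for unequal.\<close>

abbreviation neq :: "exp \<Rightarrow> exp \<Rightarrow> exp" where
  "neq e e' \<equiv> Plus (Minus e e') (Minus e' e)"

definition read_colour :: prog where
  "read_colour =
     ''col'' ::= Const 0 ;; ''wt'' ::= Const 1 ;;
     PFor ''i'' ''c''
       (PIf (Read ''Tape'' (var ''ptr'')) (''col'' ::= Plus (var ''col'') (var ''wt'')) PSkip ;;
        ''wt'' ::= Plus (var ''wt'') (var ''wt'') ;;
        ''ptr'' ::= Plus (var ''ptr'') (Const 1))"

text \<open>The loop covers all \<open>D\<close> depths even if the node is shallower: the pointer
  has to pass the whole row, and the bound must stay constant. The variable \<open>a\<close> keeps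
  \<open>e mod k\<close> by wrapping around, as there is no division.\<close>

definition check_cells :: prog where
  "check_cells =
     ''e'' ::= Const 0 ;; ''a'' ::= Const 0 ;;
     PFor ''i'' ''D''
       (PIf (Minus (var ''depth'') (var ''e''))
          (PIf (neq (var ''a'') (var ''col'')) PSkip
             (PIf (neq (Read ''Tape'' (var ''ptr'')) (Read ''Path'' (var ''e'')))
                (PAssign ''X'' (var ''v'') (Const 0)) PSkip)) PSkip ;;
        ''ptr'' ::= Plus (var ''ptr'') (Const 1) ;;
        ''e'' ::= Plus (var ''e'') (Const 1) ;;
        ''a'' ::= Plus (var ''a'') (Const 1) ;;
        PIf (Minus (var ''k'') (var ''a'')) PSkip (''a'' ::= Const 0))"

definition compute_X :: prog where
  "compute_X =
     ''ptr'' ::= Const 0 ;;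
     PFor ''v'' ''n''
       (read_colour ;;
        PIf (Minus (var ''k'') (var ''col'')) (PAssign ''X'' (var ''v'') (Const 1))
          (PAssign ''X'' (var ''v'') (Const 0)) ;;
        check_cells)"

text \<open>Strips the trailing ones of the path and moves to the sibling of what remains; depth 0
  means that the search is complete. The loop always makes \<open>D\<close> iterations, so that its
  bound is not modified.\<close>

definition backtrack :: prog where
  "backtrack =
     PFor ''i'' ''D''
       (PIf (var ''depth'')
          (PIf (Read ''Path'' (Minus (var ''depth'') (Const 1)))
             (''depth'' ::= Minus (var ''depth'') (Const 1)) PSkip) PSkip) ;;
     PIf (var ''depth'') (PAssign ''Path'' (Minus (var ''depth'') (Const 1)) (Const 1))
       (''Act'' ::= Const 0)"

text \<open>\<open>Seen\<close> stores for each set code the generation, that is, the run, in which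
  it was last recorded. A new run thus starts with an empty record without clearing up to 2 ^ n
  cells.\<close>

definition record_leaf :: prog where
  "record_leaf =
     ''code'' ::= Const 0 ;; ''size'' ::= Const 0 ;;
     PFor ''v'' ''n''
       (''code'' ::= Plus (Plus (var ''code'') (var ''code'')) (Read ''X'' (var ''v'')) ;;
        ''size'' ::= Plus (var ''size'') (Read ''X'' (var ''v''))) ;;
     PIf (Minus (var ''size'') (var ''k'')) PSkip
       (PIf (Minus (var ''Gen'') (Read ''Seen'' (var ''code'')))
          (PAssign ''Seen'' (var ''code'') (var ''Gen'') ;; ''Num'' ::= Plus (var ''Num'') (Const 1))
          PSkip)"

definition advance :: prog where
  "advance =
     PIf (var ''ans'')
       (PIf (Minus (var ''D'') (var ''depth''))
          (PAssign ''Path'' (var ''depth'') (Const 0) ;; ''depth'' ::= Plus (var ''depth'') (Const 1))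
          (record_leaf ;; backtrack))
       backtrack"

definition majority :: prog where
  "majority =
     ''yes'' ::= Const 0 ;;
     PFor ''lq'' ''q''
       (PQuery ''ans'' ''X'' ;; PIf (var ''ans'') (''yes'' ::= Plus (var ''yes'') (Const 1)) PSkip) ;;
     PIf (Minus (Plus (var ''yes'') (var ''yes'')) (var ''q'')) (''ans'' ::= Const 1) (''ans'' ::= Const 0)"

definition sample :: prog where
  "sample = PFor ''i'' ''S'' (PFlip ''flip'' ;; PAssign ''Tape'' (var ''i'') (var ''flip''))"

text \<open>\<open>Left\<close> counts the rounds not yet begun. A new round starts in the same
  iteration that visits its root, so every iteration up to the end of the last round visits a
  node.\<close>

definition begin_round :: prog where
  "begin_round =
     PIf (var ''Act'') PSkip
       (PIf (var ''Left'')
          (sample ;; ''depth'' ::= Const 0 ;; ''Act'' ::= Const 1 ;;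
           ''Left'' ::= Minus (var ''Left'') (Const 1)) PSkip)"

definition visit_node :: prog where
  "visit_node = PIf (var ''Act'') (compute_X ;; majority ;; advance) PSkip"

text \<open>If rounds or nodes are left when the iterations run out, the result is
  \<open>M + 1\<close>.\<close>

definition count_once :: "nat \<Rightarrow> prog" where
  "count_once M =
     ''Gen'' ::= Plus (var ''Gen'') (Const 1) ;; ''Num'' ::= Const 0 ;;
     ''Left'' ::= var ''R'' ;; ''Act'' ::= Const 0 ;;
     PFor ''lb'' ''B'' (begin_round ;; visit_node) ;;
     PIf (Plus (var ''Left'') (var ''Act'')) (''res'' ::= Const (M + 1))
       (PIf (Minus (var ''Num'') (Const M)) (''res'' ::= Const (M + 1)) (''res'' ::= var ''Num''))"

text \<open>At most one value can occur in more than half of the runs, so once it has done so,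
  \<open>final\<close> is not overwritten by another one.\<close>

definition tally :: prog where
  "tally =
     PAssign ''Hist'' (var ''res'') (Plus (Read ''Hist'' (var ''res'')) (Const 1)) ;;
     PIf (Minus (Plus (Read ''Hist'' (var ''res'')) (Read ''Hist'' (var ''res''))) (var ''r''))
       (''final'' ::= var ''res'') PSkip"

definition count_loop :: "nat \<Rightarrow> prog" where
  "count_loop M = PFor ''lr'' ''r'' (count_once M ;; tally)"

definition emit :: "nat \<Rightarrow> prog" where
  "emit M = PIf (Minus (var ''final'') (Const M)) (''more'' ::= Const 1) (''out'' ::= var ''final'')"

lemmas prog_defs = read_colour_def check_cells_def compute_X_def backtrack_def record_leaf_def
  advance_def majority_def sample_def begin_round_def visit_node_def count_once_def tally_def
  count_loop_def emit_def

lemma wf_programs [simp]: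
  "wf_prog read_colour" "wf_prog check_cells" "wf_prog compute_X" "wf_prog backtrack"
  "wf_prog record_leaf" "wf_prog advance" "wf_prog majority" "wf_prog sample"
  "wf_prog begin_round" "wf_prog visit_node" "wf_prog (count_once M)" "wf_prog tally"
  "wf_prog (count_loop M)" "wf_prog (emit M)"
  by (simp_all add: prog_defs)

lemma determ_programs [simp]:
  "determ read_colour" "determ check_cells" "determ compute_X" "determ backtrack"
  "determ record_leaf" "determ advance" "determ tally" "determ (emit M)"
  by (simp_all add: prog_defs)

lemma mods_read_colour: "mods read_colour = {''col'', ''wt'', ''i'', ''ptr''}"
  by (auto simp: read_colour_def)

lemma mods_check_cells: "mods check_cells = {''e'', ''a'', ''i'', ''X'', ''ptr''}"
  by (auto simp: check_cells_def)

lemma mods_compute_X: "mods compute_X = {''col'', ''wt'', ''i'', ''e'', ''a'', ''X'', ''ptr'', ''v''}"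
  by (auto simp: compute_X_def mods_read_colour mods_check_cells)

lemma mods_backtrack: "mods backtrack = {''i'', ''depth'', ''Path'', ''Act''}"
  by (auto simp: backtrack_def)

lemma mods_record_leaf: "mods record_leaf = {''v'', ''code'', ''size'', ''Seen'', ''Num''}"
  by (auto simp: record_leaf_def)

lemma mods_majority: "mods majority = {''yes'', ''lq'', ''ans''}"
  by (auto simp: majority_def)

lemma mods_sample: "mods sample = {''i'', ''flip'', ''Tape''}"
  by (auto simp: sample_def)

lemma mods_advance: "mods advance =
   {''i'', ''depth'', ''Path'', ''Act'', ''v'', ''code'', ''size'', ''Seen'', ''Num''}"
  by (auto simp: advance_def mods_backtrack mods_record_leaf)

lemma mods_begin_round: "mods begin_round = {''i'', ''flip'', ''Tape'', ''depth'', ''Act'', ''Left''}"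
  by (auto simp: begin_round_def mods_sample)

lemma mods_visit_node: "mods visit_node =
   {''col'', ''wt'', ''i'', ''e'', ''a'', ''X'', ''ptr'', ''v'', ''yes'', ''lq'', ''ans'', ''depth'',
    ''Path'', ''Act'', ''code'', ''size'', ''Seen'', ''Num''}"
  by (auto simp: visit_node_def mods_compute_X mods_majority mods_advance)

lemma mods_count_once: "mods (count_once M) =
   {''Gen'', ''Num'', ''Left'', ''Act'', ''lb'', ''res'', ''col'', ''wt'', ''i'', ''e'', ''a'', ''X'',
    ''ptr'', ''v'', ''yes'', ''lq'', ''ans'', ''depth'', ''Path'', ''code'', ''size'', ''Seen'',
    ''flip'', ''Tape''}"
  by (auto simp: count_once_def mods_begin_round mods_visit_node)

lemma mods_tally: "mods tally = {''Hist'', ''final''}"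
  by (auto simp: tally_def)

section \<open>Correctness of the deterministic parts of the program\<close>

lemma Collect_less_Suc: "{i. i < Suc j \<and> Q i} = (if Q j then insert j {i. i < j \<and> Q i} else {i. i < j \<and> Q i})"
  by (auto simp: less_Suc_eq)

lemma dsem_PFor_inv:
  assumes "P (m x 0) (m(i := (m i)(0 := m x 0)))"
    and "\<And>j a. j < m x 0 \<Longrightarrow> P (Suc j) a \<Longrightarrow> P j (dsem p (a(i := (a i)(0 := j))))"
  shows "P 0 (dsem (PFor i x p) m)"
  unfolding dsem.simps by (rule downto0_inv[where P = P]) (use assms in auto)

lemma dsem_read_colour:
  fixes m :: store
  defines "m' \<equiv> dsem read_colour m" and "b \<equiv> m ''ptr'' 0" and "N \<equiv> m ''c'' 0"
  shows "m' ''col'' 0 = set_encode {i. i < N \<and> m ''Tape'' (b + i) \<noteq> 0}"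
    and "m' ''ptr'' 0 = b + N"
proof -
  define P where "P j a \<longleftrightarrow> j \<le> N \<and> a ''col'' 0 = set_encode {i. i < N - j \<and> m ''Tape'' (b + i) \<noteq> 0} \<and>
     a ''wt'' 0 = 2 ^ (N - j) \<and> a ''ptr'' 0 = b + (N - j) \<and> a ''Tape'' = m ''Tape''" for j and a :: store
  have "P 0 m'"
    unfolding m'_def read_colour_def dsem.simps(5)
  proof (rule dsem_PFor_inv[where P = P])
    fix j and a :: store
    assume P: "P (Suc j) a"
    then have *: "N - j = Suc (N - Suc j)" by (auto simp: P_def)
    show "P j (dsem
       (PIf (Read ''Tape'' (var ''ptr'')) (''col'' ::= Plus (var ''col'') (var ''wt'')) PSkip ;;
        ''wt'' ::= Plus (var ''wt'') (var ''wt'') ;;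
        ''ptr'' ::= Plus (var ''ptr'') (Const 1)) (a(''i'' := (a ''i'')(0 := j))))"
      using P unfolding P_def * Collect_less_Suc by (auto simp: set_encode_insert)
  qed (simp add: P_def b_def N_def)
  then show "m' ''col'' 0 = set_encode {i. i < N \<and> m ''Tape'' (b + i) \<noteq> 0}" "m' ''ptr'' 0 = b + N"
    by (auto simp: P_def)
qed

lemma dsem_check_cells:
  fixes m :: store
  defines "m' \<equiv> dsem check_cells m" and "b \<equiv> m ''ptr'' 0" and "N \<equiv> m ''D'' 0" and "v \<equiv> m ''v'' 0"
  assumes k: "N > 0 \<Longrightarrow> m ''k'' 0 > 0"
  shows "m' ''X'' = (m ''X'')(v :=
       if \<forall>e < min N (m ''depth'' 0). e mod m ''k'' 0 = m ''col'' 0 \<longrightarrow> m ''Tape'' (b + e) = m ''Path'' e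
       then m ''X'' v else 0)"
    and "m' ''ptr'' 0 = b + N"
proof -
  define ok where "ok e \<longleftrightarrow> (e < m ''depth'' 0 \<longrightarrow> e mod m ''k'' 0 = m ''col'' 0 \<longrightarrow> m ''Tape'' (b + e) = m ''Path'' e)" for e
  define P where "P j a \<longleftrightarrow> j \<le> N \<and> a ''e'' 0 = N - j \<and> a ''a'' 0 = (N - j) mod m ''k'' 0 \<and>
     a ''ptr'' 0 = b + (N - j) \<and> a ''Tape'' = m ''Tape'' \<and> a ''Path'' = m ''Path'' \<and>
     a ''depth'' = m ''depth'' \<and> a ''col'' = m ''col'' \<and> a ''k'' = m ''k'' \<and> a ''v'' = m ''v'' \<and>
     a ''X'' = (m ''X'')(v := if \<forall>e < N - j. ok e then m ''X'' v else 0)"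
    for j and a :: store
  have "P 0 m'"
    unfolding m'_def check_cells_def dsem.simps(5)
  proof (rule dsem_PFor_inv[where P = P])
    fix j and a :: store
    assume P: "P (Suc j) a"
    then have *: "N - j = Suc (N - Suc j)" by (auto simp: P_def)
    have k0: "m ''k'' 0 > 0" using k P by (auto simp: P_def)
    have md: "Suc x mod m ''k'' 0 = (if Suc (x mod m ''k'' 0) < m ''k'' 0 then Suc (x mod m ''k'' 0) else 0)" for x
      using mod_less_divisor[OF k0, of x] by (auto simp: mod_Suc)
    let ?body = "PIf (Minus (var ''depth'') (var ''e''))
          (PIf (neq (var ''a'') (var ''col'')) PSkip
             (PIf (neq (Read ''Tape'' (var ''ptr'')) (Read ''Path'' (var ''e'')))
                (PAssign ''X'' (var ''v'') (Const 0)) PSkip)) PSkip ;;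
        ''ptr'' ::= Plus (var ''ptr'') (Const 1) ;;
        ''e'' ::= Plus (var ''e'') (Const 1) ;;
        ''a'' ::= Plus (var ''a'') (Const 1) ;;
        PIf (Minus (var ''k'') (var ''a'')) PSkip (''a'' ::= Const 0)"
    define x where "x = N - Suc j"
    define a' where "a' = dsem ?body (a(''i'' := (a ''i'')(0 := j)))"
    have P': "a ''e'' 0 = x" "a ''a'' 0 = x mod m ''k'' 0" "a ''ptr'' 0 = b + x" "a ''Tape'' = m ''Tape''"
      "a ''Path'' = m ''Path''" "a ''depth'' = m ''depth''" "a ''col'' = m ''col''" "a ''k'' = m ''k''"
      "a ''v'' = m ''v''" "a ''X'' = (m ''X'')(v := if \<forall>e < x. ok e then m ''X'' v else 0)"
      using P by (simp_all add: P_def x_def)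
    have "a' ''X'' = (if ok x then a ''X'' else (a ''X'')(v := 0))"
      using P'(1-9) by (simp add: a'_def ok_def v_def)
    then have "a' ''X'' = (m ''X'')(v := if \<forall>e < Suc x. ok e then m ''X'' v else 0)"
      using P'(10) by (simp add: All_less_Suc)
    moreover have "a' ''e'' 0 = Suc x" "a' ''a'' 0 = Suc x mod m ''k'' 0" "a' ''ptr'' 0 = b + Suc x"
      "a' ''Tape'' = m ''Tape''" "a' ''Path'' = m ''Path''" "a' ''depth'' = m ''depth''"
      "a' ''col'' = m ''col''" "a' ''k'' = m ''k''" "a' ''v'' = m ''v''"
      using P'(1-9) by (simp_all add: a'_def md)
    ultimately show "P j (dsem ?body (a(''i'' := (a ''i'')(0 := j))))"
      using P unfolding P_def a'_def[symmetric] * x_def[symmetric] by simp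
  qed (simp add: P_def b_def N_def v_def)
  then show "m' ''X'' = (m ''X'')(v :=
       if \<forall>e < min N (m ''depth'' 0). e mod m ''k'' 0 = m ''col'' 0 \<longrightarrow> m ''Tape'' (b + e) = m ''Path'' e
       then m ''X'' v else 0)" "m' ''ptr'' 0 = b + N"
    by (auto simp: P_def ok_def)
qed

lemma (in colouring) dsem_compute_X:
  fixes s :: store
  assumes "s ''n'' 0 = n" "s ''k'' 0 = k" "s ''c'' 0 = m" "s ''D'' 0 = k * L" "s ''depth'' 0 \<le> k * L"
    and tape: "\<And>i. i < S \<Longrightarrow> s ''Tape'' i = of_bool (i \<in> Y)"
    and v: "v < n"
  shows "dsem compute_X s ''X'' v = of_bool (v \<in> matching Y (s ''depth'' 0) (s ''Path''))"
proof -
  define d p where "d = s ''depth'' 0" and "p = s ''Path''"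
  define H where "H = m + k * L"
  define P where "P j a \<longleftrightarrow> j \<le> n \<and> a ''ptr'' 0 = (n - j) * H \<and>
     (\<forall>v. j \<le> v \<longrightarrow> v < n \<longrightarrow> a ''X'' v = of_bool (v \<in> matching Y d p)) \<and>
     (\<forall>x. x \<notin> mods compute_X \<longrightarrow> a x = s x)" for j and a :: store
  have "P 0 (dsem compute_X s)"
    unfolding compute_X_def dsem.simps(5)
  proof (rule dsem_PFor_inv[where P = P])
    fix j and a :: store
    assume P: "P (Suc j) a"
    then have j: "j < n" by (simp add: P_def)
    define a0 where "a0 = a(''v'' := (a ''v'')(0 := j))"
    define a1 where "a1 = dsem read_colour a0"
    define a2 where "a2 = a1(''X'' := (a1 ''X'')(a1 ''v'' 0 := if k - a1 ''col'' 0 \<noteq> 0 then 1 else 0))"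
    define a3 where "a3 = dsem check_cells a2"
    have a0: "a0 x = s x" if "x \<notin> mods compute_X" for x
      using that P by (auto simp: a0_def P_def mods_compute_X)
    have a1: "a1 x = a0 x" if "x \<notin> mods read_colour" for x
      using that unfolding a1_def by (rule dsem_frame)
    have a3: "a3 x = a2 x" if "x \<notin> mods check_cells" for x
      using that unfolding a3_def by (rule dsem_frame)
    have ptr0: "a0 ''ptr'' 0 = pos j 0" using P by (simp add: a0_def P_def pos_def H_def)
    have Tape: "a0 ''Tape'' = s ''Tape''" by (rule a0) (simp add: mods_compute_X)
    have tp: "s ''Tape'' (pos j i) = of_bool (pos j i \<in> Y)" if "i < H" for i
      using tape pos_less[OF j, of i] that by (simp add: H_def)
    have pj: "pos j 0 + i = pos j i" for i by (simp add: pos_def)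
    have col: "a1 ''col'' 0 = colour Y j"
    proof -
      have "a1 ''col'' 0 = set_encode {i. i < m \<and> s ''Tape'' (pos j i) \<noteq> 0}"
        using dsem_read_colour(1)[of a0] a0[of "''c''"] assms(3)
        unfolding a1_def ptr0 Tape pj by (simp add: mods_compute_X)
      also have "{i. i < m \<and> s ''Tape'' (pos j i) \<noteq> 0} = {i. i < m \<and> pos j i \<in> Y}"
        using tp by (auto simp: H_def)
      finally show ?thesis by (simp add: colour_def)
    qed
    have ptr1: "a1 ''ptr'' 0 = pos j m"
      using dsem_read_colour(2)[of a0] a0[of "''c''"] assms(3)
      unfolding a1_def ptr0 by (simp add: mods_compute_X pos_def)
    have v1: "a1 ''v'' 0 = j"
      using a1[of "''v''"] by (simp add: mods_read_colour a0_def)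
    have X1: "a1 ''X'' = a ''X''"
      using a1[of "''X''"] by (simp add: mods_read_colour a0_def)
    have a2s: "a2 x = s x" if "x \<notin> mods compute_X" for x
      using that a0[of x] a1[of x] by (simp add: a2_def mods_compute_X mods_read_colour)
    have "a3 ''X'' = (a2 ''X'')(a2 ''v'' 0 := if \<forall>e < min (a2 ''D'' 0) (a2 ''depth'' 0). e mod a2 ''k'' 0 = a2 ''col'' 0 \<longrightarrow>
         a2 ''Tape'' (a2 ''ptr'' 0 + e) = a2 ''Path'' e then a2 ''X'' (a2 ''v'' 0) else 0)"
      unfolding a3_def
    proof (rule dsem_check_cells)
      assume "0 < a2 ''D'' 0"
      then show "0 < a2 ''k'' 0"
        using a2s[of "''D''"] a2s[of "''k''"] assms(2,4) by (cases k) (auto simp: mods_compute_X)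
    qed
    also have "\<dots> = (a ''X'')(j := if \<forall>e<d. e mod k = colour Y j \<longrightarrow> s ''Tape'' (pos j (m + e)) = p e
        then of_bool (colour Y j < k) else 0)"
      using a2s[of "''D''"] a2s[of "''k''"] a2s[of "''depth''"] a2s[of "''Tape''"] a2s[of "''Path''"] assms(2,4,5) v1 X1 ptr1 col
      by (auto simp: mods_compute_X d_def p_def a2_def pos_def add_ac of_bool_def min_absorb2)
    also have "\<dots> = (a ''X'')(j := of_bool (j \<in> matching Y d p))"
    proof -
      have "s ''Tape'' (pos j (m + e)) = of_bool (pos j (m + e) \<in> Y)" if "e < d" for e
        using that assms(5) by (intro tp) (simp add: d_def H_def)
      then show ?thesis using j by (auto simp: matching_def)
    qed
    finally have X3: "a3 ''X'' = (a ''X'')(j := of_bool (j \<in> matching Y d p))" .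
    have "a2 ''ptr'' 0 = pos j m" using ptr1 by (simp add: a2_def)
    then have ptr3: "a3 ''ptr'' 0 = (n - j) * H"
    proof -
      have "a3 ''ptr'' 0 = a2 ''ptr'' 0 + a2 ''D'' 0"
        unfolding a3_def
      proof (rule dsem_check_cells)
        assume "0 < a2 ''D'' 0"
        then show "0 < a2 ''k'' 0"
          using a2s[of "''D''"] a2s[of "''k''"] assms(2,4) by (cases k) (auto simp: mods_compute_X)
      qed
      also have "\<dots> = Suc (n - Suc j) * H"
        using \<open>a2 ''ptr'' 0 = pos j m\<close> a2s[of "''D''"] assms(4) by (simp add: mods_compute_X pos_def H_def)
      also have "Suc (n - Suc j) = n - j" using j by simp
      finally show ?thesis .
    qed
    have "a3 x = s x" if "x \<notin> mods compute_X" for x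
      using that a3[of x] a2s[OF that] by (simp add: mods_compute_X mods_check_cells)
    moreover have "a3 ''X'' v = of_bool (v \<in> matching Y d p)" if "j \<le> v" "v < n" for v
      using that P X3 by (cases "v = j") (auto simp: P_def)
    ultimately have "P j a3" using j ptr3 by (simp add: P_def)
    moreover have "a3 = dsem (read_colour ;;
        PIf (Minus (var ''k'') (var ''col'')) (PAssign ''X'' (var ''v'') (Const 1))
          (PAssign ''X'' (var ''v'') (Const 0)) ;;
        check_cells) (a(''v'' := (a ''v'')(0 := j)))"
    proof -
      have "a1 ''k'' 0 = k"
        using a1[of "''k''"] a0[of "''k''"] assms(2) by (simp add: mods_compute_X mods_read_colour)
      then show ?thesis
        by (simp add: a3_def a2_def a1_def a0_def)
    qed
    ultimately show "P j (dsem (read_colour ;;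
        PIf (Minus (var ''k'') (var ''col'')) (PAssign ''X'' (var ''v'') (Const 1))
          (PAssign ''X'' (var ''v'') (Const 0)) ;;
        check_cells) (a(''v'' := (a ''v'')(0 := j))))"
      by simp
  qed (use assms(1) in \<open>auto simp: P_def mods_compute_X\<close>)
  then show ?thesis using v by (simp add: P_def d_def p_def)
qed

lemma dsem_backtrack:
  fixes s :: store
  assumes "s ''depth'' 0 \<le> s ''D'' 0"
  defines "d \<equiv> shed (s ''Path'') (s ''depth'' 0)"
  shows "dsem backtrack s ''depth'' 0 = d"
    and "dsem backtrack s ''Path'' = (if d = 0 then s ''Path'' else (s ''Path'')(d - 1 := 1))"
    and "dsem backtrack s ''Act'' 0 = (if d = 0 then 0 else s ''Act'' 0)"
proof -
  \<comment> \<open>Each iteration lowers the depth unless it has arrived at \<open>d\<close>; as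
    the initial depth is at most \<open>D\<close>, the \<open>D\<close> iterations suffice.\<close>
  define P where "P j a \<longleftrightarrow> a ''Path'' = s ''Path'' \<and> a ''Act'' = s ''Act'' \<and>
      shed (s ''Path'') (a ''depth'' 0) = d \<and> (a ''depth'' 0 \<le> j \<or> a ''depth'' 0 = d)"
    for j and a :: store
  let ?loop = "PFor ''i'' ''D''
       (PIf (var ''depth'')
          (PIf (Read ''Path'' (Minus (var ''depth'') (Const 1)))
             (''depth'' ::= Minus (var ''depth'') (Const 1)) PSkip) PSkip)"
  have "P 0 (dsem ?loop s)"
  proof (rule dsem_PFor_inv[where P = P])
    fix j and a :: store
    assume P: "P (Suc j) a"
    show "P j (dsem (PIf (var ''depth'')
          (PIf (Read ''Path'' (Minus (var ''depth'') (Const 1)))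
             (''depth'' ::= Minus (var ''depth'') (Const 1)) PSkip) PSkip) (a(''i'' := (a ''i'')(0 := j))))"
    proof (cases "a ''depth'' 0")
      case 0
      with P show ?thesis by (simp add: P_def)
    next
      case (Suc e)
      with P shed_le[of "s ''Path''" e] show ?thesis by (auto simp: P_def split: if_splits)
    qed
  qed (use assms in \<open>simp add: P_def\<close>)
  then have "dsem ?loop s ''Path'' = s ''Path''" "dsem ?loop s ''Act'' = s ''Act''"
    "dsem ?loop s ''depth'' 0 = d"
    by (auto simp: P_def)
  then show "dsem backtrack s ''depth'' 0 = d"
    "dsem backtrack s ''Path'' = (if d = 0 then s ''Path'' else (s ''Path'')(d - 1 := 1))"
    "dsem backtrack s ''Act'' 0 = (if d = 0 then 0 else s ''Act'' 0)"
    unfolding backtrack_def dsem.simps(5) by (auto simp del: dsem.simps(7))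
qed

lemma dsem_record_leaf:
  fixes s :: store
  assumes X: "\<And>v. v < s ''n'' 0 \<Longrightarrow> s ''X'' v = of_bool (v \<in> T)" and T: "T \<subseteq> {..<s ''n'' 0}"
  defines "s' \<equiv> dsem record_leaf s"
  defines "new \<equiv> card T \<le> s ''k'' 0 \<and> s ''Seen'' (set_encode T) < s ''Gen'' 0"
  shows "s' ''Seen'' = (if new then (s ''Seen'')(set_encode T := s ''Gen'' 0) else s ''Seen'')"
    and "s' ''Num'' 0 = (if new then Suc (s ''Num'' 0) else s ''Num'' 0)"
proof -
  define n where "n = s ''n'' 0"
  have finT: "finite T" using T finite_subset by blast
  \<comment> \<open>Horner's scheme: elements are read from the largest down and the code is doubled
    each time, so the sum ends as \<open>set_encode T\<close>.\<close>
  define P where "P j a \<longleftrightarrow> a ''code'' 0 = (\<Sum>v\<in>{v\<in>T. j \<le> v}. 2 ^ (v - j)) \<and> a ''size'' 0 = card {v\<in>T. j \<le> v} \<and>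
      (\<forall>x. x \<notin> {''v'', ''code'', ''size''} \<longrightarrow> a x = s x)"
    for j and a :: store
  let ?body = "''code'' ::= Plus (Plus (var ''code'') (var ''code'')) (Read ''X'' (var ''v'')) ;;
        ''size'' ::= Plus (var ''size'') (Read ''X'' (var ''v''))"
  let ?init = "\<lambda>s :: store. s(''code'' := (s ''code'')(0 := 0), ''size'' := (s ''size'')(0 := 0))"
  let ?loop = "PFor ''v'' ''n'' ?body"
  have "P 0 (dsem ?loop (?init s))"
  proof (rule dsem_PFor_inv[where P = P])
    have e: "{v \<in> T. n \<le> v} = {}" using T by (auto simp: n_def)
    show "P (?init s ''n'' 0) ((?init s)(''v'' := (?init s ''v'')(0 := ?init s ''n'' 0)))"
      unfolding P_def by (simp add: e flip: n_def)
  next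
    fix j and a :: store
    assume "j < ?init s ''n'' 0" and P: "P (Suc j) a"
    then have j: "j < n" by (simp add: n_def)
    have Xj: "a ''X'' j = of_bool (j \<in> T)"
      using P X j by (simp add: P_def n_def)
    have split: "{v \<in> T. j \<le> v} = (if j \<in> T then insert j {v \<in> T. Suc j \<le> v} else {v \<in> T. Suc j \<le> v})"
      by (auto simp: Suc_le_eq le_eq_less_or_eq)
    have fin: "finite {v \<in> T. Suc j \<le> v}" using finT by simp
    have "(\<Sum>v\<in>{v\<in>T. Suc j \<le> v}. 2 ^ (v - j)) = (\<Sum>v\<in>{v\<in>T. Suc j \<le> v}. 2 * (2::nat) ^ (v - Suc j))"
    proof (intro sum.cong refl)
      fix v assume "v \<in> {v\<in>T. Suc j \<le> v}"
      then have "v - j = Suc (v - Suc j)" by auto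
      then show "2 ^ (v - j) = 2 * (2::nat) ^ (v - Suc j)" by simp
    qed
    then have sum: "(\<Sum>v\<in>{v\<in>T. j \<le> v}. 2 ^ (v - j)) =
        2 * (\<Sum>v\<in>{v\<in>T. Suc j \<le> v}. (2::nat) ^ (v - Suc j)) + of_bool (j \<in> T)"
      unfolding split using fin by (simp add: sum_distrib_left)
    have card: "card {v\<in>T. j \<le> v} = card {v\<in>T. Suc j \<le> v} + of_bool (j \<in> T)"
      unfolding split using fin by simp
    show "P j (dsem ?body (a(''v'' := (a ''v'')(0 := j))))"
      using P Xj unfolding P_def sum card by simp
  qed
  then have loop: "dsem ?loop (?init s) ''code'' 0 = set_encode T" "dsem ?loop (?init s) ''size'' 0 = card T"
     "dsem ?loop (?init s) ''Seen'' = s ''Seen''" "dsem ?loop (?init s) ''Gen'' = s ''Gen''"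
     "dsem ?loop (?init s) ''Num'' = s ''Num''" "dsem ?loop (?init s) ''k'' = s ''k''"
    by (simp_all add: P_def set_encode_def)
  have s': "s' = dsem (PIf (Minus (var ''size'') (var ''k'')) PSkip
       (PIf (Minus (var ''Gen'') (Read ''Seen'' (var ''code'')))
          (PAssign ''Seen'' (var ''code'') (var ''Gen'') ;; ''Num'' ::= Plus (var ''Num'') (Const 1))
          PSkip)) (dsem ?loop (?init s))"
    unfolding s'_def record_leaf_def by (simp del: dsem.simps(6,7))
  show "s' ''Seen'' = (if new then (s ''Seen'')(set_encode T := s ''Gen'' 0) else s ''Seen'')"
    and "s' ''Num'' 0 = (if new then Suc (s ''Num'' 0) else s ''Num'' 0)"
    unfolding s' using loop by (auto simp: new_def simp del: dsem.simps(7))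
qed

section \<open>Randomness: sampling and majority votes\<close>

lemma sum_Pow_lessThan_Suc:
  fixes g :: "nat set \<Rightarrow> ennreal"
  shows "(\<Sum>Y\<in>Pow {..<Suc j}. g Y) = (\<Sum>Y\<in>Pow {..<j}. g Y + g (insert j Y))"
proof -
  have "(\<Sum>Y\<in>Pow {..<Suc j}. g Y) = (\<Sum>Y\<in>Pow {..<j} \<union> insert j ` Pow {..<j}. g Y)"
    by (simp add: lessThan_Suc Pow_insert)
  also have "\<dots> = (\<Sum>Y\<in>Pow {..<j}. g Y) + (\<Sum>Y\<in>insert j ` Pow {..<j}. g Y)"
    by (rule sum.union_disjoint) auto
  also have "(\<Sum>Y\<in>insert j ` Pow {..<j}. g Y) = (\<Sum>Y\<in>Pow {..<j}. g (insert j Y))"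
    by (subst sum.reindex) (auto intro!: inj_onI simp: insert_eq_iff subset_iff)
  finally show ?thesis by (simp add: sum.distrib)
qed

definition overwrite :: "nat set \<Rightarrow> nat \<Rightarrow> (nat \<Rightarrow> nat) \<Rightarrow> nat \<Rightarrow> nat" where
  "overwrite Y j f = (\<lambda>i. if i < j then of_bool (i \<in> Y) else f i)"

lemma overwrite_Suc:
  assumes "Y \<subseteq> {..<j}"
  shows "overwrite Y (Suc j) f = overwrite Y j (f(j := 0))"
    and "overwrite (insert j Y) (Suc j) f = overwrite Y j (f(j := 1))"
proof -
  have "j \<notin> Y" using assms by auto
  then show "overwrite Y (Suc j) f = overwrite Y j (f(j := 0))"
    "overwrite (insert j Y) (Suc j) f = overwrite Y j (f(j := 1))"
    by (auto simp: overwrite_def fun_eq_iff less_Suc_eq)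
qed

text \<open>The expectation becomes an average over all bit strings, which is the form in which the
  counting lemmas on colourings apply.\<close>

lemma ev_sample_le:
  assumes irrel: "\<And>x y a m. x \<in> {''i'', ''flip''} \<Longrightarrow> \<phi> (m(x := a)) = \<phi> m"
  defines "t \<equiv> (\<lambda>Y j m. m(''Tape'' := overwrite Y j (m ''Tape'')) :: store)"
  shows "ev Or sample \<phi> s \<le> (\<Sum>Y\<in>Pow {..<mem s ''S'' 0}. \<phi> (t Y (mem s ''S'' 0) (mem s))) / 2 ^ (mem s ''S'' 0)"
proof -
  \<comment> \<open>Averages over the cells below \<open>j\<close>, which are still to be drawn
    because the counter runs downwards.\<close>
  define J where "J j m = (\<Sum>Y\<in>Pow {..<j}. \<phi> (t Y j m)) / 2 ^ j" for j m
  have t_upd: "t Y j (m(x := a)) = (t Y j m)(x := a)" if "x \<noteq> ''Tape''" for Y j m x a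
    using that by (simp add: t_def fun_upd_twist[of x "''Tape''"])
  have J_upd: "J j (m(x := a)) = J j m" if "x \<in> {''i'', ''flip''}" for j m x a
  proof -
    have ne: "x \<noteq> ''Tape''" using that by auto
    show ?thesis unfolding J_def t_upd[OF ne] irrel[OF that] by (rule refl)
  qed
  have J_Suc: "J (Suc j) m = (J j (m(''Tape'' := (m ''Tape'')(j := 0))) + J j (m(''Tape'' := (m ''Tape'')(j := 1)))) / 2" for j m
  proof -
    have t0: "t Y (Suc j) m = t Y j (m(''Tape'' := (m ''Tape'')(j := 0)))"
      "t (insert j Y) (Suc j) m = t Y j (m(''Tape'' := (m ''Tape'')(j := 1)))" if "Y \<in> Pow {..<j}" for Y
      by (simp_all only: t_def fun_upd_same fun_upd_upd overwrite_Suc[OF PowD[OF that]])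
    have inv2: "inverse (2 * 2 ^ j) = inverse 2 * (inverse (2 ^ j) :: ennreal)"
      by (rule ennreal_inverse_mult) (simp_all add: power_less_top_ennreal)
    have "J (Suc j) m = (\<Sum>Y\<in>Pow {..<j}. \<phi> (t Y j (m(''Tape'' := (m ''Tape'')(j := 0)))) + \<phi> (t Y j (m(''Tape'' := (m ''Tape'')(j := 1))))) / 2 ^ Suc j"
      unfolding J_def sum_Pow_lessThan_Suc by (intro arg_cong[where f = "\<lambda>x. x / _"] sum.cong refl) (simp add: t0)
    also have "\<dots> = (J j (m(''Tape'' := (m ''Tape'')(j := 0))) + J j (m(''Tape'' := (m ''Tape'')(j := 1)))) / 2"
      by (simp add: J_def sum.distrib divide_ennreal_def inv2 mult_ac distrib_left)
    finally show ?thesis .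
  qed
  have "ev Or sample (J 0) s \<le> J (mem s ''S'' 0) (mem s)"
    unfolding sample_def
  proof (rule ev_PFor_le)
    fix j and s' :: state
    assume j: "mem s' ''i'' 0 = j"
    have "ev Or (PFlip ''flip'' ;; PAssign ''Tape'' (var ''i'') (var ''flip'')) (J j) s' \<le>
       ev Or (PFlip ''flip'') (\<lambda>m. J j (dsem (PAssign ''Tape'' (var ''i'') (var ''flip'')) m)) s'"
      by (rule ev_PSeq_det_le) auto
    also have "\<dots> = J (Suc j) (mem s')"
    proof -
      have sw: "m(''flip'' := f, ''Tape'' := g) = m(''Tape'' := g, ''flip'' := f)" for m :: store and f g
        by (rule fun_upd_twist) simp
      show ?thesis
        unfolding ev_PFlip J_Suc by (simp add: j sw J_upd)
    qed
    finally show "ev Or (PFlip ''flip'' ;; PAssign ''Tape'' (var ''i'') (var ''flip'')) (J j) s' \<le> J (Suc j) (mem s')" .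
  qed (simp_all add: J_upd del: fun_upd_apply)
  moreover have "J 0 = \<phi>" by (auto simp: J_def t_def overwrite_def fun_eq_iff divide_ennreal_def)
  ultimately show ?thesis by (simp add: J_def)
qed

lemma ev_PQuery: "ev Or (PQuery r x) \<phi> s =
   (\<integral>\<^sup>+ bt. \<phi> ((mem s)(r := (mem s r)(0 := of_bool (fst bt))))
      \<partial>measure_spmf (Or (calls s) {i. i < mem s ''n'' 0 \<and> mem s x i \<noteq> 0}))"
  by (simp add: ev_def nn_integral_bind_spmf measure_spmf_return_spmf nn_integral_return split_beta)

text \<open>
  Every wrong answer multiplies the potential by \<open>y\<^sup>2 = (1 - c) / c\<close>, so that it is at least
  \<open>1\<close> as soon as half of the answers are wrong.
\<close>

lemma ev_majority_le:
  fixes c :: real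
  assumes c: "0 < c" "c < 1 / 2"
    and or: "\<And>i. measure (measure_spmf (Or i {i. i < mem s ''n'' 0 \<and> mem s ''X'' i \<noteq> 0})) {bt. fst bt \<noteq> b} \<le> c"
  shows "ev Or majority (\<lambda>m. of_bool ((m ''ans'' 0 \<noteq> 0) \<noteq> b)) s \<le> ennreal ((2 * sqrt (c * (1 - c))) ^ (mem s ''q'' 0))"
proof -
  define X where "X = {i. i < mem s ''n'' 0 \<and> mem s ''X'' i \<noteq> 0}"
  define q where "q = mem s ''q'' 0"
  define y where "y = sqrt ((1 - c) / c)"
  have y2: "y\<^sup>2 = (1 - c) / c" using c by (simp add: y_def)
  have y1: "1 \<le> y" using c by (simp add: y_def)
  \<comment> \<open>The number of wrong votes among the \<open>q - j\<close> votes cast so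
    far.\<close>
  define wr where "wr j yes = (if b then (q - j) - yes else yes)" for j yes
  \<comment> \<open>A vote multiplies the term \<open>y ^ (2 * wr j yes)\<close> by at most 1 + (y ^
    2 - 1) c = 2 (1 - c) in expectation, which is prepaid for the \<open>j\<close> votes to come;
    the division by y ^ q normalises a lost vote to at least 1. Over all votes the factor per vote
    is 2 (1 - c) / y = 2 sqrt (c (1 - c)).\<close>
  define pot where "pot j yes = (2 * (1 - c)) ^ j * y ^ (2 * wr j yes) / y ^ q" for j yes
  have pot_ge: "0 \<le> pot j yes" for j yes using c y1 by (simp add: pot_def)
  define inv where "inv j m \<longleftrightarrow> m ''n'' = mem s ''n'' \<and> m ''X'' = mem s ''X'' \<and> m ''q'' 0 = q \<and>
     m ''yes'' 0 \<le> q - j \<and> j \<le> q" for j and m :: store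
  \<comment> \<open>Outside the invariant the potential is infinite, which makes the step inequality
    trivial there.\<close>
  define J where "J j m = (if inv j m then ennreal (pot j (m ''yes'' 0)) else \<top>)" for j m
  let ?last = "PIf (Minus (Plus (var ''yes'') (var ''yes'')) (var ''q'')) (''ans'' ::= Const 1) (''ans'' ::= Const 0)"
  let ?body = "PQuery ''ans'' ''X'' ;; PIf (var ''ans'') (''yes'' ::= Plus (var ''yes'') (Const 1)) PSkip"
  let ?\<phi> = "\<lambda>m. of_bool ((m ''ans'' 0 \<noteq> 0) \<noteq> b) :: ennreal"
  let ?s1 = "tick 3 (put ''yes'' 0 0 s)"
  have last: "?\<phi> (dsem ?last m) \<le> J 0 m" for m
  proof (cases "inv 0 m \<and> (dsem ?last m ''ans'' 0 \<noteq> 0) \<noteq> b")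
    case True
    then have "q \<le> 2 * wr 0 (m ''yes'' 0)"
      by (auto simp: inv_def wr_def split: if_splits)
    then have "y ^ q \<le> y ^ (2 * wr 0 (m ''yes'' 0))" using y1 by (rule power_increasing)
    then have "1 \<le> pot 0 (m ''yes'' 0)" using y1 by (simp add: pot_def)
    then show ?thesis using True by (simp add: J_def)
  qed (auto simp: J_def)
  have "ev Or majority ?\<phi> s \<le> ev Or (PFor ''lq'' ''q'' ?body ;; ?last) ?\<phi> ?s1"
    unfolding majority_def ev_PSeq[of _ "_ ::= _"] 
    by (simp add: measure_spmf_return_spmf nn_integral_return numeral_eq_Suc)
  also have "\<dots> \<le> ev Or (PFor ''lq'' ''q'' ?body) (\<lambda>m. ?\<phi> (dsem ?last m)) ?s1"
    by (rule ev_PSeq_det_le; simp)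
  also have "\<dots> \<le> ev Or (PFor ''lq'' ''q'' ?body) (J 0) ?s1"
    by (rule ev_mono, simp, rule last)
  also have "\<dots> \<le> J (mem ?s1 ''q'' 0) (mem ?s1)"
  proof (rule ev_PFor_le)
    fix j and s' :: state
    show "ev Or ?body (J j) s' \<le> J (Suc j) (mem s')"
    proof (cases "inv (Suc j) (mem s')")
      case inv: True
      define yes where "yes = mem s' ''yes'' 0"
      define A where "A = pot j (if b then Suc yes else yes)"
      have A0: "0 \<le> A" using pot_ge by (simp add: A_def)
      have yes_le: "yes \<le> q - Suc j" "Suc j \<le> q" using inv by (auto simp: inv_def yes_def)
      have powS: "y ^ (2 * Suc w) = y ^ (2 * w) * y\<^sup>2" for w
        by (simp add: power2_eq_square)
      have wrong: "pot j (if b then yes else Suc yes) = A * y\<^sup>2"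
      proof (cases b)
        case True
        have "wr j yes = Suc (wr j (Suc yes))" using True yes_le by (simp add: wr_def)
        then show ?thesis using True by (simp add: A_def pot_def powS[unfolded power2_eq_square] power2_eq_square)
      next
        case False
        have "wr j (Suc yes) = Suc (wr j yes)" using False by (simp add: wr_def)
        then show ?thesis using False by (simp add: A_def pot_def powS[unfolded power2_eq_square] power2_eq_square)
      qed
      have right: "pot (Suc j) yes = A * (2 * (1 - c))"
      proof -
        have "wr (Suc j) yes = wr j (if b then Suc yes else yes)" using yes_le by (auto simp: wr_def)
        then show ?thesis by (simp add: A_def pot_def)
      qed
      have step: "J j (dsem (PIf (var ''ans'') (''yes'' ::= Plus (var ''yes'') (Const 1)) PSkip)
          ((mem s')(''ans'' := (mem s' ''ans'')(0 := of_bool a)))) =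
          ennreal A + ennreal (A * (y\<^sup>2 - 1)) * of_bool (a \<noteq> b)" for a
      proof -
        have "J j (dsem (PIf (var ''ans'') (''yes'' ::= Plus (var ''yes'') (Const 1)) PSkip)
          ((mem s')(''ans'' := (mem s' ''ans'')(0 := of_bool a)))) = ennreal (pot j (if a then Suc yes else yes))"
          using inv yes_le by (auto simp: J_def inv_def yes_def)
        also have "\<dots> = ennreal A + ennreal (A * (y\<^sup>2 - 1)) * of_bool (a \<noteq> b)"
        proof (cases "a = b")
          case False
          then have "pot j (if a then Suc yes else yes) = A + A * (y\<^sup>2 - 1)"
            using wrong by (auto simp: algebra_simps split: if_splits)
          moreover have "0 \<le> A * (y\<^sup>2 - 1)" using A0 y1 by (simp add: one_le_power)
          ultimately show ?thesis using False A0 by (simp add: ennreal_plus)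
        qed (simp add: A_def)
        finally show ?thesis .
      qed
      have Xs': "{i. i < mem s' ''n'' 0 \<and> mem s' ''X'' i \<noteq> 0} = X"
        using inv by (simp add: inv_def X_def)
      define O' where "O' = measure_spmf (Or (calls s') X)"
      have "ev Or ?body (J j) s' \<le> ev Or (PQuery ''ans'' ''X'') (\<lambda>m. J j (dsem (PIf (var ''ans'') (''yes'' ::= Plus (var ''yes'') (Const 1)) PSkip) m)) s'"
        by (rule ev_PSeq_det_le) auto
      also have "\<dots> = (\<integral>\<^sup>+ bt. ennreal A + ennreal (A * (y\<^sup>2 - 1)) * of_bool (fst bt \<noteq> b) \<partial>O')"
        unfolding ev_PQuery Xs' O'_def step ..
      also have "\<dots> = ennreal A * emeasure O' (space O') + ennreal (A * (y\<^sup>2 - 1)) * (\<integral>\<^sup>+ bt. indicator {bt. fst bt \<noteq> b} bt \<partial>O')"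
        by (simp add: nn_integral_add nn_integral_cmult O'_def indicator_def of_bool_def)
      also have "\<dots> \<le> ennreal A * 1 + ennreal (A * (y\<^sup>2 - 1)) * ennreal c"
      proof (intro add_mono mult_left_mono)
        show "emeasure O' (space O') \<le> 1"
          unfolding O'_def by (rule measure_spmf.subprob_emeasure_le_1)
        show "(\<integral>\<^sup>+ bt. indicator {bt. fst bt \<noteq> b} bt \<partial>O') \<le> ennreal c"
          using or[of "calls s'"] c unfolding O'_def X_def[symmetric]
          by (simp add: measure_spmf.emeasure_eq_measure ennreal_leI)
      qed auto
      also have "\<dots> = ennreal (A + A * (y\<^sup>2 - 1) * c)"
        using A0 y1 c by (simp add: ennreal_plus ennreal_mult one_le_power)
      also have "A + A * (y\<^sup>2 - 1) * c = A * (2 * (1 - c))"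
        using c by (simp add: y2 field_simps)
      also have "ennreal (A * (2 * (1 - c))) = J (Suc j) (mem s')"
        using inv right by (simp add: J_def yes_def)
      finally show ?thesis .
    qed (simp add: J_def)
  qed (auto simp: J_def inv_def)
  also have "\<dots> = ennreal (pot q 0)"
    by (simp add: J_def inv_def q_def)
  also have "pot q 0 = (2 * (1 - c) / y) ^ q"
    by (simp add: pot_def wr_def power_divide)
  also have "2 * (1 - c) / y = 2 * sqrt (c * (1 - c))"
  proof -
    have "sqrt (c * (1 - c)) * y = sqrt ((1 - c)\<^sup>2)"
      using c by (simp add: y_def power2_eq_square flip: real_sqrt_mult)
    then have "sqrt (c * (1 - c)) * y = 1 - c" using c by simp
    moreover have "y > 0" using y1 by simp
    ultimately show ?thesis by (simp add: field_simps)
  qed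
  finally show ?thesis by (simp add: q_def)
qed

section \<open>Analysis of one counting run\<close>

text \<open>There are \<open>q\<close> votes per question, \<open>R\<close> rounds and
  \<open>B\<close> iterations in a run. \<open>oracle_error\<close> is a bound for each call
  separately; since every call draws a fresh sample, it applies in whatever state the call is
  made.\<close>

locale noisy_search = witness_search n k m L \<W>
  for n k m L :: nat and \<W> :: "nat set set" +
  fixes Or :: answerer and c :: real and q R B M :: nat
  assumes c: "0 < c" "c < 1 / 2"
    and oracle_error: "\<And>i X. X \<subseteq> {..<n} \<Longrightarrow> measure (measure_spmf (Or i X)) {bt. fst bt \<noteq> alive X} \<le> c"
    and B_pos: "0 < B"
begin

definition vote_error :: real where
  "vote_error = (2 * sqrt (c * (1 - c))) ^ q"

text \<open>The bound of \<open>card_found_ge\<close>: every witness is found in a round with at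
  least this probability.\<close>

definition hit_prob :: real where
  "hit_prob = 1 / (2 * 8 ^ k)"

abbreviation pend :: "nat set \<Rightarrow> nat \<Rightarrow> (nat \<Rightarrow> nat) \<Rightarrow> (nat \<times> nat set) list" where
  "pend Y \<equiv> tree_search.pending alive (matching Y) (k * L)"

abbreviation sibs :: "nat set \<Rightarrow> nat \<Rightarrow> (nat \<Rightarrow> nat) \<Rightarrow> (nat \<times> nat set) list" where
  "sibs Y \<equiv> tree_search.siblings alive (matching Y) (k * L)"

definition params :: "store \<Rightarrow> bool" where
  "params s \<longleftrightarrow> s ''n'' 0 = n \<and> s ''k'' 0 = k \<and> s ''c'' 0 = m \<and> s ''D'' 0 = k * L \<and>
     s ''S'' 0 = S \<and> s ''q'' 0 = q"

text \<open>\<open>F\<close> is ghost data: the memory holds only its size and the stamps of its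
  codes.\<close>

definition found_sets :: "nat set set \<Rightarrow> store \<Rightarrow> bool" where
  "found_sets F s \<longleftrightarrow> params s \<and> F \<subseteq> \<W> \<and> s ''Num'' 0 = card F \<and> (\<forall>c. s ''Seen'' c \<le> s ''Gen'' 0) \<and>
     (\<forall>c. s ''Seen'' c = s ''Gen'' 0 \<longleftrightarrow> c \<in> set_encode ` F)"

definition tape_of :: "nat set \<Rightarrow> store \<Rightarrow> bool" where
  "tape_of Y s \<longleftrightarrow> (\<forall>i<S. s ''Tape'' i = of_bool (i \<in> Y))"

text \<open>
  A state is ideal if all majority votes of the current run were right: \<open>F\<close> are the witnesses found so far, and
  \<open>xs\<close> are the nodes that the current round has yet to visit.
\<close>

definition ideal :: "nat set set \<Rightarrow> (nat \<times> nat set) list \<Rightarrow> store \<Rightarrow> bool" where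
  "ideal F xs s \<longleftrightarrow> found_sets F s \<and>
     (if s ''Act'' 0 = 0 then xs = []
      else \<exists>Y. tape_of Y s \<and> s ''depth'' 0 \<le> k * L \<and> xs = pend Y (s ''depth'' 0) (s ''Path''))"

text \<open>
  With \<open>t\<close> iterations and \<open>r\<close> rounds to come, the summands bound the probabilities that some witness is never found,
  that the iterations run out (which matters only if there are at most \<open>M\<close> witnesses), and that
  some majority vote is wrong.
\<close>

definition pot :: "nat \<Rightarrow> nat \<Rightarrow> nat set set \<Rightarrow> (nat \<times> nat set) list \<Rightarrow> real" where
  "pot t r F xs = (\<Sum>W\<in>\<W> - (F \<union> found xs). (1 - hit_prob) ^ r) +
     (if card \<W> \<le> M \<and> \<not> (r = 0 \<and> xs = [])
      then (real B - real t + real (length xs) + real r * visits_bound) / real B else 0) +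
     vote_error * (real (length xs) + real r * visits_bound)"

text \<open>\<open>F\<close> and the pending list are not stored in memory, so the potential is the
  infimum over all descriptions that fit. The inserted 1 is the trivial bound on a probability; it
  covers the states reached after a wrong vote.\<close>

definition J :: "nat \<Rightarrow> store \<Rightarrow> ennreal" where
  "J t s = Inf (insert 1 {ennreal (pot t (s ''Left'' 0) F xs) |F xs. ideal F xs s})"

lemma J_le: "ideal F xs s \<Longrightarrow> J t s \<le> ennreal (pot t (s ''Left'' 0) F xs)"
  unfolding J_def by (rule Inf_lower) auto

lemma J_le_1: "J t s \<le> 1"
  unfolding J_def by (rule Inf_lower) auto

lemma le_J: 
  assumes "e \<le> 1" "\<And>F xs. ideal F xs s \<Longrightarrow> e \<le> ennreal (pot t (s ''Left'' 0) F xs)"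
  shows "e \<le> J t s"
  unfolding J_def by (rule Inf_greatest) (use assms in auto)

lemma J_cong:
  assumes "\<And>x. x \<in> {''n'', ''k'', ''c'', ''D'', ''S'', ''q'', ''Num'', ''Seen'', ''Gen'', ''Act'', ''Tape'',
     ''depth'', ''Path'', ''Left''} \<Longrightarrow> s x = s' x"
  shows "J t s = J t s'"
  unfolding J_def ideal_def found_sets_def params_def tape_of_def by (simp add: assms)

lemma vote_error_nonneg: "0 \<le> vote_error"
  using c by (simp add: vote_error_def)

lemma hit_prob: "0 < hit_prob" "hit_prob \<le> 1"
proof -
  have "(1::real) \<le> 8 ^ k" by simp
  then have "(1::real) \<le> 2 * 8 ^ k" by linarith
  then show "0 < hit_prob" "hit_prob \<le> 1" by (simp_all add: hit_prob_def divide_simps)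
qed

lemma visits_bound_ge_1: "1 \<le> visits_bound"
  by (simp add: visits_bound_def)

lemma found_Cons: "found (x # xs) = found [x] \<union> found xs"
  by (auto simp: found_def)

lemma matching_subset: "matching Y d p \<subseteq> {..<n}"
  by (auto simp: matching_def)

lemma pend_nonempty:
  assumes "d \<le> k * L"
  shows "pend Y d p \<noteq> []"
proof (cases "d < k * L \<and> alive (matching Y d p)")
  case True
  then show ?thesis
    using tree_search.pending_descend[OF tree_search, of d "k * L" alive Y p] by simp
next
  case False
  then show ?thesis
    using tree_search.pending_finish[OF tree_search, of d "k * L" alive Y p] assms by auto
qed

lemma ideal_backtrack:
  assumes "found_sets F s" "s ''Act'' 0 \<noteq> 0" "tape_of Y s" "s ''depth'' 0 \<le> k * L"
  shows "ideal F (sibs Y (s ''depth'' 0) (s ''Path'')) (dsem backtrack s)"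
proof -
  let ?s = "dsem backtrack s" and ?d = "s ''depth'' 0" and ?p = "s ''Path''"
  have frame: "?s x = s x" if "x \<notin> {''i'', ''depth'', ''Path'', ''Act''}" for x
    using that by (intro dsem_frame) (simp add: mods_backtrack)
  have D: "?d \<le> s ''D'' 0" using assms(1,4) by (simp add: found_sets_def params_def)
  note bt = dsem_backtrack[of s, OF D]
  have "found_sets F ?s"
    using assms(1) by (simp add: found_sets_def params_def frame)
  moreover have "tape_of Y ?s" using assms(3) by (simp add: tape_of_def frame)
  moreover have "sibs Y ?d ?p = []" if "shed ?p ?d = 0"
    using that by (rule tree_search.siblings_0[OF tree_search])
  moreover have "sibs Y ?d ?p = pend Y (?s ''depth'' 0) (?s ''Path'')" if nz: "shed ?p ?d \<noteq> 0"
  proof -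
    obtain i where i: "shed ?p ?d = Suc i" using nz by (cases "shed ?p ?d") auto
    show ?thesis
      using tree_search.siblings_Suc[OF tree_search i] bt i by simp
  qed
  moreover have "?s ''depth'' 0 \<le> k * L" using bt(1) shed_le[of ?p ?d] assms(4) by simp
  ultimately show ?thesis
    using bt assms(2) unfolding ideal_def by auto
qed

lemma found_sets_record_leaf:
  assumes F: "found_sets F s" and T: "T \<subseteq> {..<n}" "alive T"
    and X: "\<And>v. v < n \<Longrightarrow> s ''X'' v = of_bool (v \<in> T)"
  shows "found_sets (F \<union> found [(k * L, T)]) (dsem record_leaf s)"
proof -
  let ?s = "dsem record_leaf s"
  have n: "s ''n'' 0 = n" "s ''k'' 0 = k" using F by (auto simp: found_sets_def params_def)
  have frame: "?s x = s x" if "x \<notin> {''v'', ''code'', ''size'', ''Seen'', ''Num''}" for x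
    using that by (intro dsem_frame) (simp add: mods_record_leaf)
  have rl: "?s ''Seen'' = (if card T \<le> k \<and> s ''Seen'' (set_encode T) < s ''Gen'' 0
       then (s ''Seen'')(set_encode T := s ''Gen'' 0) else s ''Seen'')"
    "?s ''Num'' 0 = (if card T \<le> k \<and> s ''Seen'' (set_encode T) < s ''Gen'' 0
       then Suc (s ''Num'' 0) else s ''Num'' 0)"
    using dsem_record_leaf[of s T] X T(1) n by simp_all
  have sub: "F \<union> found [(k * L, T)] \<subseteq> \<W>"
    using F found_subset[of "[(k * L, T)]"] T(1) by (simp add: found_sets_def)
  have fT: "found [(k * L, T)] = (if card T \<le> k then {T} else {})"
    using T(2) by (auto simp: found_def)
  have enc: "set_encode T \<in> set_encode ` F \<longleftrightarrow> T \<in> F"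
  proof
    assume "set_encode T \<in> set_encode ` F"
    then obtain W where W: "W \<in> F" "set_encode T = set_encode W" by auto
    then have "W \<in> \<W>" using F by (auto simp: found_sets_def)
    then have "finite W" using \<W>(1) finite_subset by blast
    moreover have "finite T" using T(1) finite_subset by blast
    ultimately have "T = W" using W(2) by (simp add: set_encode_eq)
    with W show "T \<in> F" by simp
  qed auto
  have finF: "finite F"
    using F finite_\<W> finite_subset by (auto simp: found_sets_def)
  have new: "s ''Seen'' (set_encode T) < s ''Gen'' 0 \<longleftrightarrow> T \<notin> F"
    using F enc by (metis found_sets_def nless_le)
  have "params ?s" using F by (simp add: found_sets_def params_def frame)
  moreover have "?s ''Num'' 0 = card (F \<union> found [(k * L, T)])"
    using F finF by (auto simp: rl new fT found_sets_def insert_absorb)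
  moreover have "?s ''Gen'' = s ''Gen''" by (simp add: frame)
  moreover have "\<forall>c. ?s ''Seen'' c \<le> s ''Gen'' 0"
    using F by (auto simp: rl found_sets_def)
  moreover have "\<forall>c. ?s ''Seen'' c = s ''Gen'' 0 \<longleftrightarrow> c \<in> set_encode ` (F \<union> found [(k * L, T)])"
    using F enc by (auto simp: rl new fT found_sets_def)
  ultimately show ?thesis using sub by (simp add: found_sets_def)
qed

text \<open>After a correct vote, one node leaves the pending list, and a witness that it reveals
  moves from the pending part to \<open>F\<close>. Hence the union of recorded witnesses and those
  still to be found in this round is unchanged.\<close>

lemma ideal_advance:
  assumes F: "found_sets F s" and act: "s ''Act'' 0 \<noteq> 0" and Y: "tape_of Y s" and d: "s ''depth'' 0 \<le> k * L"
  defines "T \<equiv> matching Y (s ''depth'' 0) (s ''Path'')"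
  assumes X: "\<And>v. v < n \<Longrightarrow> s ''X'' v = of_bool (v \<in> T)" and ans: "s ''ans'' 0 \<noteq> 0 \<longleftrightarrow> alive T"
  obtains F' xs' where "ideal F' xs' (dsem advance s)"
    and "length (pend Y (s ''depth'' 0) (s ''Path'')) = Suc (length xs')"
    and "F' \<union> found xs' = F \<union> found (pend Y (s ''depth'' 0) (s ''Path''))"
proof -
  let ?d = "s ''depth'' 0" and ?p = "s ''Path''"
  have D: "s ''D'' 0 = k * L" using F by (simp add: found_sets_def params_def)
  show thesis
  proof (cases "alive T \<and> ?d < k * L")
    case True
    define s' where "s' = dsem (PAssign ''Path'' (var ''depth'') (Const 0) ;; ''depth'' ::= Plus (var ''depth'') (Const 1)) s"
    have s': "dsem advance s = s'"
      using True ans D by (simp add: advance_def s'_def)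
    have p: "pend Y ?d ?p = (?d, T) # pend Y (Suc ?d) (?p(?d := 0))"
      unfolding T_def by (rule tree_search.pending_descend[OF tree_search]) (use True T_def in auto)
    have "ideal F (pend Y (Suc ?d) (?p(?d := 0))) s'"
      using F act Y True unfolding ideal_def s'_def
      by (auto simp: found_sets_def params_def tape_of_def intro!: exI[of _ Y])
    moreover have "found (pend Y ?d ?p) = found (pend Y (Suc ?d) (?p(?d := 0)))"
      using True unfolding p by (auto simp: found_def)
    ultimately show ?thesis
      using that[of F "pend Y (Suc ?d) (?p(?d := 0))"] unfolding s' p by simp
  next
    case False
    then have p: "pend Y ?d ?p = (?d, T) # sibs Y ?d ?p"
      unfolding T_def by (intro tree_search.pending_finish[OF tree_search]) (use d in auto)
    show ?thesis
    proof (cases "alive T")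
      case al: True
      with False d have dD: "?d = k * L" by simp
      let ?s1 = "dsem record_leaf s"
      have s': "dsem advance s = dsem backtrack ?s1"
        using al ans D dD by (simp add: advance_def)
      have frame: "?s1 x = s x" if "x \<notin> {''v'', ''code'', ''size'', ''Seen'', ''Num''}" for x
        using that by (intro dsem_frame) (simp add: mods_record_leaf)
      have "found_sets (F \<union> found [(k * L, T)]) ?s1"
        by (rule found_sets_record_leaf) (use F X al matching_subset in \<open>auto simp: T_def\<close>)
      from ideal_backtrack[OF this, of Y]
      have "ideal (F \<union> found [(k * L, T)]) (sibs Y ?d ?p) (dsem advance s)"
        using act Y d unfolding s' by (simp add: frame tape_of_def)
      then show ?thesis
        using that[of "F \<union> found [(k * L, T)]" "sibs Y ?d ?p"] unfolding p
        by (simp add: found_Cons[of _ "sibs Y (k * L) ?p"] dD Un_assoc)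
    next
      case al: False
      have s': "dsem advance s = dsem backtrack s"
        using al ans by (simp add: advance_def)
      have "found [(?d, T)] = {}" using al by (auto simp: found_def)
      then show ?thesis
        using that[OF ideal_backtrack[OF F act Y d, folded s']] unfolding p
        by (simp add: found_Cons[of _ "sibs Y ?d ?p"])
    qed
  qed
qed

text \<open>In the second summand, one node and one iteration less cancel out; in the third, the
  node that disappears releases \<open>vote_error\<close>, which pays for the risk of its own
  vote.\<close>

lemma pot_visit:
  assumes "length xs = Suc (length xs')" "F' \<union> found xs' = F \<union> found xs" "Suc t \<le> B"
  shows "pot t r F' xs' + vote_error \<le> pot (Suc t) r F xs" "0 \<le> pot t r F' xs'"
proof -
  have nn: "0 \<le> (real B - real t + real (length xs') + real r * visits_bound) / real B"
    using assms(3) visits_bound_ge_1 by (intro divide_nonneg_nonneg add_nonneg_nonneg) auto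
  moreover have "0 \<le> (\<Sum>W\<in>\<W> - (F' \<union> found xs'). (1 - hit_prob) ^ r)"
    using hit_prob by (intro sum_nonneg) auto
  moreover have "0 \<le> vote_error * (real (length xs') + real r * visits_bound)"
    using vote_error_nonneg visits_bound_ge_1 by (intro mult_nonneg_nonneg add_nonneg_nonneg) auto
  ultimately show "0 \<le> pot t r F' xs'" unfolding pot_def by auto
  show "pot t r F' xs' + vote_error \<le> pot (Suc t) r F xs"
    using nn assms(1,3) unfolding pot_def assms(2) by (auto simp: algebra_simps)
qed

text \<open>The assumption on \<open>Act\<close> and \<open>Left\<close> is what
  \<open>begin_round\<close> guarantees. It excludes an iteration that is wasted while rounds
  remain, for which the second summand could not pay.\<close>

lemma ev_visit_node_le:
  assumes t: "Suc t \<le> B" and act: "mem s ''Act'' 0 \<noteq> 0 \<or> mem s ''Left'' 0 = 0"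
  shows "ev Or visit_node (J t) s \<le> J (Suc t) (mem s)"
proof (rule le_J)
  show "ev Or visit_node (J t) s \<le> 1"
    by (rule ev_le_const) (auto simp: J_le_1)
next
  fix F xs assume id: "ideal F xs (mem s)"
  let ?r = "mem s ''Left'' 0"
  show "ev Or visit_node (J t) s \<le> ennreal (pot (Suc t) ?r F xs)"
  proof (cases "mem s ''Act'' 0 = 0")
    case True
    with id act have "xs = []" "?r = 0" by (auto simp: ideal_def)
    then have "pot t ?r F xs = pot (Suc t) ?r F xs" by (simp add: pot_def)
    moreover have "ev Or visit_node (J t) s \<le> J t (mem s)"
      unfolding visit_node_def ev_PIf using True by (simp add: ev_det_le)
    ultimately show ?thesis using J_le[OF id, of t] by simp
  next
    case False
    then obtain Y where F: "found_sets F (mem s)" and Y: "tape_of Y (mem s)"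
      and d: "mem s ''depth'' 0 \<le> k * L" and xs: "xs = pend Y (mem s ''depth'' 0) (mem s ''Path'')"
      using id by (auto simp: ideal_def)
    define d p where "d = mem s ''depth'' 0" and "p = mem s ''Path''"
    define T where "T = matching Y d p"
    \<comment> \<open>The potential left after a correct vote; a wrong vote costs at most 1, with
      probability at most \<open>vote_error\<close>.\<close>
    define A where "A = ennreal (pot (Suc t) ?r F xs - vote_error)"
    have "ev Or (compute_X ;; majority ;; advance) (J t) (tick 3 s) \<le> ennreal (pot (Suc t) ?r F xs)"
    proof (rule ev_det_PSeq_le)
      fix s1 :: state assume "mem s1 = dsem compute_X (mem (tick 3 s))"
      then have s1: "mem s1 = dsem compute_X (mem s)" by simp
      have fr1: "mem s1 x = mem s x" if "x \<notin> mods compute_X" for x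
        unfolding s1 using that by (rule dsem_frame)
      have X: "mem s1 ''X'' v = of_bool (v \<in> T)" if "v < n" for v
        unfolding s1 T_def d_def p_def
        by (rule dsem_compute_X) (use F Y d that in \<open>auto simp: found_sets_def params_def tape_of_def\<close>)
      have n1: "mem s1 ''n'' 0 = n" "mem s1 ''q'' 0 = q"
        using F by (auto simp: fr1 mods_compute_X found_sets_def params_def)
      have XT: "{i. i < mem s1 ''n'' 0 \<and> mem s1 ''X'' i \<noteq> 0} = T"
        using X n1 matching_subset[of Y d p] by (auto simp: T_def)
      have "ev Or (majority ;; advance) (J t) s1 \<le> ev Or majority (\<lambda>m. J t (dsem advance m)) s1"
        by (rule ev_PSeq_det_le) auto
      also have "\<dots> \<le> ev Or majority (\<lambda>m. A + 1 * of_bool ((m ''ans'' 0 \<noteq> 0) \<noteq> alive T)) s1"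
      proof (rule ev_mono)
        fix m assume m: "\<And>x. x \<notin> mods majority \<Longrightarrow> m x = mem s1 x"
        show "J t (dsem advance m) \<le> A + 1 * of_bool ((m ''ans'' 0 \<noteq> 0) \<noteq> alive T)"
        proof (cases "(m ''ans'' 0 \<noteq> 0) = alive T")
          case True
          have fr: "m x = mem s x" if "x \<notin> mods compute_X \<union> mods majority" for x
            using that m[of x] fr1[of x] by simp
          have ms: "m ''depth'' = mem s ''depth''" "m ''Path'' = mem s ''Path''" "m ''Left'' = mem s ''Left''"
            by (simp_all add: fr mods_compute_X mods_majority)
          have Fm: "found_sets F m"
            using F by (simp add: found_sets_def params_def fr mods_compute_X mods_majority)
          have am: "m ''Act'' 0 \<noteq> 0" using False by (simp add: fr mods_compute_X mods_majority)
          have Ym: "tape_of Y m" using Y by (simp add: tape_of_def fr mods_compute_X mods_majority)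
          have dm: "m ''depth'' 0 \<le> k * L" using d ms by simp
          have Xm: "m ''X'' v = of_bool (v \<in> matching Y (m ''depth'' 0) (m ''Path''))" if "v < n" for v
            using X[OF that] m[of "''X''"] by (simp add: mods_majority ms T_def d_def p_def)
          have ansm: "m ''ans'' 0 \<noteq> 0 \<longleftrightarrow> alive (matching Y (m ''depth'' 0) (m ''Path''))"
            using True by (simp add: ms T_def d_def p_def)
          obtain F' xs' where id': "ideal F' xs' (dsem advance m)"
            and l: "length xs = Suc (length xs')" and f: "F' \<union> found xs' = F \<union> found xs"
            using ideal_advance[OF Fm am Ym dm Xm ansm] by (auto simp: xs ms)
          have "dsem advance m ''Left'' = mem s ''Left''"
            using ms(3) by (subst dsem_frame) (simp_all add: mods_advance)
          then have "J t (dsem advance m) \<le> ennreal (pot t ?r F' xs')"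
            using J_le[OF id', of t] by simp
          also have "\<dots> \<le> A"
            unfolding A_def using pot_visit[OF l f t, of ?r] by (intro ennreal_leI) linarith
          finally show ?thesis using True by simp
        qed (use J_le_1[of t "dsem advance m"] in \<open>auto intro: order.trans add_increasing\<close>)
      qed auto
      also have "\<dots> \<le> A + 1 * ev Or majority (\<lambda>m. of_bool ((m ''ans'' 0 \<noteq> 0) \<noteq> alive T)) s1"
        by (rule ev_add_mult_le)
      also have "\<dots> \<le> A + 1 * ennreal vote_error"
      proof (intro add_left_mono mult_left_mono)
        show "ev Or majority (\<lambda>m. of_bool ((m ''ans'' 0 \<noteq> 0) \<noteq> alive T)) s1 \<le> ennreal vote_error"
        proof -
          have ve: "vote_error = (2 * sqrt (c * (1 - c))) ^ (mem s1 ''q'' 0)"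
            by (simp add: vote_error_def n1)
          show ?thesis
            unfolding ve by (rule ev_majority_le[OF c])
              (unfold XT, use oracle_error[of T] matching_subset in \<open>simp add: T_def\<close>)
        qed
      qed simp
      also have "\<dots> = ennreal (pot (Suc t) ?r F xs)"
      proof -
        have "pend Y d p \<noteq> []" using d by (intro pend_nonempty) (simp add: d_def)
        then have "xs \<noteq> []" by (simp add: xs d_def p_def)
        then obtain xs' where l: "length xs = Suc (length xs')" and "found xs' \<subseteq> found xs"
          by (cases xs) (auto simp: found_def)
        \<comment> \<open>A virtual step that only serves to show that the difference in
          \<open>A\<close> is nonnegative, so that \<open>ennreal\<close> does not truncate
          it.\<close>
        then have "(F \<union> found xs) \<union> found xs' = F \<union> found xs" by auto
        from pot_visit[OF l this t, of ?r] have "vote_error \<le> pot (Suc t) ?r F xs" by linarith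
        then show ?thesis
          unfolding A_def using vote_error_nonneg by (simp flip: ennreal_plus)
      qed
      finally show "ev Or (majority ;; advance) (J t) s1 \<le> ennreal (pot (Suc t) ?r F xs)" .
    qed auto
    then show ?thesis
      unfolding visit_node_def ev_PIf using False by (simp add: numeral_eq_Suc)
  qed
qed

text \<open>Averaging over the tapes, a fresh round trades one unit of \<open>r\<close> for a
  concrete search: a missing witness stays missing with probability at most
  \<open>1 - hit_prob\<close>, and the list has expected length at most
  \<open>visits_bound\<close>.\<close>

lemma sum_pot_search_le:
  assumes "F \<subseteq> \<W>" "t \<le> B"
  shows "(\<Sum>Y\<in>Pow {..<S}. pot t r F (search Y)) \<le> 2 ^ S * pot t (Suc r) F []"
proof -
  let ?P = "Pow {..<S}"
  define a where "a = (1 - hit_prob) ^ r"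
  have a: "0 \<le> a" using hit_prob by (simp add: a_def)
  have cardP: "real (card ?P) = 2 ^ S" by (simp add: card_Pow)
  have "(\<Sum>Y\<in>?P. \<Sum>W\<in>\<W> - (F \<union> found (search Y)). a) =
      (\<Sum>Y\<in>?P. \<Sum>W\<in>\<W> - F. a * of_bool (W \<notin> found (search Y)))"
  proof (rule sum.cong[OF refl])
    fix Y
    have "\<W> - (F \<union> found (search Y)) = {W \<in> \<W> - F. W \<notin> found (search Y)}" by auto
    then have "(\<Sum>W\<in>\<W> - (F \<union> found (search Y)). a) =
        (\<Sum>W\<in>\<W> - F. if W \<notin> found (search Y) then a else 0)"
      using sum.inter_filter[of "\<W> - F" "\<lambda>_. a"] finite_\<W> by simp
    also have "\<dots> = (\<Sum>W\<in>\<W> - F. a * of_bool (W \<notin> found (search Y)))"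
      by (intro sum.cong) auto
    finally show "(\<Sum>W\<in>\<W> - (F \<union> found (search Y)). a) = (\<Sum>W\<in>\<W> - F. a * of_bool (W \<notin> found (search Y)))" .
  qed
  also have "\<dots> = (\<Sum>W\<in>\<W> - F. \<Sum>Y\<in>?P. a * of_bool (W \<notin> found (search Y)))"
    by (rule sum.swap)
  also have "\<dots> \<le> (\<Sum>W\<in>\<W> - F. 2 ^ S * (1 - hit_prob) ^ Suc r)"
  proof (rule sum_mono)
    fix W assume W: "W \<in> \<W> - F"
    have "2 ^ S \<le> 2 * 8 ^ k * card {Y \<in> ?P. W \<in> found (search Y)}"
      using W by (intro card_found_ge) auto
    then have "real (2 ^ S) \<le> real (2 * 8 ^ k * card {Y \<in> ?P. W \<in> found (search Y)})"
      unfolding of_nat_le_iff .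
    then have ge: "2 ^ S * hit_prob \<le> real (card {Y \<in> ?P. W \<in> found (search Y)})"
      by (simp add: hit_prob_def field_simps)
    have "(\<Sum>Y\<in>?P. of_bool (W \<notin> found (search Y))) = (\<Sum>Y\<in>?P. 1 - of_bool (W \<in> found (search Y)) :: real)"
      by (intro sum.cong) auto
    also have "\<dots> = 2 ^ S - real (card {Y \<in> ?P. W \<in> found (search Y)})"
      by (simp add: sum_subtractf cardP of_bool_def sum.If_cases Int_def)
    also have "\<dots> \<le> 2 ^ S * (1 - hit_prob)" using ge by (simp add: algebra_simps)
    finally have "a * (\<Sum>Y\<in>?P. of_bool (W \<notin> found (search Y))) \<le> a * (2 ^ S * (1 - hit_prob))"
      using a by (rule mult_left_mono)
    then show "(\<Sum>Y\<in>?P. a * of_bool (W \<notin> found (search Y))) \<le> 2 ^ S * (1 - hit_prob) ^ Suc r"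
      by (simp add: sum_distrib_left[symmetric] a_def mult_ac)
  qed
  finally have 1: "(\<Sum>Y\<in>?P. \<Sum>W\<in>\<W> - (F \<union> found (search Y)). a) \<le>
      2 ^ S * (\<Sum>W\<in>\<W> - F. (1 - hit_prob) ^ Suc r)"
    by (simp add: mult_ac)
  define E where "E = (\<Sum>Y\<in>?P. real (length (search Y)))"
  have E: "E \<le> 2 ^ S * visits_bound" unfolding E_def by (rule sum_length_search_le)
  define G where "G Y = (real B - real t + real (length (search Y)) + real r * visits_bound) / real B" for Y
  have G0: "0 \<le> G Y" for Y
    unfolding G_def using assms(2) visits_bound_ge_1 by (intro divide_nonneg_nonneg add_nonneg_nonneg) auto
  have sumG: "(\<Sum>Y\<in>?P. G Y) \<le> 2 ^ S * ((real B - real t + real (Suc r) * visits_bound) / real B)"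
  proof -
    have "(\<Sum>Y\<in>?P. real B - real t + real (length (search Y)) + real r * visits_bound) =
        2 ^ S * (real B - real t + real r * visits_bound) + E"
      by (simp add: sum.distrib sum_subtractf cardP E_def algebra_simps)
    then have "(\<Sum>Y\<in>?P. G Y) = (2 ^ S * (real B - real t + real r * visits_bound) + E) / real B"
      unfolding G_def sum_divide_distrib[symmetric] by simp
    also have "\<dots> \<le> (2 ^ S * (real B - real t + real r * visits_bound) + 2 ^ S * visits_bound) / real B"
      using E by (intro divide_right_mono) auto
    also have "\<dots> = 2 ^ S * ((real B - real t + real (Suc r) * visits_bound) / real B)"
      by (simp add: algebra_simps add_divide_distrib)
    finally show ?thesis .
  qed
  have 2: "(\<Sum>Y\<in>?P. if card \<W> \<le> M \<and> \<not> (r = 0 \<and> search Y = []) then G Y else 0) \<le>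
      2 ^ S * (if card \<W> \<le> M \<and> \<not> (Suc r = 0 \<and> [] = []) then (real B - real t + real (length []) + real (Suc r) * visits_bound) / real B else 0)"
  proof (cases "card \<W> \<le> M")
    case True
    have "(\<Sum>Y\<in>?P. if card \<W> \<le> M \<and> \<not> (r = 0 \<and> search Y = []) then G Y else 0) \<le> (\<Sum>Y\<in>?P. G Y)"
      by (intro sum_mono) (use G0 in auto)
    then show ?thesis using sumG True by simp
  qed simp
  have "(\<Sum>Y\<in>?P. vote_error * (real (length (search Y)) + real r * visits_bound)) =
      vote_error * (E + 2 ^ S * (real r * visits_bound))"
    by (simp add: sum_distrib_left[symmetric] sum.distrib E_def cardP)
  also have "\<dots> \<le> vote_error * (2 ^ S * visits_bound + 2 ^ S * (real r * visits_bound))"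
    using E vote_error_nonneg by (intro mult_left_mono) auto
  finally have 3: "(\<Sum>Y\<in>?P. vote_error * (real (length (search Y)) + real r * visits_bound)) \<le>
      2 ^ S * (vote_error * (real (length []) + real (Suc r) * visits_bound))"
    by (simp add: algebra_simps)
  have "found [] = {}" by (simp add: found_def)
  then show ?thesis
    using add_mono[OF add_mono[OF 1 2] 3]
    unfolding pot_def a_def G_def sum.distrib by (simp only: distrib_left Un_empty_right)
qed

lemma pend_0: "pend Y 0 p = search Y"
  unfolding search_def tree_search.pending_def[OF tree_search] tree_search.siblings.simps[OF tree_search]
  using tree_search.trav_cong[OF tree_search, of 0 p "\<lambda>_. 0"] by simp

text \<open>Giving \<psi> the value 1 elsewhere hands the precondition of
  \<open>ev_visit_node_le\<close> over to the second half of the iteration.\<close>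

lemma ev_begin_round_le:
  assumes t: "t \<le> B"
  defines "\<psi> \<equiv> \<lambda>m. if m ''Act'' 0 \<noteq> 0 \<or> m ''Left'' 0 = 0 then J t m else 1"
  shows "ev Or begin_round \<psi> s \<le> J t (mem s)"
proof (cases "mem s ''Act'' 0 \<noteq> 0 \<or> mem s ''Left'' 0 = 0")
  case True
  then show ?thesis
    unfolding begin_round_def ev_PIf \<psi>_def by (auto simp: ev_det_le)
next
  case False
  define r where "r = mem s ''Left'' 0 - 1"
  have r: "mem s ''Left'' 0 = Suc r" using False by (simp add: r_def)
  let ?set = "''depth'' ::= Const 0 ;; ''Act'' ::= Const 1 ;; ''Left'' ::= Minus (var ''Left'') (Const 1)"
  have \<psi>1: "\<psi> m \<le> 1" for m using J_le_1 by (simp add: \<psi>_def)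
  show ?thesis
  proof (rule le_J)
    show "ev Or begin_round \<psi> s \<le> 1"
      by (rule ev_le_const) (auto simp: \<psi>1)
  next
    fix F xs assume id: "ideal F xs (mem s)"
    with False have xs: "xs = []" and F: "found_sets F (mem s)" by (auto simp: ideal_def)
    have S: "mem s ''S'' 0 = S" and FW: "F \<subseteq> \<W>" using F by (auto simp: found_sets_def params_def)
    define mY where "mY Y = (mem s)(''Tape'' := overwrite Y S (mem s ''Tape''))" for Y
    have "ev Or begin_round \<psi> s = ev Or (sample ;; ?set) \<psi> (tick 6 s)"
      unfolding begin_round_def ev_PIf using False by (simp add: tick_def numeral_eq_Suc)
    also have "\<dots> \<le> ev Or sample (\<lambda>m. \<psi> (dsem ?set m)) (tick 6 s)"
      by (rule ev_PSeq_det_le) auto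
    also have "\<dots> \<le> (\<Sum>Y\<in>Pow {..<mem (tick 6 s) ''S'' 0}. \<psi> (dsem ?set ((mem (tick 6 s))(''Tape'' := overwrite Y (mem (tick 6 s) ''S'' 0) (mem (tick 6 s) ''Tape'')))))
         / 2 ^ (mem (tick 6 s) ''S'' 0)"
    proof (rule ev_sample_le)
      fix x y a and m :: store assume "x \<in> {''i'', ''flip''}"
      then have eq: "dsem ?set (m(x := a)) y = dsem ?set m y" if "y \<notin> {''i'', ''flip''}" for y
        using that by auto
      have "J t (dsem ?set (m(x := a))) = J t (dsem ?set m)"
        by (rule J_cong, rule eq) auto
      moreover have "dsem ?set (m(x := a)) ''Act'' = dsem ?set m ''Act''"
        "dsem ?set (m(x := a)) ''Left'' = dsem ?set m ''Left''"
        by (rule eq; simp)+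
      ultimately show "\<psi> (dsem ?set (m(x := a))) = \<psi> (dsem ?set m)"
        by (simp only: \<psi>_def)
    qed
    also have "\<dots> = (\<Sum>Y\<in>Pow {..<S}. \<psi> (dsem ?set (mY Y))) / 2 ^ S"
      by (simp add: S mY_def)
    also have "\<dots> \<le> (\<Sum>Y\<in>Pow {..<S}. ennreal (pot t r F (search Y))) / 2 ^ S"
    proof (intro divide_right_mono_ennreal sum_mono)
      fix Y
      let ?m = "dsem ?set (mY Y)"
      have "ideal F (search Y) ?m"
        using F unfolding ideal_def
        by (auto simp: found_sets_def params_def tape_of_def mY_def overwrite_def pend_0 intro!: exI[of _ Y])
      from J_le[OF this, of t] show "\<psi> ?m \<le> ennreal (pot t r F (search Y))"
        by (simp add: \<psi>_def mY_def r)
    qed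
    also have "\<dots> = ennreal ((\<Sum>Y\<in>Pow {..<S}. pot t r F (search Y)) / 2 ^ S)"
    proof -
      have nn: "0 \<le> pot t r F (search Y)" for Y
        unfolding pot_def using hit_prob vote_error_nonneg visits_bound_ge_1 t
        by (intro add_nonneg_nonneg sum_nonneg) auto
      have "(2::ennreal) ^ S = ennreal (2 ^ S)" by (simp flip: ennreal_power)
      then show ?thesis
        using nn by (simp add: sum_ennreal divide_ennreal sum_nonneg)
    qed
    also have "\<dots> \<le> ennreal (pot t (Suc r) F [])"
      using sum_pot_search_le[OF FW t, of r] by (intro ennreal_leI) (simp add: field_simps)
    finally show "ev Or begin_round \<psi> s \<le> ennreal (pot t (mem s ''Left'' 0) F xs)"
      by (simp add: xs r)
  qed
qed

lemma ev_iteration_le: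
  assumes t: "Suc t \<le> B"
  shows "ev Or (begin_round ;; visit_node) (J t) s \<le> J (Suc t) (mem s)"
proof -
  have "ev Or (begin_round ;; visit_node) (J t) s \<le>
      ev Or begin_round (\<lambda>m. if m ''Act'' 0 \<noteq> 0 \<or> m ''Left'' 0 = 0 then J (Suc t) m else 1) s"
  proof (rule ev_PSeq_le)
    fix s'
    have "ev Or visit_node (J t) s' \<le> 1"
      by (rule ev_le_const) (auto simp: J_le_1)
    then show "ev Or visit_node (J t) s' \<le> (if mem s' ''Act'' 0 \<noteq> 0 \<or> mem s' ''Left'' 0 = 0 then J (Suc t) (mem s') else 1)"
      using ev_visit_node_le[OF t] by auto
  qed auto
  also have "\<dots> \<le> J (Suc t) (mem s)" using t by (rule ev_begin_round_le)
  finally show ?thesis .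
qed

lemma ev_count_once_le:
  assumes s: "params (mem s)" "mem s ''R'' 0 = R" "mem s ''B'' 0 = B"
    and seen: "\<And>c. mem s ''Seen'' c \<le> mem s ''Gen'' 0"
  shows "ev Or (count_once M) (\<lambda>m. of_bool (m ''res'' 0 \<noteq> min (card \<W>) (Suc M))) s \<le> ennreal (pot B R {} [])"
proof -
  let ?init = "''Gen'' ::= Plus (var ''Gen'') (Const 1) ;; ''Num'' ::= Const 0 ;;
     ''Left'' ::= var ''R'' ;; ''Act'' ::= Const 0"
  let ?loop = "PFor ''lb'' ''B'' (begin_round ;; visit_node)"
  let ?fin = "PIf (Plus (var ''Left'') (var ''Act'')) (''res'' ::= Const (M + 1))
       (PIf (Minus (var ''Num'') (Const M)) (''res'' ::= Const (M + 1)) (''res'' ::= var ''Num''))"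
  let ?\<phi> = "\<lambda>m :: store. of_bool (m ''res'' 0 \<noteq> min (card \<W>) (Suc M)) :: ennreal"
  have fin: "?\<phi> (dsem ?fin m) \<le> J 0 m" for m
  proof (rule le_J)
    fix F xs assume id: "ideal F xs m"
    let ?r = "m ''Left'' 0"
    have nn: "0 \<le> (\<Sum>W\<in>\<W> - (F \<union> found xs). (1 - hit_prob) ^ ?r)"
      "0 \<le> vote_error * (real (length xs) + real ?r * visits_bound)"
      using hit_prob vote_error_nonneg visits_bound_ge_1 by (auto intro!: sum_nonneg)
    show "?\<phi> (dsem ?fin m) \<le> ennreal (pot 0 ?r F xs)"
    proof (cases "dsem ?fin m ''res'' 0 = min (card \<W>) (Suc M)")
      case ne: False
      have "1 \<le> pot 0 ?r F xs"
      proof (cases "?r = 0 \<and> m ''Act'' 0 = 0")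
        case True
        then have xs: "xs = []" and F: "found_sets F m" using id by (auto simp: ideal_def)
        have "F \<noteq> \<W>"
        proof
          assume "F = \<W>"
          then show False using ne True F by (auto simp: found_sets_def min_def split: if_splits)
        qed
        \<comment> \<open>With no rounds left each missing witness weighs 1 in the first
          summand.\<close>
        then have "\<W> - F \<noteq> {}" using F by (auto simp: found_sets_def)
        then have "1 \<le> card (\<W> - F)" using finite_\<W> by (simp add: Suc_le_eq card_gt_0_iff)
        then show ?thesis using True xs by (simp add: pot_def found_def)
      next
        case False
        \<comment> \<open>An unfinished run reports \<open>M + 1\<close>, which is wrong only for at
          most \<open>M\<close> witnesses; then the second summand is at least 1, as no iterations
          remain.\<close>
        have "card \<W> \<le> M" using ne False by (auto simp: min_def split: if_splits)
        moreover have "\<not> (?r = 0 \<and> xs = [])"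
        proof
          assume *: "?r = 0 \<and> xs = []"
          with False id obtain Y where "[] = pend Y (m ''depth'' 0) (m ''Path'')" "m ''depth'' 0 \<le> k * L"
            by (auto simp: ideal_def)
          then show False using pend_nonempty by metis
        qed
        moreover have "1 \<le> (real B - real 0 + real (length xs) + real ?r * visits_bound) / real B"
          using B_pos visits_bound_ge_1 by simp
        ultimately show ?thesis using nn unfolding pot_def by simp
      qed
      then show ?thesis using ne by simp
    qed simp
  qed simp
  have reassoc: "ev Or (count_once M) ?\<phi> s = ev Or (?init ;; ?loop ;; ?fin) ?\<phi> s"
    by (simp add: count_once_def ev_def)
  show ?thesis
    unfolding reassoc
  proof (rule order.trans[OF ev_PSeq_le[where \<psi> = "\<lambda>m. if m ''B'' 0 = B then J B m else \<top>"]])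
    fix s'
    have "ev Or (?loop ;; ?fin) ?\<phi> s' \<le> ev Or ?loop (\<lambda>m. ?\<phi> (dsem ?fin m)) s'"
      by (rule ev_PSeq_det_le) auto
    also have "\<dots> \<le> ev Or ?loop (J 0) s'"
      by (rule ev_mono, simp add: mods_begin_round mods_visit_node, rule fin)
    also have "\<dots> \<le> J (mem s' ''B'' 0) (mem s')" if "mem s' ''B'' 0 = B"
    proof (rule ev_PFor_le)
      fix j s'' assume "j < mem s' ''B'' 0"
      then show "ev Or (begin_round ;; visit_node) (J j) s'' \<le> J (Suc j) (mem s'')"
        using that by (intro ev_iteration_le) simp
    qed (auto simp: mods_begin_round mods_visit_node intro!: J_cong)
    finally show "ev Or (?loop ;; ?fin) ?\<phi> s' \<le> (if mem s' ''B'' 0 = B then J B (mem s') else \<top>)"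
      by (simp del: dsem.simps)
  next
    show "ev Or ?init (\<lambda>m. if m ''B'' 0 = B then J B m else \<top>) s \<le> ennreal (pot B R {} [])"
    proof (rule ev_det_le)
      let ?m = "dsem ?init (mem s)"
      have "mem s ''Seen'' c < Suc (mem s ''Gen'' 0)" "mem s ''Seen'' c \<noteq> Suc (mem s ''Gen'' 0)" for c
        using seen[of c] by auto
      then have "ideal {} [] ?m"
        using s by (auto simp: ideal_def found_sets_def params_def less_imp_le)
      from J_le[OF this, of B] show "(if ?m ''B'' 0 = B then J B ?m else \<top>) \<le> ennreal (pot B R {} [])"
        using s by simp
    qed auto
  qed auto
qed

end

section \<open>Repeating the run\<close>

definition preserves :: "(store \<Rightarrow> bool) \<Rightarrow> prog \<Rightarrow> bool" where
  "preserves P p \<longleftrightarrow> (\<forall>Or s s'. P (mem s) \<longrightarrow> s' \<in> set_spmf (exec Or (com_of p) s) \<longrightarrow> P (mem s'))"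

lemma preserves_PSeq: "preserves P p \<Longrightarrow> preserves P p' \<Longrightarrow> preserves P (p ;; p')"
  unfolding preserves_def com_of.simps set_exec_Seq by blast

lemma preserves_PIf:
  assumes "preserves P p" "preserves P p'"
  shows "preserves P (PIf e p p')"
  unfolding preserves_def
proof (intro allI impI)
  fix Or s s' assume "P (mem s)" "s' \<in> set_spmf (exec Or (com_of (PIf e p p')) s)"
  then show "P (mem s')"
    using assms[unfolded preserves_def, rule_format, of "tick (1 + cost e) s" s' Or]
    by (simp split: if_splits)
qed

lemma preserves_PFor:
  assumes p: "preserves P p" and P: "\<And>m a. P (m(i := a)) \<longleftrightarrow> P m" and wf: "wf_prog (PFor i x p)"
  shows "preserves P (PFor i x p)"
proof -
  have *: "P (mem s')" if "P (mem s)" "s' \<in> set_spmf (exec Or (loop_of i p) s)" for Or s s'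
    using that
  proof (induction "mem s i 0" arbitrary: s)
    case 0
    then show ?case by (subst (asm) exec_loop_of) simp
  next
    case (Suc j)
    then obtain s1 where s1: "s1 \<in> set_spmf (exec Or (com_of p) (dec i s))"
      and s': "s' \<in> set_spmf (exec Or (loop_of i p) s1)"
      by (subst (asm) (3) exec_loop_of) (auto simp: set_bind_spmf o_def bind_UNION)
    have "mem s1 i 0 = j"
      using exec_frame[OF _ s1, of i] wf Suc(2) by simp
    moreover have "P (mem s1)"
      using p s1 Suc(3) P unfolding preserves_def by (metis dec_simps(1))
    ultimately show ?case using Suc(1)[OF _ _ s'] by simp
  qed
  show ?thesis
    unfolding preserves_def
  proof (intro allI impI)
    fix Or s s' assume s: "P (mem s)" "s' \<in> set_spmf (exec Or (com_of (PFor i x p)) s)"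
    then have "P (mem (tick 4 (put i 0 (mem s x 0) s)))" using P by simp
    from *[OF this] s show "P (mem s')" unfolding exec_PFor by blast
  qed
qed

lemma preserves_frame:
  assumes "wf_prog p" "\<And>m m'. (\<And>x. x \<notin> mods p \<Longrightarrow> m' x = m x) \<Longrightarrow> P m \<Longrightarrow> P m'"
  shows "preserves P p"
  unfolding preserves_def
proof (intro allI impI)
  fix Or s s' assume "P (mem s)" "s' \<in> set_spmf (exec Or (com_of p) s)"
  then show "P (mem s')"
    using assms(2)[of "mem s'" "mem s"] exec_frame[OF assms(1)] by blast
qed

lemma preserves_determ:
  assumes "wf_prog p" "determ p" "\<And>m. P m \<Longrightarrow> P (dsem p m)"
  shows "preserves P p"
  unfolding preserves_def
proof (intro allI impI)
  fix Or s s' assume "P (mem s)" "s' \<in> set_spmf (exec Or (com_of p) s)"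
  then show "P (mem s')"
    using assms(3)[of "mem s"] exec_det[OF assms(1,2), of s' Or s] by simp
qed

lemma ev_mono_preserves:
  assumes "wf_prog p" "preserves P p" "P (mem s)"
    and "\<And>m. (\<And>x. x \<notin> mods p \<Longrightarrow> m x = mem s x) \<Longrightarrow> P m \<Longrightarrow> \<phi> m \<le> \<psi> m"
  shows "ev Or p \<phi> s \<le> ev Or p \<psi> s"
  unfolding ev_def
proof (rule nn_integral_spmf_mono)
  fix s' assume s': "s' \<in> set_spmf (exec Or (com_of p) s)"
  then have "P (mem s')" using assms(2,3) unfolding preserves_def by blast
  moreover have "mem s' x = mem s x" if "x \<notin> mods p" for x
    using exec_frame[OF assms(1) s' that] .
  ultimately show "\<phi> (mem s') \<le> \<psi> (mem s')" by (intro assms(4))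
qed

text \<open>Must hold even after wrong votes, where no ideal description is available: if no stamp
  exceeds the generation, incrementing it makes every code unseen for the next run. This is why it
  is carried by \<open>preserves\<close> and not by the potential.\<close>

definition seen_ok :: "store \<Rightarrow> bool" where
  "seen_ok m \<longleftrightarrow> (\<forall>c. m ''Seen'' c \<le> m ''Gen'' 0)"

lemma preserves_seen_ok_frame:
  assumes "wf_prog p" "''Seen'' \<notin> mods p" "''Gen'' \<notin> mods p"
  shows "preserves seen_ok p"
proof (rule preserves_frame[OF assms(1)])
  fix m m' :: store assume "\<And>x. x \<notin> mods p \<Longrightarrow> m' x = m x" "seen_ok m"
  then show "seen_ok m'" using assms(2,3) by (simp add: seen_ok_def)
qed

lemma preserves_seen_ok_record_leaf: "preserves seen_ok record_leaf"
proof -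
  note fr = preserves_seen_ok_frame
  have "preserves seen_ok (PIf (Minus (var ''size'') (var ''k'')) PSkip
       (PIf (Minus (var ''Gen'') (Read ''Seen'' (var ''code'')))
          (PAssign ''Seen'' (var ''code'') (var ''Gen'') ;; ''Num'' ::= Plus (var ''Num'') (Const 1)) PSkip))"
    by (rule preserves_determ) (auto simp: seen_ok_def)
  then show ?thesis
    unfolding record_leaf_def
    by (intro preserves_PSeq[OF fr preserves_PSeq[OF fr preserves_PSeq[OF fr]]]) simp_all
qed

lemma preserves_seen_ok_count_once: "preserves seen_ok (count_once M)"
proof -
  note fr = preserves_seen_ok_frame
  have adv: "preserves seen_ok advance"
    unfolding advance_def
    by (intro preserves_PIf preserves_PSeq preserves_seen_ok_record_leaf fr) (auto simp: mods_backtrack)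
  have vis: "preserves seen_ok visit_node"
    unfolding visit_node_def
    by (intro preserves_PIf preserves_PSeq adv fr) (auto simp: mods_compute_X mods_majority)
  have rnd: "preserves seen_ok begin_round"
    by (rule fr) (auto simp: mods_begin_round)
  have loop: "preserves seen_ok (PFor ''lb'' ''B'' (begin_round ;; visit_node))"
    by (rule preserves_PFor, rule preserves_PSeq[OF rnd vis])
      (auto simp: seen_ok_def mods_begin_round mods_visit_node)
  have gen: "preserves seen_ok (''Gen'' ::= Plus (var ''Gen'') (Const 1))"
    by (rule preserves_determ) (auto simp: seen_ok_def intro: le_SucI)
  show ?thesis
    unfolding count_once_def
    by (intro preserves_PSeq[OF gen preserves_PSeq[OF fr preserves_PSeq[OF fr preserves_PSeq[OF fr preserves_PSeq[OF loop fr]]]]])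
      simp_all
qed

context noisy_search
begin

text \<open>Each run is wrong with probability at most 1 / 4. Weighting a wrong run by 3 gives an
  expected factor of at most 3 / 4 + 3 / 4 = 3 / 2 per run, while failure requires half of the runs
  to be wrong, hence a weight of at least sqrt 3 per run; the quotient is sqrt 3 / 2.\<close>

lemma ev_count_loop_le:
  assumes s: "params (mem s)" "mem s ''R'' 0 = R" "mem s ''B'' 0 = B" "mem s ''r'' 0 = \<rho>"
    and zero: "mem s ''Seen'' = (\<lambda>_. 0)" "mem s ''Hist'' = (\<lambda>_. 0)"
    and pot: "pot B R {} [] \<le> 1 / 4"
  shows "ev Or (count_loop M) (\<lambda>m. of_bool (m ''final'' 0 \<noteq> min (card \<W>) (Suc M))) s \<le> ennreal ((sqrt 3 / 2) ^ \<rho>)"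
proof -
  define w where "w = min (card \<W>) (Suc M)"
  \<comment> \<open>The joint bound on the frequencies of \<open>w\<close> and of another value
    forbids both from exceeding half of \<rho>, so \<open>final\<close> stays at \<open>w\<close>
    once it has been set by a majority.\<close>
  define inv where "inv j a \<longleftrightarrow> params a \<and> a ''R'' 0 = R \<and> a ''B'' 0 = B \<and> a ''r'' 0 = \<rho> \<and> seen_ok a \<and> j \<le> \<rho> \<and>
     a ''Hist'' w \<le> \<rho> - j \<and> (\<forall>v. v \<noteq> w \<longrightarrow> a ''Hist'' v + a ''Hist'' w \<le> \<rho> - j) \<and>
     (\<rho> < 2 * a ''Hist'' w \<longrightarrow> a ''final'' 0 = w)" for j and a :: store
  \<comment> \<open>The exponent of 3 is the number of wrong runs so far, and the factor 3 / 2 is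
    prepaid for the \<open>j\<close> runs to come.\<close>
  define pt where "pt j h = (3 / 2) ^ j * 3 ^ (\<rho> - j - h) / sqrt 3 ^ \<rho>" for j h
  define K where "K j a = (if inv j a then ennreal (pt j (a ''Hist'' w)) else \<top>)" for j a
  let ?body = "count_once M ;; tally"
  have "ev Or (count_loop M) (\<lambda>m. of_bool (m ''final'' 0 \<noteq> w)) s \<le> ev Or (count_loop M) (K 0) s"
  proof (rule ev_mono)
    fix m
    show "of_bool (m ''final'' 0 \<noteq> w) \<le> K 0 m"
    proof (cases "inv 0 m \<and> m ''final'' 0 \<noteq> w")
      case True
      then have "\<rho> \<le> 2 * (\<rho> - m ''Hist'' w)" by (auto simp: inv_def)
      then have "sqrt 3 ^ \<rho> \<le> sqrt 3 ^ (2 * (\<rho> - m ''Hist'' w))"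
        by (rule power_increasing) simp
      also have "\<dots> = 3 ^ (\<rho> - m ''Hist'' w)" by (simp add: power_mult)
      finally have "1 \<le> pt 0 (m ''Hist'' w)" by (simp add: pt_def)
      then show ?thesis using True by (simp add: K_def)
    qed (auto simp: K_def)
  qed simp
  also have "\<dots> \<le> K (mem s ''r'' 0) (mem s)"
    unfolding count_loop_def
  proof (rule ev_PFor_le)
    show "wf_prog (PFor ''lr'' ''r'' ?body)" by (simp add: mods_count_once mods_tally)
    have "inv j (a(''lr'' := (a ''lr'')(0 := v))) \<longleftrightarrow> inv j a" for j a v
      unfolding inv_def params_def seen_ok_def by simp
    then show "K j (a(''lr'' := (a ''lr'')(0 := v))) = K j a" for j a v
      by (simp add: K_def)
    fix j s' assume "j < mem s ''r'' 0"
    show "ev Or ?body (K j) s' \<le> K (Suc j) (mem s')"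
    proof (cases "inv (Suc j) (mem s')")
      case inv: True
      define h where "h = mem s' ''Hist'' w"
      define A where "A = (3 / 2) ^ j * 3 ^ (\<rho> - Suc j - h) / sqrt 3 ^ \<rho>"
      have A0: "0 \<le> A" by (simp add: A_def)
      have jr: "Suc j \<le> \<rho>" "h \<le> \<rho> - Suc j" using inv by (auto simp: inv_def h_def)
      have sj: "\<rho> - j = Suc (\<rho> - Suc j)" using jr by simp
      have sjh: "\<rho> - j - h = Suc (\<rho> - Suc j - h)" using jr by simp
      have "ev Or ?body (K j) s' \<le> ev Or (count_once M) (\<lambda>m. K j (dsem tally m)) s'"
        by (rule ev_PSeq_det_le) auto
      also have "\<dots> \<le> ev Or (count_once M) (\<lambda>m. ennreal A + ennreal (2 * A) * of_bool (m ''res'' 0 \<noteq> w)) s'"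
      proof (rule ev_mono_preserves[OF _ preserves_seen_ok_count_once])
        show "seen_ok (mem s')" using inv by (simp add: inv_def)
        fix m assume fr: "\<And>x. x \<notin> mods (count_once M) \<Longrightarrow> m x = mem s' x" and ok: "seen_ok m"
        have ms: "m ''Hist'' = mem s' ''Hist''" "m ''final'' = mem s' ''final''" "m ''r'' = mem s' ''r''"
          "m ''n'' = mem s' ''n''" "m ''k'' = mem s' ''k''" "m ''c'' = mem s' ''c''" "m ''D'' = mem s' ''D''"
          "m ''S'' = mem s' ''S''" "m ''q'' = mem s' ''q''" "m ''R'' = mem s' ''R''" "m ''B'' = mem s' ''B''"
          by (simp_all add: fr mods_count_once)
        let ?m = "dsem tally m"
        have Hist: "?m ''Hist'' = (m ''Hist'')(m ''res'' 0 := Suc (m ''Hist'' (m ''res'' 0)))"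
          and final: "?m ''final'' 0 = (if \<rho> < 2 * Suc (m ''Hist'' (m ''res'' 0)) then m ''res'' 0 else m ''final'' 0)"
          using inv by (auto simp: tally_def ms inv_def)
        have frt: "?m x = m x" if "x \<notin> {''Hist'', ''final''}" for x
          using that by (intro dsem_frame) (simp add: mods_tally)
        have rest: "params ?m" "?m ''R'' 0 = R" "?m ''B'' 0 = B" "?m ''r'' 0 = \<rho>" "seen_ok ?m"
          using inv ok by (simp_all add: params_def inv_def frt ms seen_ok_def)
        have H: "mem s' ''Hist'' v + h \<le> \<rho> - Suc j" if "v \<noteq> w" for v
          using inv that by (simp add: inv_def h_def)
        have fin: "\<rho> < 2 * h \<Longrightarrow> mem s' ''final'' 0 = w"
          using inv by (simp add: inv_def h_def)
        show "K j (dsem tally m) \<le> ennreal A + ennreal (2 * A) * of_bool (m ''res'' 0 \<noteq> w)"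
        proof (cases "m ''res'' 0 = w")
          case True
          have hw: "?m ''Hist'' w = Suc h" using True Hist by (simp add: ms h_def)
          have "inv j ?m"
            unfolding inv_def hw sj
          proof (intro conjI allI impI rest)
            show "j \<le> \<rho>" "Suc h \<le> Suc (\<rho> - Suc j)" using jr by auto
            show "?m ''Hist'' v + Suc h \<le> Suc (\<rho> - Suc j)" if "v \<noteq> w" for v
              using H[OF that] that True by (simp add: Hist ms)
            show "?m ''final'' 0 = w" if "\<rho> < 2 * Suc h"
              using that True by (simp add: final ms h_def)
          qed
          then have "K j ?m = ennreal (pt j (Suc h))" by (simp add: K_def hw)
          also have "pt j (Suc h) = A" by (simp add: pt_def A_def)
          finally show ?thesis using True by simp
        next
          case False
          have hw: "?m ''Hist'' w = h" using False Hist by (simp add: ms h_def)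
          have "inv j ?m"
            unfolding inv_def hw sj
          proof (intro conjI allI impI rest)
            show "j \<le> \<rho>" "h \<le> Suc (\<rho> - Suc j)" using jr by auto
            show "?m ''Hist'' v + h \<le> Suc (\<rho> - Suc j)" if "v \<noteq> w" for v
              using H[OF that] by (auto simp: Hist ms)
            assume "\<rho> < 2 * h"
            moreover have "mem s' ''Hist'' (m ''res'' 0) + h \<le> \<rho> - Suc j" using H False by simp
            ultimately have "\<not> \<rho> < 2 * Suc (m ''Hist'' (m ''res'' 0))" using jr by (simp add: ms)
            then show "?m ''final'' 0 = w" using fin \<open>\<rho> < 2 * h\<close> by (simp add: final ms)
          qed
          then have "K j ?m = ennreal (pt j h)" by (simp add: K_def hw)
          also have "pt j h = A + 2 * A" unfolding pt_def A_def sjh by simp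
          also have "ennreal (A + 2 * A) = ennreal A + ennreal (2 * A)"
            using A0 by (intro ennreal_plus) auto
          finally show ?thesis using False by simp
        qed
      qed (use ev_mono in simp)
      also have "\<dots> \<le> ennreal A + ennreal (2 * A) * ev Or (count_once M) (\<lambda>m. of_bool (m ''res'' 0 \<noteq> w)) s'"
        by (rule ev_add_mult_le)
      also have "\<dots> \<le> ennreal A + ennreal (2 * A) * ennreal (1 / 4)"
      proof (intro add_left_mono mult_left_mono)
        have "ev Or (count_once M) (\<lambda>m. of_bool (m ''res'' 0 \<noteq> w)) s' \<le> ennreal (pot B R {} [])"
          unfolding w_def by (rule ev_count_once_le) (use inv in \<open>auto simp: inv_def seen_ok_def\<close>)
        also have "\<dots> \<le> ennreal (1 / 4)" using pot by (rule ennreal_leI)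
        finally show "ev Or (count_once M) (\<lambda>m. of_bool (m ''res'' 0 \<noteq> w)) s' \<le> ennreal (1 / 4)" .
      qed simp
      also have "\<dots> = ennreal (A + 2 * A * (1 / 4))"
        using A0 by (simp flip: ennreal_plus ennreal_mult')
      also have "A + 2 * A * (1 / 4) = pt (Suc j) h"
        by (simp add: pt_def A_def)
      also have "ennreal (pt (Suc j) h) = K (Suc j) (mem s')"
        using inv by (simp add: K_def h_def)
      finally show ?thesis .
    qed (simp add: K_def)
  qed
  also have "\<dots> = ennreal (pt \<rho> 0)"
    using s zero by (simp add: K_def inv_def seen_ok_def)
  also have "pt \<rho> 0 = (sqrt 3 / 2) ^ \<rho>"
  proof -
    have "3 / 2 / sqrt 3 = sqrt 3 / 2" by (simp add: field_simps)
    moreover have "pt \<rho> 0 = (3 / 2 / sqrt 3) ^ \<rho>" by (simp add: pt_def power_divide)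
    ultimately show ?thesis by (simp only:)
  qed
  finally show ?thesis by (simp add: w_def)
qed

end

section \<open>Choice of the parameters\<close>

definition clog :: "nat \<Rightarrow> nat" where
  "clog x = (LEAST j. x \<le> 2 ^ j)"

lemma clog_ge: "x \<le> 2 ^ clog x"
  unfolding clog_def by (rule LeastI[of _ x]) (simp add: less_imp_le)

lemma clog_le: "x \<le> 2 ^ j \<Longrightarrow> clog x \<le> j"
  unfolding clog_def by (rule Least_le)

lemma clog_less: "j < clog x \<Longrightarrow> 2 ^ j < x"
  using clog_le[of x j] by (meson not_le)

lemma clog_upper: "2 ^ clog x \<le> 2 * x" if "0 < x"
proof (cases "clog x")
  case (Suc j)
  then show ?thesis using clog_less[of j x] by simp
qed (use that in simp)

lemma clog_self: "clog x \<le> x"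
  by (rule clog_le) (simp add: less_imp_le)

text \<open>Each summand of \<open>pot\<close> is at most 1 / 16. There are at most 2 ^ (k g)
  witnesses, and each is missed by all rounds with probability at most exp (- (k g + 4));
  \<open>B\<close> is 16 times a bound on the expected number of nodes for \<open>M\<close>
  witnesses; and with x = k g + k + 1 at most 2 ^ (17 x) / 16 nodes are expected, against an error
  of 2 ^ (- 17 x) for each vote.\<close>

lemma (in noisy_search) pot_le:
  assumes M: "1 \<le> M" and g: "n \<le> 2 ^ g" and L: "L = g + 1"
    and R: "R = (k * g + 4) * (2 * 8 ^ k)" and B: "B = 16 * (R * ((2 * (k * L) + 1) * 8 ^ k)) * M"
    and q: "q = C0 * (k * g + k + 1)" and C0: "(2 * sqrt (c * (1 - c))) ^ C0 \<le> (1 / 2) ^ 17"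
  shows "pot B R {} [] \<le> 1 / 4"
proof -
  define N where "N = card \<W>"
  define G where "G = k * g"
  define x where "x = G + k + 1"
  define V where "V = (2 * (k * L) + 1) * 8 ^ k"
  have N_le: "N \<le> 2 ^ G"
  proof -
    have "N \<le> card {W. W \<subseteq> {..<n} \<and> card W = k}"
      unfolding N_def by (rule card_mono) (use \<W> in auto)
    also have "\<dots> = n choose k" using n_subsets[of "{..<n}" k] by simp
    also have "\<dots> \<le> n ^ k"
    proof -
      have "(n choose k) * 1 \<le> (n choose k) * fact k" by (intro mult_left_mono) auto
      also have "\<dots> \<le> n ^ k" using binomial_fact_pow[of n k] by simp
      finally show ?thesis by simp
    qed
    also have "\<dots> \<le> (2 ^ g) ^ k" using g by (rule power_mono) simp
    finally show ?thesis by (simp add: G_def power_mult mult.commute)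
  qed
  have vb: "visits_bound \<le> real (V * max 1 N)"
  proof -
    have "visits_bound = 1 + real (2 * N * (k * L) * 2 ^ k)" by (simp add: visits_bound_def N_def)
    also have "\<dots> \<le> real (max 1 N * 8 ^ k) + real (2 * max 1 N * (k * L) * 8 ^ k)"
    proof (intro add_mono of_nat_mono mult_mono)
      have "1 * 1 \<le> max 1 N * 8 ^ k" by (intro mult_mono) auto
      then show "1 \<le> real (max 1 N * 8 ^ k)" by linarith
    qed (auto intro: power_mono)
    also have "\<dots> = real (V * max 1 N)" by (simp add: V_def algebra_simps)
    finally show ?thesis .
  qed
  have miss: "real N * (1 - hit_prob) ^ R \<le> 1 / 16"
  proof -
    have "(1 - hit_prob) ^ R \<le> exp (- hit_prob) ^ R"
      using exp_ge_add_one_self[of "- hit_prob"] hit_prob by (intro power_mono) auto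
    also have "\<dots> = exp (- (real R * hit_prob))" by (simp flip: exp_of_nat_mult)
    also have "real R * hit_prob = real (G + 4)" by (simp add: R hit_prob_def G_def field_simps)
    also have "exp (- real (G + 4)) = exp (- 1) ^ (G + 4)"
      by (simp flip: exp_of_nat_mult)
    also have "\<dots> \<le> (1 / 2) ^ (G + 4)"
      using exp_ge_add_one_self[of 1] by (intro power_mono) (auto simp: exp_minus field_simps)
    also have "\<dots> = (1 / 2) ^ G * (1 / 16)" by (simp add: power_add power_divide)
    finally have "real N * (1 - hit_prob) ^ R \<le> real N * ((1 / 2) ^ G * (1 / 16))"
      by (rule mult_left_mono) simp
    also have "\<dots> \<le> 2 ^ G * ((1 / 2) ^ G * (1 / 16))"
      using N_le by (intro mult_right_mono) (auto simp: of_nat_le_iff[symmetric] simp del: of_nat_le_iff)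
    also have "\<dots> = 1 / 16" by (simp add: power_divide)
    finally show ?thesis .
  qed
  have time: "real R * visits_bound / real B \<le> 1 / 16" if "N \<le> M"
  proof -
    have "real R * visits_bound \<le> real R * real (V * max 1 N)"
      using vb by (rule mult_left_mono) simp
    also have "\<dots> \<le> real R * real (V * M)"
      using that M by (intro mult_left_mono of_nat_mono) auto
    also have "\<dots> = real B / 16" by (simp add: B V_def)
    finally show ?thesis using B_pos by (simp add: field_simps)
  qed
  have two: "y + 1 \<le> 2 ^ y" for y :: nat
    by (induction y) auto
  have votes: "vote_error * (real R * visits_bound) \<le> 1 / 16"
  proof -
    have kx: "k \<le> x" "G + 4 \<le> 4 * x" "G \<le> x" by (auto simp: x_def)
    have kL: "2 * (k * L) + 1 \<le> 2 * x" by (simp add: x_def G_def L algebra_simps)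
    have x2: "x \<le> 2 ^ x" using two[of x] by simp
    have G4: "G + 4 \<le> 4 * 2 ^ x" using kx(2) x2 by linarith
    have kL2: "2 * (k * L) + 1 \<le> 2 * 2 ^ x" using kL x2 by linarith
    have e8: "(8::nat) ^ k \<le> 2 ^ (3 * x)"
      using kx by (simp add: power_mult power_mono power_increasing)
    \<comment> \<open>Origin of the exponent 17: the factors contribute 2 ^ (9 x), and the constant
      256 is at most 2 ^ (8 x). The maximum with 1 takes care of the root that is visited even
      without witnesses.\<close>
    have "16 * (R * (V * max 1 N)) \<le> 16 * (((4 * 2 ^ x) * (2 * 2 ^ (3 * x))) * ((2 * 2 ^ x * 2 ^ (3 * x)) * 2 ^ x))"
    proof (intro mult_mono order_refl)
      show "max 1 N \<le> 2 ^ x"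
        using N_le kx(3) by (meson le_trans max.boundedI one_le_numeral one_le_power power_increasing)
      show "R \<le> 4 * 2 ^ x * (2 * 2 ^ (3 * x))"
        unfolding R G_def[symmetric] using G4 e8 by (intro mult_mono) auto
      show "V \<le> 2 * 2 ^ x * 2 ^ (3 * x)"
        unfolding V_def using kL2 e8 by (intro mult_mono) auto
    qed auto
    also have "\<dots> = 256 * (2 ^ x * 2 ^ (3 * x) * (2 ^ x * 2 ^ (3 * x) * 2 ^ x))"
      by simp
    also have "\<dots> = 256 * 2 ^ (x + 3 * x + (x + 3 * x + x))"
      by (simp only: power_add)
    also have "\<dots> \<le> (2::nat) ^ (8 * x) * 2 ^ (9 * x)"
    proof (intro mult_mono)
      have "(256::nat) \<le> 2 ^ 8" by simp
      also have "\<dots> \<le> 2 ^ (8 * x)" by (intro power_increasing) (auto simp: x_def)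
      finally show "(256::nat) \<le> 2 ^ (8 * x)" .
    qed auto
    also have "\<dots> = 2 ^ (17 * x)" by (simp flip: power_add)
    also have "\<dots> = (2 ^ 17) ^ x" by (rule power_mult)
    finally have "real (16 * (R * (V * max 1 N))) \<le> real ((2 ^ 17) ^ x)"
      by (rule of_nat_mono)
    then have le: "16 * real (R * (V * max 1 N)) \<le> (2 ^ 17) ^ x"
      by (simp only: of_nat_mult of_nat_power of_nat_numeral)
    have qx: "q = C0 * x" by (simp add: q x_def G_def)
    have "vote_error = ((2 * sqrt (c * (1 - c))) ^ C0) ^ x"
      unfolding vote_error_def unfolding qx by (rule power_mult)
    also have "\<dots> \<le> ((1 / 2) ^ 17) ^ x"
      using C0 c by (intro power_mono) auto
    finally have ve: "vote_error \<le> ((1 / 2) ^ 17) ^ x" .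
    have "vote_error * (real R * visits_bound) \<le> ((1 / 2) ^ 17) ^ x * (real R * real (V * max 1 N))"
      using ve vb visits_bound_ge_1 by (intro mult_mono) auto
    also have "\<dots> \<le> ((1 / 2) ^ 17) ^ x * ((2 ^ 17) ^ x / 16)"
      using le by (intro mult_left_mono) auto
    also have "\<dots> = 1 / 16" by (simp add: power_divide)
    finally show ?thesis .
  qed
  have f: "found [] = {}" by (simp add: found_def)
  have "pot B R {} [] \<le> 1 / 16 + 1 / 16 + 1 / 16"
    unfolding pot_def
  proof (intro add_mono)
    show "(\<Sum>W\<in>\<W> - ({} \<union> found []). (1 - hit_prob) ^ R) \<le> 1 / 16"
      using miss by (simp add: f N_def)
    show "(if card \<W> \<le> M \<and> \<not> (R = 0 \<and> [] = [])
      then (real B - real B + real (length []) + real R * visits_bound) / real B else 0) \<le> 1 / 16"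
      using time by (simp add: N_def)
    show "vote_error * (real (length []) + real R * visits_bound) \<le> 1 / 16"
      using votes by simp
  qed
  then show ?thesis by simp
qed

section \<open>Computing the parameters\<close>

text \<open>Repeated addition: the time is linear in the value of \<open>x\<close>, so the order of
  the factors matters for the running time.\<close>

definition mult :: "vname \<Rightarrow> vname \<Rightarrow> vname \<Rightarrow> prog" where
  "mult z x y = z ::= Const 0 ;; PFor ''i'' x (z ::= Plus (var z) (var y))"

definition ceil_log :: "vname \<Rightarrow> vname \<Rightarrow> prog" where
  "ceil_log z x =
     ''w'' ::= Const 1 ;; z ::= Const 0 ;;
     PFor ''i'' x
       (PIf (Minus (var x) (var ''w''))
          (''w'' ::= Plus (var ''w'') (var ''w'') ;; z ::= Plus (var z) (Const 1)) PSkip)"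

definition power8 :: prog where
  "power8 =
     ''E'' ::= Const 1 ;;
     PFor ''i'' ''k''
       (''E'' ::= Plus (var ''E'') (var ''E'') ;; ''E'' ::= Plus (var ''E'') (var ''E'') ;;
        ''E'' ::= Plus (var ''E'') (var ''E''))"

lemma clog_iff: "2 ^ j < x \<longleftrightarrow> j < clog x"
proof
  assume *: "2 ^ j < x"
  show "j < clog x"
  proof (rule ccontr)
    assume "\<not> j < clog x"
    then have "(2::nat) ^ clog x \<le> 2 ^ j" by (intro power_increasing) auto
    with * clog_ge[of x] show False by linarith
  qed
qed (rule clog_less)

lemma dsem_mult:
  assumes "z \<noteq> ''i''" "x \<notin> {z, ''i''}" "y \<notin> {z, ''i''}"
  shows "dsem (mult z x y) s = s(z := (s z)(0 := s x 0 * s y 0), ''i'' := (s ''i'')(0 := 0))"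
proof -
  define P where "P j a \<longleftrightarrow> j \<le> s x 0 \<and> a = s(z := (s z)(0 := (s x 0 - j) * s y 0), ''i'' := (s ''i'')(0 := j))" for j and a :: store
  have "P 0 (dsem (mult z x y) s)"
    unfolding mult_def dsem.simps(5)
  proof (rule dsem_PFor_inv[where P = P])
    fix j and a :: store
    assume P: "P (Suc j) a"
    then have "s x 0 - j = Suc (s x 0 - Suc j)" by (auto simp: P_def)
    with P assms show "P j (dsem (z ::= Plus (var z) (var y)) (a(''i'' := (a ''i'')(0 := j))))"
      by (auto simp: P_def fun_eq_iff)
  qed (use assms in \<open>auto simp: P_def fun_eq_iff\<close>)
  then show ?thesis by (simp add: P_def)
qed

lemma dsem_ceil_log:
  assumes "z \<notin> {''i'', ''w''}" "x \<notin> {z, ''i'', ''w''}"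
  shows "dsem (ceil_log z x) s = s(''w'' := (s ''w'')(0 := 2 ^ clog (s x 0)),
     z := (s z)(0 := clog (s x 0)), ''i'' := (s ''i'')(0 := 0))"
proof -
  define X where "X = s x 0"
  define P where "P j a \<longleftrightarrow> j \<le> X \<and> a = s(''w'' := (s ''w'')(0 := 2 ^ min (X - j) (clog X)),
     z := (s z)(0 := min (X - j) (clog X)), ''i'' := (s ''i'')(0 := j))" for j and a :: store
  have "P 0 (dsem (ceil_log z x) s)"
    unfolding ceil_log_def dsem.simps(5)
  proof (rule dsem_PFor_inv[where P = P])
    fix j and a :: store
    assume P: "P (Suc j) a"
    define y where "y = min (X - Suc j) (clog X)"
    have "2 ^ y < X \<longleftrightarrow> y < clog X"
      by (rule clog_iff)
    moreover have "min (X - j) (clog X) = (if y < clog X then Suc y else y)"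
      using P by (auto simp: y_def P_def)
    ultimately show "P j (dsem (PIf (Minus (var x) (var ''w''))
          (''w'' ::= Plus (var ''w'') (var ''w'') ;; z ::= Plus (var z) (Const 1)) PSkip) (a(''i'' := (a ''i'')(0 := j))))"
      using P assms unfolding P_def y_def[symmetric] by (auto simp: fun_eq_iff X_def)
  qed (use assms in \<open>auto simp: P_def X_def fun_eq_iff\<close>)
  then show ?thesis using clog_self[of X] by (simp add: P_def X_def min_absorb2)
qed

lemma dsem_power8:
  "dsem power8 s = s(''E'' := (s ''E'')(0 := 8 ^ s ''k'' 0), ''i'' := (s ''i'')(0 := 0))"
proof -
  define P where "P j a \<longleftrightarrow> j \<le> s ''k'' 0 \<and> a = s(''E'' := (s ''E'')(0 := 8 ^ (s ''k'' 0 - j)), ''i'' := (s ''i'')(0 := j))" for j and a :: store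
  have "P 0 (dsem power8 s)"
    unfolding power8_def dsem.simps(5)
  proof (rule dsem_PFor_inv[where P = P])
    fix j and a :: store
    assume P: "P (Suc j) a"
    then have "s ''k'' 0 - j = Suc (s ''k'' 0 - Suc j)" by (auto simp: P_def)
    with P show "P j (dsem (''E'' ::= Plus (var ''E'') (var ''E'') ;; ''E'' ::= Plus (var ''E'') (var ''E'') ;;
        ''E'' ::= Plus (var ''E'') (var ''E'')) (a(''i'' := (a ''i'')(0 := j))))"
      by (auto simp: P_def fun_eq_iff)
  qed (auto simp: P_def fun_eq_iff)
  then show ?thesis by (simp add: P_def)
qed

text \<open>Some phases compute the loop bounds of later ones, so the set-up as a whole modifies its
  own \<open>bounds\<close>; as a list it can be analysed phase by phase. \<open>B\<close> is
  computed by a loop over \<open>V\<close>, not over the variable holding \<open>16 * M\<close>,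
  which keeps the set-up time bounded uniformly in \<open>M\<close>.\<close>

definition setup_phases :: "nat \<Rightarrow> nat \<Rightarrow> nat \<Rightarrow> prog list" where
  "setup_phases C0 M \<rho> =
     [ceil_log ''c'' ''k'', ceil_log ''g'' ''n'', ''L'' ::= Plus (var ''g'') (Const 1), mult ''D'' ''k'' ''L'',
      ''H'' ::= Plus (var ''c'') (var ''D''), mult ''S'' ''n'' ''H'', mult ''G'' ''k'' ''g'', power8,
      ''u'' ::= Plus (var ''G'') (Const 4), ''t'' ::= Plus (var ''E'') (var ''E''), mult ''R'' ''u'' ''t'',
      ''u'' ::= Plus (Plus (var ''D'') (var ''D'')) (Const 1), mult ''T'' ''u'' ''E'', mult ''V'' ''R'' ''T'',
      ''M'' ::= Const (16 * M), mult ''B'' ''V'' ''M'',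
      ''u'' ::= Plus (Plus (var ''G'') (var ''k'')) (Const 1), ''t'' ::= Const C0, mult ''q'' ''u'' ''t'',
      ''r'' ::= Const \<rho>]"

primrec seq_of :: "prog list \<Rightarrow> prog" where
  "seq_of [] = PSkip"
| "seq_of (p # ps) = p ;; seq_of ps"

definition algorithm :: "nat \<Rightarrow> nat \<Rightarrow> nat \<Rightarrow> prog" where
  "algorithm C0 M \<rho> = seq_of (setup_phases C0 M \<rho>) ;; count_loop M ;; emit M"

definition rounds :: "nat \<Rightarrow> nat \<Rightarrow> nat" where
  "rounds n k = (k * clog n + 4) * (2 * 8 ^ k)"

definition steps :: "nat \<Rightarrow> nat \<Rightarrow> nat" where
  "steps n k = rounds n k * ((2 * (k * (clog n + 1)) + 1) * 8 ^ k)"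

definition votes :: "nat \<Rightarrow> nat \<Rightarrow> nat \<Rightarrow> nat" where
  "votes C0 n k = C0 * (k * clog n + k + 1)"

definition init_mem :: "nat \<Rightarrow> nat \<Rightarrow> store" where
  "init_mem n k = (\<lambda>_ _. 0)(''n'' := array [n], ''k'' := array [k])"

lemma setup_values:
  fixes n k C0 M \<rho> :: nat
  defines "s \<equiv> dsem (seq_of (setup_phases C0 M \<rho>)) (init_mem n k)"
  shows "s ''n'' 0 = n" "s ''k'' 0 = k" "s ''c'' 0 = clog k" "s ''D'' 0 = k * (clog n + 1)"
    "s ''S'' 0 = n * (clog k + k * (clog n + 1))" "s ''q'' 0 = votes C0 n k"
    "s ''R'' 0 = rounds n k" "s ''B'' 0 = steps n k * (16 * M)" "s ''r'' 0 = \<rho>"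
    "s ''Seen'' = (\<lambda>_. 0)" "s ''Hist'' = (\<lambda>_. 0)" "s ''more'' = (\<lambda>_. 0)"
  unfolding s_def setup_phases_def
  by (simp_all add: dsem_mult dsem_ceil_log dsem_power8 init_mem_def array_def votes_def rounds_def steps_def)
    (simp add: algebra_simps)

lemma wf_setup: "p \<in> set (setup_phases C0 M \<rho>) \<Longrightarrow>
    wf_prog p \<and> determ p \<and> bounds p \<inter> mods p = {} \<and> ''n'' \<notin> mods p"
  by (auto simp: setup_phases_def mult_def ceil_log_def power8_def)

lemma wf_seq_of: "(\<And>p. p \<in> set ps \<Longrightarrow> wf_prog p) \<Longrightarrow> wf_prog (seq_of ps)"
  by (induction ps) auto

lemma determ_seq_of: "(\<And>p. p \<in> set ps \<Longrightarrow> determ p) \<Longrightarrow> determ (seq_of ps)"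
  by (induction ps) auto


section \<open>Running times\<close>

text \<open>The class 2 ^ O(k) * n ^ O(1), uniformly in a parameter \<open>p\<close>, later the pair
  of \<open>M\<close> and \<rho>. The constant \<open>a\<close> is shared by both exponents, and
  from n = 2 on the class is closed under sums and products.\<close>

definition tame :: "('p \<Rightarrow> nat \<Rightarrow> nat \<Rightarrow> nat) \<Rightarrow> bool" where
  "tame f \<longleftrightarrow> (\<exists>a. \<forall>p n k. 2 \<le> n \<longrightarrow> f p n k \<le> 2 ^ (a * (k + 1)) * n ^ a)"

lemma tame_mono: "tame f \<Longrightarrow> (\<And>p n k. 2 \<le> n \<Longrightarrow> g p n k \<le> f p n k) \<Longrightarrow> tame g"
  unfolding tame_def by (meson le_trans)

lemma tame_mult:
  assumes "tame f" "tame g"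
  shows "tame (\<lambda>p n k. f p n k * g p n k)"
proof -
  obtain a b where a: "\<And>p n k. 2 \<le> n \<Longrightarrow> f p n k \<le> 2 ^ (a * (k + 1)) * n ^ a"
    and b: "\<And>p n k. 2 \<le> n \<Longrightarrow> g p n k \<le> 2 ^ (b * (k + 1)) * n ^ b"
    using assms unfolding tame_def by blast
  have "f p n k * g p n k \<le> 2 ^ ((a + b) * (k + 1)) * n ^ (a + b)" if "2 \<le> n" for p n k
  proof -
    have "f p n k * g p n k \<le> (2 ^ (a * (k + 1)) * n ^ a) * (2 ^ (b * (k + 1)) * n ^ b)"
      using a[OF that] b[OF that] by (rule mult_mono) auto
    also have "\<dots> = 2 ^ (a * (k + 1) + b * (k + 1)) * n ^ (a + b)"
      by (simp only: power_add mult_ac)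
    finally show ?thesis by (simp only: distrib_right)
  qed
  then show ?thesis unfolding tame_def by blast
qed

lemma tame_const: "tame (\<lambda>p n k. c)"
proof -
  have "c \<le> 2 ^ (c * (k + 1)) * n ^ c" if "2 \<le> n" for n k :: nat
  proof -
    have "c \<le> 2 ^ c" by (simp add: less_imp_le)
    also have "(2::nat) ^ c \<le> 2 ^ (c * (k + 1))" by (intro power_increasing) auto
    also have "\<dots> \<le> 2 ^ (c * (k + 1)) * n ^ c" using that by simp
    finally show ?thesis .
  qed
  then show ?thesis unfolding tame_def by blast
qed

lemma tame_n: "tame (\<lambda>p n k. n)"
  unfolding tame_def by (rule exI[of _ 1]) (auto simp: Suc_le_eq)

lemma tame_k: "tame (\<lambda>p n k. k)"
  unfolding tame_def
proof (intro exI[of _ 1] allI impI)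
  fix n k :: nat assume "2 \<le> n"
  have "k \<le> 2 ^ (k + 1)" by (rule order.trans[OF less_imp_le[OF less_exp]]) simp
  then have "k * 1 \<le> 2 ^ (k + 1) * n"
    using \<open>2 \<le> n\<close> by (intro mult_mono) auto
  then show "k \<le> 2 ^ (1 * (k + 1)) * n ^ 1" by simp
qed

lemma tame_add:
  assumes "tame f" "tame g"
  shows "tame (\<lambda>p n k. f p n k + g p n k)"
proof (rule tame_mono)
  have suc: "tame (\<lambda>p n k. h p n k + 1)" if "tame h" for h :: "'a \<Rightarrow> nat \<Rightarrow> nat \<Rightarrow> nat"
  proof -
    obtain a where a: "\<And>p n k. 2 \<le> n \<Longrightarrow> h p n k \<le> 2 ^ (a * (k + 1)) * n ^ a"
      using \<open>tame h\<close> unfolding tame_def by blast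
    have "h p n k + 1 \<le> 2 ^ (Suc a * (k + 1)) * n ^ Suc a" if "2 \<le> n" for p n k
    proof -
      have "1 \<le> 2 ^ (a * (k + 1)) * n ^ a" using that by (simp add: Suc_le_eq)
      then have "h p n k + 1 \<le> 2 * (2 ^ (a * (k + 1)) * n ^ a)" using a[OF that, of p k] by linarith
      also have "\<dots> \<le> 2 ^ (k + 1) * n * (2 ^ (a * (k + 1)) * n ^ a)"
      proof (intro mult_right_mono)
        have "2 * 1 \<le> 2 ^ (k + 1) * n" using that by (intro mult_mono) auto
        then show "2 \<le> 2 ^ (k + 1) * n" by simp
      qed simp
      also have "\<dots> = 2 ^ ((k + 1) + a * (k + 1)) * n ^ Suc a"
        by (simp only: power_add power_Suc mult_ac)
      finally show ?thesis by (simp add: add_ac)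
    qed
    then show ?thesis unfolding tame_def by blast
  qed
  \<comment> \<open>Reduces sums to products and to adding 1.\<close>
  show "f p n k + g p n k \<le> (f p n k + 1) * (g p n k + 1)" for p n k by simp
  show "tame (\<lambda>p n k. (f p n k + 1) * (g p n k + 1))"
    by (intro tame_mult suc assms)
qed

lemma tame_clog_n: "tame (\<lambda>p n k. clog n)"
  by (rule tame_mono[OF tame_n]) (rule clog_self)

lemma tame_clog_k: "tame (\<lambda>p n k. clog k)"
  by (rule tame_mono[OF tame_k]) (rule clog_self)

lemma tame_8: "tame (\<lambda>p n k. 8 ^ k)"
  unfolding tame_def
proof (intro exI[of _ 3] allI impI)
  fix n k :: nat assume "2 \<le> n"
  have "8 ^ k = (2::nat) ^ (3 * k)" by (simp add: power_mult)
  also have "\<dots> \<le> 2 ^ (3 * (k + 1))" by (intro power_increasing) auto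
  also have "\<dots> \<le> 2 ^ (3 * (k + 1)) * n ^ 3" using \<open>2 \<le> n\<close> by simp
  finally show "8 ^ k \<le> 2 ^ (3 * (k + 1)) * n ^ 3" .
qed

lemma tame_Suc: "tame f \<Longrightarrow> tame (\<lambda>p n k. Suc (f p n k))"
  using tame_add[OF _ tame_const[of 1]] by fastforce

lemmas tame_intros = tame_const tame_n tame_k tame_clog_n tame_clog_k tame_8 tame_Suc tame_add tame_mult

lemma tame_time_bound:
  assumes "\<And>x. x \<in> insert ''n'' (bounds P) \<Longrightarrow> tame (\<lambda>p n k. v p n k x)"
  shows "tame (\<lambda>p n k. time_bound 1 (v p n k) P)"
  using assms by (induction P) (auto intro!: tame_intros simp del: add_Suc add_2_eq_Suc add_2_eq_Suc')

text \<open>Isolates the cost of an answer as a factor, so that the remaining bound is independent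
  of the decision algorithm.\<close>

lemma time_bound_le: "1 \<le> \<tau> \<Longrightarrow> time_bound \<tau> v p \<le> time_bound 1 v p * \<tau>"
proof (induction p)
  case (PFor i x p)
  have "7 + v x * (9 + time_bound \<tau> v p) \<le> 7 * \<tau> + v x * (9 * \<tau> + time_bound 1 v p * \<tau>)"
    using PFor by (intro add_mono mult_left_mono) auto
  then show ?case by (simp add: algebra_simps)
next
  case (PQuery r x)
  have "3 * 1 + v ''n'' * 1 + \<tau> \<le> 3 * \<tau> + v ''n'' * \<tau> + \<tau>"
    using PQuery by (intro add_mono mult_left_mono) auto
  then show ?case by (simp add: algebra_simps)
next
  case (PIf e p p')
  have "(1 + cost e) * 1 \<le> (1 + cost e) * \<tau>" using PIf.prems by (intro mult_left_mono) auto
  then show ?case using PIf by (simp add: algebra_simps)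
next
  case (PAssign x a e)
  have "(1 + cost a + cost e) * 1 \<le> (1 + cost a + cost e) * \<tau>" using PAssign.prems by (intro mult_left_mono) auto
  then show ?case by simp
qed (auto simp: algebra_simps)

lemma time_bound_determ: "determ p \<Longrightarrow> time_bound \<tau> v p = time_bound 1 v p"
  by (induction p) auto

lemma call_bound_determ: "determ p \<Longrightarrow> call_bound v p = 0"
  by (induction p) auto

text \<open>The bounds of each phase are evaluated in the store left by the earlier phases.\<close>

primrec seq_time :: "prog list \<Rightarrow> store \<Rightarrow> nat" where
  "seq_time [] m = 1"
| "seq_time (p # ps) m = time_bound 1 (\<lambda>x. m x 0) p + seq_time ps (dsem p m)"

lemma runs_within_seq_of:
  assumes "\<And>p. p \<in> set ps \<Longrightarrow> wf_prog p \<and> determ p \<and> bounds p \<inter> mods p = {} \<and> ''n'' \<notin> mods p"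
    and or: "\<And>i X. X \<subseteq> {..<mem s ''n'' 0} \<Longrightarrow>
       lossless_spmf (Or i X) \<and> (\<forall>(b, t) \<in> set_spmf (Or i X). t \<le> \<tau>)"
  shows "runs_within Or (seq_of ps) s (seq_time ps (mem s)) 0"
  using assms
proof (induction ps arbitrary: s)
  case Nil
  then show ?case by (simp add: runs_within_def)
next
  case (Cons p ps)
  have p: "wf_prog p" "determ p" "bounds p \<inter> mods p = {}" "''n'' \<notin> mods p"
    using Cons.prems(1)[of p] by auto
  have "runs_within Or p s (time_bound \<tau> (\<lambda>x. mem s x 0) p) (call_bound (\<lambda>x. mem s x 0) p)"
    by (rule runs_within_bounds) (use p Cons.prems(2) in auto)
  then have 1: "runs_within Or p s (time_bound 1 (\<lambda>x. mem s x 0) p) 0"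
    using p(2) by (simp add: time_bound_determ[of p \<tau>] call_bound_determ)
  have 2: "runs_within Or (seq_of ps) s' (seq_time ps (dsem p (mem s))) 0"
    if s': "s' \<in> set_spmf (exec Or (com_of p) s)" for s'
  proof -
    have m: "mem s' = dsem p (mem s)" by (rule exec_det[OF p(1,2) s'])
    have "mem s' ''n'' = mem s ''n''" by (rule exec_frame[OF p(1) s' p(4)])
    then have "runs_within Or (seq_of ps) s' (seq_time ps (mem s')) 0"
      using Cons.prems by (intro Cons.IH) auto
    then show ?thesis by (simp add: m)
  qed
  show ?case using runs_within_Seq[OF 1 2] by simp
qed

lemma time_bound_mult: "time_bound \<tau> v (mult z x y) = 10 + v x * 16"
  by (simp add: mult_def)

lemma time_bound_ceil_log: "time_bound \<tau> v (ceil_log z x) = 13 + v x * 29"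
  by (simp add: ceil_log_def)

lemma time_bound_power8: "time_bound \<tau> v power8 = 10 + v ''k'' * 30"
  by (simp add: power8_def)

lemma tame_setup: "tame (\<lambda>p n k. seq_time (setup_phases C0 (fst p) (snd p)) (init_mem n k))"
    unfolding setup_phases_def
    by (simp add: dsem_mult dsem_ceil_log dsem_power8 init_mem_def array_def time_bound_mult
        time_bound_ceil_log time_bound_power8) (intro tame_intros)

lemma tame_main:
  "tame (\<lambda>p n k. time_bound 1 (\<lambda>x. dsem (seq_of (setup_phases C0 (fst p) (snd p))) (init_mem n k) x 0) (begin_round ;; visit_node))"
proof (rule tame_time_bound)
    fix x assume "x \<in> insert ''n'' (bounds (begin_round ;; visit_node))"
    then have "x \<in> {''n'', ''S'', ''c'', ''D'', ''q''}"
      by (auto simp: begin_round_def visit_node_def sample_def compute_X_def read_colour_def check_cells_def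
          majority_def advance_def record_leaf_def backtrack_def)
    then show "tame (\<lambda>p n k. dsem (seq_of (setup_phases C0 (fst p) (snd p))) (init_mem n k) x 0)"
      by (auto simp: setup_values votes_def intro!: tame_intros simp del: add_Suc_right mult_Suc_right)
qed

text \<open>Every terminating run takes time, which forces the bound g(k) * n ^ a to be positive;
  otherwise it could not absorb the counting algorithm's own work. As \<open>exec\<close> is a least
  fixed point, the proof is by fixed point induction.\<close>

lemma exec_elapsed:
  assumes "s' \<in> set_spmf (exec Or p s)"
  shows "elapsed s < elapsed s'"
proof -
  have "\<forall>Or p s s'. s' \<in> set_spmf (exec Or p s) \<longrightarrow> elapsed s < elapsed s'"
  proof (rule exec.fixp_induct[where P = "\<lambda>ex. \<forall>Or p s s'. s' \<in> set_spmf (ex Or p s) \<longrightarrow> elapsed s < elapsed s'"], goal_cases)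
    case 1
    show ?case
    proof (rule ccpo.admissibleI)
      fix A :: "(((nat \<Rightarrow> nat set \<Rightarrow> (bool \<times> nat) spmf) \<times> com) \<times> state \<Rightarrow> state spmf) set"
      assume chain: "Complete_Partial_Order.chain (fun_ord (ord_spmf (=))) A"
        and *: "\<forall>x\<in>A. \<forall>Or p s s'. s' \<in> set_spmf (curry (curry x) Or p s) \<longrightarrow> elapsed s < elapsed s'"
      show "\<forall>Or p s s'. s' \<in> set_spmf (curry (curry (fun_lub lub_spmf A)) Or p s) \<longrightarrow> elapsed s < elapsed s'"
        using * by (auto simp: fun_lub_def set_lub_spmf[OF chain_fun[OF chain]])
    qed
  next
    case 2
    show ?case by simp
  next
    case (3 ex)
    then have IH: "s' \<in> set_spmf (ex Or p s) \<Longrightarrow> elapsed s < elapsed s'" for Or p s s' by blast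
    show ?case
    proof (intro allI impI, goal_cases)
      case (1 Or p s s')
      show ?case
      proof (cases p)
        case (Seq p1 p2)
        with 1 obtain s1 where s1: "s1 \<in> set_spmf (ex Or p1 s)" "s' \<in> set_spmf (ex Or p2 s1)"
          by (auto simp: set_bind_spmf o_def bind_UNION)
        show ?thesis using IH[OF s1(1)] IH[OF s1(2)] by simp
      next
        case (Cond e p1 p2)
        then show ?thesis
          using 1 IH[of s' Or p1 "tick (1 + cost e) s"] IH[of s' Or p2 "tick (1 + cost e) s"]
          by (simp split: if_splits)
      next
        case (While e p1)
        show ?thesis
        proof (cases "val e (mem s) = 0")
          case False
          with 1 While obtain s1 where s1: "s1 \<in> set_spmf (ex Or p1 (tick (1 + cost e) s))"
            "s' \<in> set_spmf (ex Or (While e p1) s1)"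
            by (auto simp: set_bind_spmf o_def bind_UNION)
          show ?thesis using IH[OF s1(1)] IH[OF s1(2)] by simp
        qed (use 1 While in simp)
      qed (use 1 in \<open>auto simp: set_bind_spmf o_def bind_UNION\<close>)
    qed
  qed
  with assms show ?thesis by blast
qed

section \<open>Number of repetitions and of oracle calls\<close>

definition repetitions :: "real \<Rightarrow> nat" where
  "repetitions \<delta> = nat \<lceil>5 * log 2 (1 / \<delta>)\<rceil>"

text \<open>The constant 5 works because (sqrt 3 / 2) ^ 5 = 9 sqrt 3 / 32 is below 1 / 2; rounding
  up costs at most one more logarithm, which is at least 1.\<close>

lemma repetitions:
  assumes "0 < \<delta>" "\<delta> \<le> 1 / 2"
  shows "1 \<le> log 2 (1 / \<delta>)" "real (repetitions \<delta>) \<le> 6 * log 2 (1 / \<delta>)" "1 \<le> repetitions \<delta>"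
    "(sqrt 3 / 2) ^ repetitions \<delta> \<le> \<delta>"
proof -
  define l where "l = log 2 (1 / \<delta>)"
  have "2 \<le> 1 / \<delta>" using assms by (simp add: field_simps)
  then have "log 2 2 \<le> l" unfolding l_def using assms by (intro log_mono) auto
  then show l: "1 \<le> log 2 (1 / \<delta>)" by (simp add: l_def)
  show "real (repetitions \<delta>) \<le> 6 * log 2 (1 / \<delta>)" "1 \<le> repetitions \<delta>"
    using l unfolding repetitions_def by linarith+
  have ge: "5 * l \<le> real (repetitions \<delta>)"
    unfolding repetitions_def l_def by linarith
  have lt: "sqrt 3 < 2" by (rule real_less_lsqrt) auto
  have "(sqrt 3 / 2) ^ 5 = 9 * sqrt 3 / 32"
    by (simp add: power_divide eval_nat_numeral)
  also have "\<dots> \<le> 1 / 2"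
  proof -
    have "sqrt 3 \<le> 16 / 9" by (rule real_le_lsqrt) (auto simp: power2_eq_square)
    then show ?thesis by simp
  qed
  finally have five: "(sqrt 3 / 2) ^ 5 \<le> 1 / 2" .
  have "(sqrt 3 / 2) ^ repetitions \<delta> = (sqrt 3 / 2) powr real (repetitions \<delta>)"
    by (simp add: powr_realpow)
  also have "\<dots> \<le> (sqrt 3 / 2) powr (5 * l)"
    using ge lt by (intro powr_mono') auto
  also have "\<dots> = ((sqrt 3 / 2) ^ 5) powr l"
    by (simp add: powr_powr[symmetric] powr_numeral)
  also have "\<dots> \<le> (1 / 2) powr l"
    using five l by (intro powr_mono2) (auto simp: l_def)
  also have "\<dots> = \<delta>"
    using assms by (simp add: l_def powr_divide)
  finally show "(sqrt 3 / 2) ^ repetitions \<delta> \<le> \<delta>" .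
qed

lemma clog_le_log:
  assumes "2 \<le> n" shows "real (clog n) \<le> 2 * log 2 (real n)"
proof -
  have "2 ^ clog n \<le> 2 * n" using assms by (intro clog_upper) simp
  then have "real (2 ^ clog n) \<le> real (2 * n)" by (rule of_nat_mono)
  then have "log 2 (2 ^ clog n) \<le> log 2 (2 * real n)"
    using assms by (subst log_le_cancel_iff) auto
  also have "\<dots> = 1 + log 2 (real n)" using assms by (subst log_mult) auto
  also have "1 \<le> log 2 (real n)"
    using log_mono[of 2 2 "real n"] assms by simp
  finally show ?thesis by (simp add: log_nat_power)
qed

text \<open>The rounds, the depth and the votes are each linear in \<open>k\<close> times log n,
  which gives the third power of log n; the factors linear in \<open>k\<close> go into 2 ^
  O(k).\<close>

lemma calls_le:
  assumes n: "2 \<le> n" and \<rho>: "real \<rho> \<le> 6 * l"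
  shows "real (\<rho> * (steps n k * (16 * M) * votes C0 n k)) \<le>
     2 powr (9 * real k + real (15 + C0)) * log 2 (real n) ^ 3 * real M * l"
proof -
  define g where "g = log 2 (real n)"
  define G where "G = real (clog n)"
  have g1: "1 \<le> g" using log_mono[of 2 2 "real n"] n by (simp add: g_def)
  have G: "0 \<le> G" "G \<le> 2 * g" using clog_le_log[OF n] by (auto simp: G_def g_def)
  have l0: "0 \<le> l" using \<rho> by linarith
  have kG: "real k * G \<le> real k * (2 * g)" using G by (intro mult_left_mono) auto
  have kg: "real k \<le> real k * g" using g1 by (simp add: mult_le_cancel_left1)
  have lin: "a + b * real k \<le> c * 2 ^ k" if "a \<le> c" "b \<le> c" "0 \<le> c" for a b c :: real
  proof -
    have "real (Suc k) \<le> 2 ^ k" by (induction k) auto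
    then have "c * real (Suc k) \<le> c * 2 ^ k" using that by (intro mult_left_mono) auto
    moreover have "a + b * real k \<le> c * real (Suc k)"
      using that mult_right_mono[of b c "real k"] by (simp add: algebra_simps)
    ultimately show ?thesis by linarith
  qed
  have R: "real (k * clog n + 4) \<le> (4 + 2 * real k) * g"
  proof -
    have "real (k * clog n + 4) = real k * G + 4" by (simp add: G_def)
    also have "\<dots> \<le> real k * (2 * g) + 4 * g" using kG g1 by linarith
    finally show ?thesis by (simp add: algebra_simps)
  qed
  have T: "real (2 * (k * (clog n + 1)) + 1) \<le> (1 + 6 * real k) * g"
  proof -
    have "real (2 * (k * (clog n + 1)) + 1) = 2 * (real k * G) + 2 * real k + 1"
      by (simp add: G_def algebra_simps)
    also have "\<dots> \<le> 2 * (real k * (2 * g)) + 2 * (real k * g) + g" using kG kg g1 by linarith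
    finally show ?thesis by (simp add: algebra_simps)
  qed
  have Q: "real (k * clog n + k + 1) \<le> (1 + 3 * real k) * g"
  proof -
    have "real (k * clog n + k + 1) = real k * G + real k + 1" by (simp add: G_def)
    also have "\<dots> \<le> real k * (2 * g) + real k * g + g" using kG kg g1 by linarith
    finally show ?thesis by (simp add: algebra_simps)
  qed
  have le: "(a + b * real k) * g \<le> (c * 2 ^ k) * g" if "a \<le> c" "b \<le> c" "0 \<le> c" for a b c
    using lin[OF that] g1 by (intro mult_right_mono) auto
  have C0: "real C0 \<le> 2 ^ C0" using of_nat_mono[OF less_imp_le[OF less_exp[of C0]], where 'a = real] by simp
  have "real (\<rho> * (steps n k * (16 * M) * votes C0 n k)) =
      2 * 16 * real \<rho> * 8 ^ k * 8 ^ k * real M * real C0 * (real (k * clog n + 4) * (real (2 * (k * (clog n + 1)) + 1) * real (k * clog n + k + 1)))"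
    by (simp only: steps_def rounds_def votes_def of_nat_mult of_nat_power of_nat_numeral mult_ac)
  also have "\<dots> \<le> 2 * 16 * (6 * l) * 8 ^ k * 8 ^ k * real M * 2 ^ C0 * ((4 * 2 ^ k * g) * ((6 * 2 ^ k * g) * (3 * 2 ^ k * g)))"
    using \<rho> C0 l0 g1 order.trans[OF R le[of 4 4 2, simplified]] order.trans[OF T le[of 1 6 6, simplified]] order.trans[OF Q le[of 1 3 3, simplified]]
    by (intro mult_mono mult_nonneg_nonneg) auto
  \<comment> \<open>13824 = 2 * 16 * 6 * 4 * 6 * 3, which is below 2 ^ 15.\<close>
  also have "\<dots> = 13824 * (8 ^ k * 8 ^ k * 2 ^ k * 2 ^ k * 2 ^ k) * 2 ^ C0 * g ^ 3 * real M * l"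
    by (simp add: power3_eq_cube)
  also have "(8::real) ^ k * 8 ^ k * 2 ^ k * 2 ^ k * 2 ^ k = 2 ^ (9 * k)"
    by (simp add: power_mult power_mult_distrib[symmetric])
  also have "13824 * 2 ^ (9 * k) * 2 ^ C0 * g ^ 3 * real M * l \<le> 2 ^ 15 * 2 ^ (9 * k) * 2 ^ C0 * g ^ 3 * real M * l"
    using g1 l0 by (intro mult_right_mono) auto
  also have "2 ^ 15 * 2 ^ (9 * k) * (2::real) ^ C0 = 2 powr (9 * real k + real (15 + C0))"
  proof -
    have "2 powr (9 * real k + real (15 + C0)) = 2 powr real (15 + 9 * k + C0)" by (simp add: add_ac)
    also have "\<dots> = 2 ^ (15 + 9 * k + C0)" by (rule powr_realpow) simp
    finally show ?thesis by (simp only: power_add)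
  qed
  finally show ?thesis by (simp add: g_def)
qed

lemma good_result_emit:
  assumes "m ''final'' 0 = min N (Suc M)" "m ''more'' 0 = 0" "0 < \<epsilon>" "mem s = dsem (emit M) m"
  shows "good_result \<epsilon> M N (result s)"
proof -
  have "(1 - \<epsilon>) * real N \<le> real N" using assms(3) by (simp add: mult_left_le_one_le algebra_simps)
  then show ?thesis
    using assms(1,2) by (auto simp: good_result_def result_def emit_def assms(4) min_def)
qed

lemma runs_within_algorithm:
  fixes n k C0 M \<rho> :: nat
  assumes or: "\<And>i X. X \<subseteq> {..<n} \<Longrightarrow>
       lossless_spmf (Or i X) \<and> (\<forall>(b, t) \<in> set_spmf (Or i X). t \<le> \<tau>)"
  defines "v \<equiv> \<lambda>x. dsem (seq_of (setup_phases C0 M \<rho>)) (init_mem n k) x 0"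
  shows "runs_within Or (algorithm C0 M \<rho>) (start (init_mem n k))
     (seq_time (setup_phases C0 M \<rho>) (init_mem n k) + time_bound \<tau> v (count_loop M ;; emit M))
     (\<rho> * (steps n k * (16 * M) * votes C0 n k))"
proof -
  let ?s = "start (init_mem n k)" and ?ps = "setup_phases C0 M \<rho>"
  have mem: "mem ?s = init_mem n k" by (simp add: start_def)
  have n0: "mem ?s ''n'' 0 = n" unfolding mem by (simp add: init_mem_def array_def)
  have "runs_within Or (seq_of ?ps) ?s (seq_time ?ps (mem ?s)) 0"
  proof (rule runs_within_seq_of)
    show "wf_prog p \<and> determ p \<and> bounds p \<inter> mods p = {} \<and> ''n'' \<notin> mods p" if "p \<in> set ?ps" for p
      using that by (rule wf_setup)
    show "lossless_spmf (Or i X) \<and> (\<forall>(b, t) \<in> set_spmf (Or i X). t \<le> \<tau>)" if "X \<subseteq> {..<mem ?s ''n'' 0}" for i X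
      using that unfolding n0 by (rule or)
  qed
  then have 1: "runs_within Or (seq_of ?ps) ?s (seq_time ?ps (init_mem n k)) 0"
    by (simp only: mem)
  have vn: "v ''n'' = n" by (simp add: v_def setup_values)
  have 2: "runs_within Or (count_loop M ;; emit M) s' (time_bound \<tau> v (count_loop M ;; emit M))
      (\<rho> * (steps n k * (16 * M) * votes C0 n k))"
    if s': "s' \<in> set_spmf (exec Or (com_of (seq_of ?ps)) ?s)" for s'
  proof -
    have m: "mem s' = dsem (seq_of ?ps) (init_mem n k)"
      using exec_det[OF wf_seq_of determ_seq_of s'] wf_setup[of _ C0 M \<rho>] mem by auto
    have "runs_within Or (count_loop M ;; emit M) s' (time_bound \<tau> v (count_loop M ;; emit M))
        (call_bound v (count_loop M ;; emit M))"
    proof (rule runs_within_bounds)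
      show "bounds (count_loop M ;; emit M) \<inter> mods (count_loop M ;; emit M) = {}"
        by (auto simp: prog_defs)
    qed (use or vn in \<open>auto simp: m v_def\<close>)
    moreover have "call_bound v (count_loop M ;; emit M) = \<rho> * (steps n k * (16 * M) * votes C0 n k)"
      by (simp add: prog_defs v_def setup_values)
    ultimately show ?thesis by simp
  qed
  show ?thesis unfolding algorithm_def using runs_within_Seq[OF 1 2] by simp
qed

lemma time_main_le:
  assumes "1 \<le> M" "1 \<le> \<rho>" "v ''r'' = \<rho>" "v ''B'' = K * (16 * M)"
  shows "time_bound 1 v (count_loop M ;; emit M) \<le> (300 + 16 * (K * (9 + time_bound 1 v (begin_round ;; visit_node)))) * (M * \<rho>)"
proof -
  define I where "I = time_bound 1 v (begin_round ;; visit_node)"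
  have "time_bound 1 v (count_loop M ;; emit M) \<le> 100 + \<rho> * (200 + K * (16 * M) * (9 + I))"
    by (simp add: count_loop_def count_once_def tally_def emit_def assms(3,4) I_def)
      (rule trans_le_add2, rule mult_left_mono; simp)
  also have "\<dots> \<le> 100 * (M * \<rho>) + \<rho> * (200 * M + K * (16 * M) * (9 + I))"
    using assms(1,2) by (intro add_mono mult_left_mono) auto
  also have "\<dots> = (300 + 16 * (K * (9 + I))) * (M * \<rho>)" by (simp add: algebra_simps)
  finally show ?thesis by (simp add: I_def)
qed

lemma tame_total:
  obtains A where "\<And>n k M \<rho> \<tau>. 2 \<le> n \<Longrightarrow> 1 \<le> M \<Longrightarrow> 1 \<le> \<rho> \<Longrightarrow> 1 \<le> \<tau> \<Longrightarrow>
    seq_time (setup_phases C0 M \<rho>) (init_mem n k) +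
      time_bound \<tau> (\<lambda>x. dsem (seq_of (setup_phases C0 M \<rho>)) (init_mem n k) x 0) (count_loop M ;; emit M)
    \<le> 2 ^ (A * (k + 1)) * n ^ A * (M * \<rho> * \<tau>)"
proof -
  define v where "v p n k x = dsem (seq_of (setup_phases C0 (fst p) (snd p))) (init_mem n k) x 0"
    for p :: "nat \<times> nat" and n k x
  define F where "F p n k = seq_time (setup_phases C0 (fst p) (snd p)) (init_mem n k)" for p :: "nat \<times> nat" and n k
  define I where "I p n k = time_bound 1 (v p n k) (begin_round ;; visit_node)" for p :: "nat \<times> nat" and n k
  have "tame (\<lambda>p n k. F p n k + (300 + 16 * (steps n k * (9 + I p n k))))"
  proof (intro tame_intros)
    show "tame F" unfolding F_def by (rule tame_setup)
    show "tame I" unfolding I_def v_def by (rule tame_main)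
    show "tame (\<lambda>p n k. steps n k)" unfolding steps_def rounds_def by (intro tame_intros)
  qed
  then obtain A where A: "\<And>p n k. 2 \<le> n \<Longrightarrow> F p n k + (300 + 16 * (steps n k * (9 + I p n k))) \<le> 2 ^ (A * (k + 1)) * n ^ A"
    unfolding tame_def by blast
  show thesis
  proof (rule that)
    fix n k M \<rho> \<tau> :: nat assume *: "2 \<le> n" "1 \<le> M" "1 \<le> \<rho>" "1 \<le> \<tau>"
    let ?p = "(M, \<rho>)"
    have MR: "1 \<le> M * \<rho> * \<tau>" using * by simp
    have "time_bound \<tau> (v ?p n k) (count_loop M ;; emit M) \<le> time_bound 1 (v ?p n k) (count_loop M ;; emit M) * \<tau>"
      using *(4) by (rule time_bound_le)
    also have "\<dots> \<le> (300 + 16 * (steps n k * (9 + I ?p n k))) * (M * \<rho>) * \<tau>"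
      unfolding I_def by (intro mult_right_mono time_main_le) (use * in \<open>auto simp: v_def setup_values\<close>)
    finally have T: "time_bound \<tau> (v ?p n k) (count_loop M ;; emit M) \<le>
        (300 + 16 * (steps n k * (9 + I ?p n k))) * (M * \<rho> * \<tau>)"
      by (simp only: mult.assoc)
    have "F ?p n k * 1 \<le> F ?p n k * (M * \<rho> * \<tau>)"
      using MR by (rule mult_left_mono) simp
    then have "F ?p n k + time_bound \<tau> (v ?p n k) (count_loop M ;; emit M) \<le>
        F ?p n k * (M * \<rho> * \<tau>) + (300 + 16 * (steps n k * (9 + I ?p n k))) * (M * \<rho> * \<tau>)"
      using T by (intro add_mono) (simp_all only: mult_1_right)
    also have "\<dots> = (F ?p n k + (300 + 16 * (steps n k * (9 + I ?p n k)))) * (M * \<rho> * \<tau>)"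
      by (simp only: distrib_right)
    also have "\<dots> \<le> 2 ^ (A * (k + 1)) * n ^ A * (M * \<rho> * \<tau>)"
      using A[OF *(1)] by (rule mult_right_mono) simp
    finally have total: "F ?p n k + time_bound \<tau> (v ?p n k) (count_loop M ;; emit M)
      \<le> 2 ^ (A * (k + 1)) * n ^ A * (M * \<rho> * \<tau>)" .
    show "seq_time (setup_phases C0 M \<rho>) (init_mem n k) +
      time_bound \<tau> (\<lambda>x. dsem (seq_of (setup_phases C0 M \<rho>)) (init_mem n k) x 0) (count_loop M ;; emit M)
      \<le> 2 ^ (A * (k + 1)) * n ^ A * (M * \<rho> * \<tau>)"
    proof -
      have "v ?p n k = (\<lambda>x. dsem (seq_of (setup_phases C0 M \<rho>)) (init_mem n k) x 0)"
        by (rule ext) (simp add: v_def)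
      with total show ?thesis by (simp only: F_def fst_conv snd_conv)
    qed
  qed
qed

section \<open>Assembling the algorithm and its guarantees\<close>

lemma counting_run_eq:
  "counting_run Or p I = exec Or p (start (init_mem (usize I) (param I)))"
  by (simp add: counting_run_def init_mem_def)

lemma ev_algorithm_le:
  fixes c :: real and n k C0 M :: nat and \<W> :: "nat set set"
  assumes \<W>: "\<And>W. W \<in> \<W> \<Longrightarrow> W \<subseteq> {..<n} \<and> card W = k"
    and c: "0 < c" "c < 1 / 2"
    and or: "\<And>i X. X \<subseteq> {..<n} \<Longrightarrow> measure (measure_spmf (Or i X)) {bt. fst bt \<noteq> (\<exists>W\<in>\<W>. W \<subseteq> X)} \<le> c"
    and C0: "(2 * sqrt (c * (1 - c))) ^ C0 \<le> (1 / 2) ^ 17" and M: "1 \<le> M"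
    and \<phi>: "\<And>m. m ''final'' 0 = min (card \<W>) (Suc M) \<Longrightarrow> m ''more'' 0 = 0 \<Longrightarrow> \<phi> (dsem (emit M) m) = 0"
      "\<And>m. \<phi> m \<le> 1"
  shows "ev Or (algorithm C0 M \<rho>) \<phi> (start (init_mem n k)) \<le> ennreal ((sqrt 3 / 2) ^ \<rho>)"
proof -
  define B where "B = steps n k * (16 * M)"
  let ?ini = "seq_of (setup_phases C0 M \<rho>)"
  interpret ws: witness_search n k "clog k" "clog n + 1" \<W>
  proof
    show "W \<subseteq> {..<n}" "card W = k" if "W \<in> \<W>" for W using \<W>[OF that] by auto
    show "k \<le> 2 ^ clog k" by (rule clog_ge)
    show "2 ^ (clog k * k) \<le> (2 * k) ^ k"
    proof (cases "k = 0")
      case False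
      then have "(2 ^ clog k) ^ k \<le> (2 * k) ^ k" by (intro power_mono clog_upper) auto
      then show ?thesis by (simp add: power_mult)
    qed simp
    show "2 * n \<le> 2 ^ (clog n + 1)" using clog_ge[of n] by simp
  qed
  interpret ns: noisy_search n k "clog k" "clog n + 1" \<W> Or c "votes C0 n k" "rounds n k" B M
  proof
    show "measure (measure_spmf (Or i X)) {bt. fst bt \<noteq> ws.alive X} \<le> c" if "X \<subseteq> {..<n}" for i X
      using or[OF that] by (simp add: ws.alive_def)
    show "0 < B" using M by (simp add: B_def steps_def rounds_def)
  qed (use c in auto)
  have pot: "ns.pot B (rounds n k) {} [] \<le> 1 / 4"
    by (rule ns.pot_le[where g = "clog n" and ?C0.0 = C0])
      (use M C0 clog_ge[of n] in \<open>simp_all add: B_def steps_def rounds_def votes_def\<close>)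
  show ?thesis
    unfolding algorithm_def
  proof (rule ev_det_PSeq_le)
    show "wf_prog ?ini" "determ ?ini"
      using wf_setup by (blast intro: wf_seq_of determ_seq_of)+
    fix s :: state
    assume "mem s = dsem ?ini (mem (start (init_mem n k)))"
    then have s: "mem s = dsem ?ini (init_mem n k)" by (simp add: start_def)
    note sv = setup_values[of C0 M \<rho> n k, folded s]
    have "ev Or (count_loop M ;; emit M) \<phi> s \<le> ev Or (count_loop M) (\<lambda>m. \<phi> (dsem (emit M) m)) s"
      by (rule ev_PSeq_det_le) auto
    also have "\<dots> \<le> ev Or (count_loop M) (\<lambda>m. of_bool (m ''final'' 0 \<noteq> min (card \<W>) (Suc M))) s"
    proof (rule ev_mono)
      fix m assume fr: "\<And>x. x \<notin> mods (count_loop M) \<Longrightarrow> m x = mem s x"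
      have "m ''more'' = mem s ''more''"
        by (rule fr) (simp add: count_loop_def mods_count_once mods_tally)
      then have "m ''more'' 0 = 0" by (simp add: sv)
      then show "\<phi> (dsem (emit M) m) \<le> of_bool (m ''final'' 0 \<noteq> min (card \<W>) (Suc M))"
        using \<phi>(1)[of m] \<phi>(2)[of "dsem (emit M) m"] by (cases "m ''final'' 0 = min (card \<W>) (Suc M)") auto
    qed simp
    also have "\<dots> \<le> ennreal ((sqrt 3 / 2) ^ \<rho>)"
    proof (rule ns.ev_count_loop_le[OF _ _ _ _ _ _ pot])
      show "ns.params (mem s)"
        unfolding ns.params_def ws.S_def using sv by simp
    qed (simp_all add: sv B_def)
    finally show "ev Or (count_loop M ;; emit M) \<phi> s \<le> ennreal ((sqrt 3 / 2) ^ \<rho>)" .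
  qed
qed

lemma good_result_prob:
  fixes c :: real and n k C0 M :: nat and \<W> :: "nat set set"
  assumes \<W>: "\<And>W. W \<in> \<W> \<Longrightarrow> W \<subseteq> {..<n} \<and> card W = k"
    and c: "0 < c" "c < 1 / 2"
    and or: "\<And>i X. X \<subseteq> {..<n} \<Longrightarrow> measure (measure_spmf (Or i X)) {bt. fst bt \<noteq> (\<exists>W\<in>\<W>. W \<subseteq> X)} \<le> c"
    and C0: "(2 * sqrt (c * (1 - c))) ^ C0 \<le> (1 / 2) ^ 17" and M: "1 \<le> M"
    and \<epsilon>: "0 < \<epsilon>" and \<delta>: "0 < \<delta>" "\<delta> \<le> 1 / 2"
    and lossless: "lossless_spmf (exec Or (com_of (algorithm C0 M (repetitions \<delta>))) (start (init_mem n k)))"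
  shows "1 - \<delta> \<le> measure (measure_spmf (exec Or (com_of (algorithm C0 M (repetitions \<delta>))) (start (init_mem n k))))
     {s. good_result \<epsilon> M (card \<W>) (result s)}"
proof -
  let ?p = "algorithm C0 M (repetitions \<delta>)" and ?s = "start (init_mem n k)"
  let ?D = "measure_spmf (exec Or (com_of ?p) ?s)"
  let ?good = "{s. good_result \<epsilon> M (card \<W>) (result s)}"
  \<comment> \<open>\<open>result\<close> restated on stores, since \<open>ev\<close> takes
    functions of the memory.\<close>
  define res where "res m = (if m ''more'' 0 \<noteq> 0 then More_than_M else Number (m ''out'' 0))" for m :: store
  have res: "result s = res (mem s)" for s by (simp add: result_def res_def)
  define \<phi> where "\<phi> m = (of_bool (\<not> good_result \<epsilon> M (card \<W>) (res m)) :: ennreal)" for m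
  have "emeasure ?D (- ?good) = (\<integral>\<^sup>+ s. indicator (- ?good) s \<partial>?D)" by simp
  also have "\<dots> = ev Or ?p \<phi> ?s"
    unfolding ev_def by (intro nn_integral_cong) (simp add: \<phi>_def res indicator_def)
  also have "\<dots> \<le> ennreal ((sqrt 3 / 2) ^ repetitions \<delta>)"
  proof (rule ev_algorithm_le[OF \<W> c or C0 M])
    fix m :: store assume m: "m ''final'' 0 = min (card \<W>) (Suc M)" "m ''more'' 0 = 0"
    have "mem (start (dsem (emit M) m)) = dsem (emit M) m" by (simp add: start_def)
    from good_result_emit[OF m \<epsilon> this] show "\<phi> (dsem (emit M) m) = 0"
      by (simp add: \<phi>_def res start_def)
  qed (auto simp: \<phi>_def)
  also have "\<dots> \<le> ennreal \<delta>" using repetitions(4)[OF \<delta>] by (rule ennreal_leI)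
  finally have bad: "measure ?D (- ?good) \<le> \<delta>"
    using \<delta> by (simp add: measure_spmf.emeasure_eq_measure)
  have "measure ?D UNIV = 1"
    using lossless by (simp add: lossless_spmf_def weight_spmf_def space_measure_spmf)
  moreover have "measure ?D (?good \<union> - ?good) = measure ?D ?good + measure ?D (- ?good)"
    by (rule measure_spmf.finite_measure_Union) auto
  ultimately show ?thesis using bad by simp
qed

text \<open>The worst case bounds the expectation; losslessness enters because non-termination
  counts as infinite time.\<close>

lemma expected_time_le:
  assumes "lossless_spmf r" "\<And>s. s \<in> set_spmf r \<Longrightarrow> real (elapsed s) \<le> T"
  shows "expected_time r \<le> ennreal T"
proof -
  have "expected_time r \<le> (\<integral>\<^sup>+ x. ennreal T \<partial>measure_pmf r)"
    unfolding expected_time_def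
  proof (rule nn_integral_mono_AE, rule AE_pmfI)
    fix x assume x: "x \<in> set_pmf r"
    show "(case x of None \<Rightarrow> \<infinity> | Some s \<Rightarrow> of_nat (elapsed s)) \<le> ennreal T"
    proof (cases x)
      case None
      with x assms(1) show ?thesis by (simp add: lossless_iff_set_pmf_None)
    next
      case (Some s)
      with x have "s \<in> set_spmf r" by (simp add: in_set_spmf)
      from assms(2)[OF this] Some show ?thesis
        by (simp flip: ennreal_of_nat_eq_real_of_nat add: ennreal_leI)
    qed
  qed
  also have "\<dots> = ennreal T" by simp
  finally show ?thesis .
qed

text \<open>Since 4 c (1 - c) = 1 - (1 - 2 c) ^ 2 is below 1, a constant number of votes lowers the
  error bound below any fixed threshold.\<close>

lemma exists_votes:
  fixes c :: real
  assumes "0 < c" "c < 1 / 2"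
  obtains C0 :: nat where "(2 * sqrt (c * (1 - c))) ^ C0 \<le> (1 / 2) ^ 17"
proof -
  have "0 < (1 - 2 * c)\<^sup>2" using assms by simp
  then have "4 * (c * (1 - c)) < 1" by (simp add: power2_eq_square algebra_simps)
  then have "sqrt (4 * (c * (1 - c))) < 1" by simp
  then have "2 * sqrt (c * (1 - c)) < 1" by (simp add: real_sqrt_mult)
  then obtain C0 where "(2 * sqrt (c * (1 - c))) ^ C0 < (1 / 2) ^ 17"
    using real_arch_pow_inv[of "(1 / 2) ^ 17" "2 * sqrt (c * (1 - c))"] by auto
  then show thesis by (rule that[OF less_imp_le])
qed

lemma linear_bigo: "(\<lambda>k. a * real k + b) \<in> O(\<lambda>k. real k)"
proof (rule bigoI)
  show "\<forall>\<^sub>F k in at_top. norm (a * real k + b) \<le> (\<bar>a\<bar> + \<bar>b\<bar>) * norm (real k)"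
  proof (rule eventually_at_top_linorderI)
    fix k :: nat assume "1 \<le> k"
    then have "\<bar>b\<bar> * 1 \<le> \<bar>b\<bar> * real k" by (intro mult_left_mono) auto
    moreover have "\<bar>a * real k + b\<bar> \<le> \<bar>a\<bar> * real k + \<bar>b\<bar>"
      using abs_triangle_ineq[of "a * real k" b] by (simp add: abs_mult)
    ultimately show "norm (a * real k + b) \<le> (\<bar>a\<bar> + \<bar>b\<bar>) * norm (real k)"
      by (simp add: algebra_simps)
  qed
qed

theorem theorem11:
  fixes \<P> :: problem and c :: real
  assumes "witness_problem \<P>" and "c < 1 / 2"
  shows "\<exists>(alg :: real \<Rightarrow> real \<Rightarrow> nat \<Rightarrow> com) (f :: nat \<Rightarrow> real).
    f \<in> O(\<lambda>k. real k) \<and>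
    (\<forall>\<epsilon> \<delta> M. 0 < \<epsilon> \<and> \<epsilon> < 1 \<and> 0 < \<delta> \<and> \<delta> \<le> 1 / 2 \<and> 1 \<le> M \<longrightarrow>
      (\<forall>I \<in> instances \<P>. \<forall>Or. randomised_oracle \<P> I c Or \<longrightarrow>
        lossless_spmf (with_oracle Or (alg \<epsilon> \<delta> M) I) \<and>
        (2 \<le> usize I \<longrightarrow> (\<forall>s \<in> set_spmf (with_oracle Or (alg \<epsilon> \<delta> M) I).
           real (calls s) \<le>
             2 powr f (param I) * log 2 (real (usize I)) ^ 3 * real M * log 2 (1 / \<delta>))) \<and>
        measure (measure_spmf (with_oracle Or (alg \<epsilon> \<delta> M) I))
          {s. good_result \<epsilon> M (card (witnesses \<P> I)) (result s)} \<ge> 1 - \<delta>)) \<and>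
    (\<forall>d g a. computable g \<and> solves_decision \<P> c d \<and> decision_time \<P> d g a \<longrightarrow>
      (\<exists>(h :: nat \<Rightarrow> real) (b :: nat). h \<in> O(\<lambda>k. real k) \<and>
        (\<forall>\<epsilon> \<delta> M. 0 < \<epsilon> \<and> \<epsilon> < 1 \<and> 0 < \<delta> \<and> \<delta> \<le> 1 / 2 \<and> 1 \<le> M \<longrightarrow>
          (\<forall>I \<in> instances \<P>. 2 \<le> usize I \<longrightarrow>
            expected_time (with_decision d (alg \<epsilon> \<delta> M) I) \<le>
              ennreal (2 powr h (param I) * real (g (param I)) * real (usize I) ^ b
                       * real M * log 2 (1 / \<delta>))))))"
proof -
  \<comment> \<open>The analysis of the vote divides by the error bound, so it is raised to a
    positive value that is still below 1 / 2.\<close>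
  define c' where "c' = max c (1 / 4)"
  have c': "0 < c'" "c' < 1 / 2" "c \<le> c'" using assms(2) by (auto simp: c'_def)
  obtain C0 where C0: "(2 * sqrt (c' * (1 - c'))) ^ C0 \<le> (1 / 2) ^ 17"
    using exists_votes[OF c'(1,2)] .
  obtain A where A: "\<And>n k M \<rho> \<tau>. 2 \<le> n \<Longrightarrow> 1 \<le> M \<Longrightarrow> 1 \<le> \<rho> \<Longrightarrow> 1 \<le> \<tau> \<Longrightarrow>
    seq_time (setup_phases C0 M \<rho>) (init_mem n k) +
      time_bound \<tau> (\<lambda>x. dsem (seq_of (setup_phases C0 M \<rho>)) (init_mem n k) x 0) (count_loop M ;; emit M)
    \<le> 2 ^ (A * (k + 1)) * n ^ A * (M * \<rho> * \<tau>)"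
    using tame_total[of C0] by blast
  define alg where "alg \<epsilon> \<delta> M = com_of (algorithm C0 M (repetitions \<delta>))" for \<epsilon> \<delta> :: real and M
  define f where "f k = 9 * real k + real (15 + C0)" for k
  have oracle_part: "lossless_spmf (with_oracle Or (alg \<epsilon> \<delta> M) I) \<and>
        (2 \<le> usize I \<longrightarrow> (\<forall>s \<in> set_spmf (with_oracle Or (alg \<epsilon> \<delta> M) I).
           real (calls s) \<le>
             2 powr f (param I) * log 2 (real (usize I)) ^ 3 * real M * log 2 (1 / \<delta>))) \<and>
        measure (measure_spmf (with_oracle Or (alg \<epsilon> \<delta> M) I))
          {s. good_result \<epsilon> M (card (witnesses \<P> I)) (result s)} \<ge> 1 - \<delta>"
    if *: "0 < \<epsilon>" "0 < \<delta>" "\<delta> \<le> 1 / 2" "1 \<le> M" and I: "I \<in> instances \<P>" and or: "randomised_oracle \<P> I c Or"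
    for \<epsilon> \<delta> M I Or
  proof -
    define Or' where "Or' i X = spmf_of_pmf (map_pmf (\<lambda>b. (b, 0 :: nat)) (Or i X))" for i X
    have eq: "with_oracle Or (alg \<epsilon> \<delta> M) I =
        exec Or' (com_of (algorithm C0 M (repetitions \<delta>))) (start (init_mem (usize I) (param I)))"
      unfolding with_oracle_def counting_run_eq alg_def Or'_def by simp
    have runs: "runs_within Or' (algorithm C0 M (repetitions \<delta>)) (start (init_mem (usize I) (param I)))
     (seq_time (setup_phases C0 M (repetitions \<delta>)) (init_mem (usize I) (param I)) +
       time_bound 0 (\<lambda>x. dsem (seq_of (setup_phases C0 M (repetitions \<delta>))) (init_mem (usize I) (param I)) x 0) (count_loop M ;; emit M))
     (repetitions \<delta> * (steps (usize I) (param I) * (16 * M) * votes C0 (usize I) (param I)))"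
      by (rule runs_within_algorithm) (auto simp: Or'_def)
    then have lossless: "lossless_spmf (with_oracle Or (alg \<epsilon> \<delta> M) I)"
      by (simp add: runs_within_def eq)
    have "real (calls s) \<le> 2 powr f (param I) * log 2 (real (usize I)) ^ 3 * real M * log 2 (1 / \<delta>)"
      if n: "2 \<le> usize I" and s: "s \<in> set_spmf (with_oracle Or (alg \<epsilon> \<delta> M) I)" for s
    proof -
      have "calls s \<le> repetitions \<delta> * (steps (usize I) (param I) * (16 * M) * votes C0 (usize I) (param I))"
        using runs s by (auto simp: runs_within_def eq start_def)
      then have "real (calls s) \<le> real (repetitions \<delta> * (steps (usize I) (param I) * (16 * M) * votes C0 (usize I) (param I)))"
        by (rule of_nat_mono)
      also have "\<dots> \<le> 2 powr f (param I) * log 2 (real (usize I)) ^ 3 * real M * log 2 (1 / \<delta>)"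
        unfolding f_def by (rule calls_le[OF n repetitions(2)[OF *(2,3)]])
      finally show ?thesis .
    qed
    moreover have "1 - \<delta> \<le> measure (measure_spmf (with_oracle Or (alg \<epsilon> \<delta> M) I))
          {s. good_result \<epsilon> M (card (witnesses \<P> I)) (result s)}"
      unfolding eq
    proof (rule good_result_prob[OF _ c'(1,2) _ C0 *(4,1-3) lossless[unfolded eq]])
      show "W \<subseteq> {..<usize I} \<and> card W = param I" if "W \<in> witnesses \<P> I" for W
        using assms(1) I that by (auto simp: witness_problem_def)
      fix i X assume X: "X \<subseteq> {..<usize I}"
      let ?b = "\<exists>W\<in>witnesses \<P> I. W \<subseteq> X"
      have "measure (measure_spmf (Or' i X)) {bt. fst bt \<noteq> ?b} = measure (measure_pmf (Or i X)) {\<not> ?b}"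
        unfolding Or'_def by (auto simp: vimage_def intro!: arg_cong[where f = "measure _"])
      also have "\<dots> \<le> c'"
        using or X c'(3) by (auto simp: randomised_oracle_def contains_witness_def measure_pmf_single intro: order.trans)
      finally show "measure (measure_spmf (Or' i X)) {bt. fst bt \<noteq> ?b} \<le> c'" .
    qed
    ultimately show ?thesis using lossless by blast
  qed
  have decision_part: "\<exists>(h :: nat \<Rightarrow> real) (b :: nat). h \<in> O(\<lambda>k. real k) \<and>
        (\<forall>\<epsilon> \<delta> M. 0 < \<epsilon> \<and> \<epsilon> < 1 \<and> 0 < \<delta> \<and> \<delta> \<le> 1 / 2 \<and> 1 \<le> M \<longrightarrow>
          (\<forall>I \<in> instances \<P>. 2 \<le> usize I \<longrightarrow>
            expected_time (with_decision d (alg \<epsilon> \<delta> M) I) \<le>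
              ennreal (2 powr h (param I) * real (g (param I)) * real (usize I) ^ b
                       * real M * log 2 (1 / \<delta>))))"
    if d: "solves_decision \<P> c d" "decision_time \<P> d g a" for d g a
  proof -
    \<comment> \<open>The exponent is A (k + 1) + 3, where 2 ^ 3 absorbs the factor 6 from the
      number of repetitions.\<close>
    define h where "h k = real A * real k + real (A + 3)" for k
    have "expected_time (with_decision d (alg \<epsilon> \<delta> M) I) \<le>
        ennreal (2 powr h (param I) * real (g (param I)) * real (usize I) ^ (A + a) * real M * log 2 (1 / \<delta>))"
      if *: "0 < \<delta>" "\<delta> \<le> 1 / 2" "1 \<le> M" and I: "I \<in> instances \<P>" and n: "2 \<le> usize I" for \<epsilon> \<delta> M I
    proof -
      define n k where "n = usize I" and "k = param I"
      define \<tau> where "\<tau> = g k * n ^ a"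
      define \<rho> where "\<rho> = repetitions \<delta>"
      define Or where "Or i X = map_spmf (\<lambda>s. (accepts s, elapsed s)) (decision_run d I X)" for i :: nat and X
      have lossless: "lossless_spmf (decision_run d I X)" and time: "s \<in> set_spmf (decision_run d I X) \<Longrightarrow> elapsed s \<le> \<tau>"
        if "X \<subseteq> {..<n}" for X s
        using d I n that by (auto simp: solves_decision_def decision_time_def n_def k_def \<tau>_def)
      \<comment> \<open>The decision algorithm terminates on the empty set with positive
        probability, and any such run already takes time.\<close>
      have \<tau>: "1 \<le> \<tau>"
      proof -
        have "set_spmf (decision_run d I {}) \<noteq> {}"
          using lossless[of "{}"] measure_spmf_zero_iff[of "decision_run d I {}" UNIV]
          by (auto simp: lossless_spmf_def weight_spmf_def space_measure_spmf)
        then obtain s where s: "s \<in> set_spmf (decision_run d I {})" by blast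
        have "0 < elapsed s"
          using exec_elapsed[OF s[unfolded decision_run_def]] by simp
        with time[OF _ s] show ?thesis by simp
      qed
      have \<rho>: "1 \<le> \<rho>" "real \<rho> \<le> 6 * log 2 (1 / \<delta>)" and l: "1 \<le> log 2 (1 / \<delta>)"
        using repetitions[OF *(1,2)] by (auto simp: \<rho>_def)
      have eq: "with_decision d (alg \<epsilon> \<delta> M) I = exec Or (com_of (algorithm C0 M \<rho>)) (start (init_mem n k))"
        unfolding with_decision_def counting_run_eq alg_def Or_def n_def k_def \<rho>_def by simp
      have "runs_within Or (algorithm C0 M \<rho>) (start (init_mem n k))
         (seq_time (setup_phases C0 M \<rho>) (init_mem n k) +
           time_bound \<tau> (\<lambda>x. dsem (seq_of (setup_phases C0 M \<rho>)) (init_mem n k) x 0) (count_loop M ;; emit M))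
         (\<rho> * (steps n k * (16 * M) * votes C0 n k))"
        by (rule runs_within_algorithm) (use lossless time in \<open>auto simp: Or_def\<close>)
      then have runs: "runs_within Or (algorithm C0 M \<rho>) (start (init_mem n k))
         (2 ^ (A * (k + 1)) * n ^ A * (M * \<rho> * \<tau>)) (\<rho> * (steps n k * (16 * M) * votes C0 n k))"
        by (rule runs_within_mono) (use A[of n M \<rho> \<tau> k] n *(3) \<rho>(1) \<tau> in \<open>auto simp: n_def\<close>)
      show ?thesis
      proof (rule expected_time_le)
        show "lossless_spmf (with_decision d (alg \<epsilon> \<delta> M) I)"
          using runs by (simp add: runs_within_def eq)
        fix s assume "s \<in> set_spmf (with_decision d (alg \<epsilon> \<delta> M) I)"
        then have "elapsed s \<le> 2 ^ (A * (k + 1)) * n ^ A * (M * \<rho> * \<tau>)"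
          using runs by (auto simp: runs_within_def eq start_def)
        then have "real (elapsed s) \<le> real (2 ^ (A * (k + 1)) * n ^ A * (M * \<rho> * \<tau>))"
          by (rule of_nat_mono)
        also have "\<dots> = 2 ^ (A * (k + 1)) * real n ^ A * (real M * real \<rho> * real \<tau>)"
          by simp
        also have "\<dots> \<le> 2 ^ (A * (k + 1)) * real n ^ A * (real M * (2 ^ 3 * log 2 (1 / \<delta>)) * real \<tau>)"
          using \<rho>(2) l by (intro mult_left_mono mult_right_mono) auto
        also have "\<dots> = (2 ^ (A * (k + 1)) * 2 ^ 3) * real (g k) * real n ^ (A + a) * real M * log 2 (1 / \<delta>)"
          by (simp add: \<tau>_def power_add mult_ac)
        also have "2 ^ (A * (k + 1)) * 2 ^ 3 = 2 powr h k"
        proof -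
          have "2 powr h k = 2 powr real (A * (k + 1) + 3)" by (simp add: h_def algebra_simps)
          also have "\<dots> = 2 ^ (A * (k + 1) + 3)" by (rule powr_realpow) simp
          finally show ?thesis by (simp only: power_add)
        qed
        finally show "real (elapsed s) \<le> 2 powr h (param I) * real (g (param I)) * real (usize I) ^ (A + a) * real M * log 2 (1 / \<delta>)"
          by (simp only: n_def k_def)
      qed
    qed
    moreover have "h \<in> O(\<lambda>k. real k)"
      unfolding h_def by (rule linear_bigo)
    ultimately show ?thesis by blast
  qed
  have "f \<in> O(\<lambda>k. real k)"
    unfolding f_def by (rule linear_bigo)
  then show ?thesis
    using oracle_part decision_part by (intro exI[of _ alg] exI[of _ f]) blast
qed

end
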